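(* Let $N,k\ge 1$ be integers, let $\bm z=(z_1,\dots,z_k)$ and $\bm w=(w_1,\dots,w_k)$ be vectors in $\mathbb{C}^k$, let $Z=\mathrm{diag}(\bm z)$, $W=\mathrm{diag}(\bm w)$, and let $\Omega,\Sigma$ be deterministic complex $N\times N$ matrices. Let $G$ be an $N\times N$ complex Ginibre matrix and set $$R_N(\bm z,\bm w;\Omega,\Sigma)=\mathbb{E}\Big(\prod_{j=1}^{k}\det(\Omega G-z_jI_N)\det(\Sigma G^\dagger-w_jI_N)\Big).$$ (i) If all $z_j,w_j$ are nonzero, then $$R_N(\bm z,\bm w;\Omega,\Sigma)=\det(ZW)^N\,\mathbb{E}_X\Big[\det\big(I_{kN}+\Omega\Sigma\otimes Z^{-1}XW^{-1}X^\dagger\big)\Big],$$ where $\mathbb{E}_X$ is the expectation over a $k\times k$ complex Ginibre matrix $X$. (ii) If $\Omega=\Sigma=I_N$, then $$R_N(\bm z,\bm w;I_N,I_N)=\frac{1}{\pi^{k^2}}\int_{\mathbb{C}^{k\times k}}dX\,e^{-\mathrm{Tr}XX^\dagger}\det\begin{pmatrix}Z&X\\-X^\dagger&W\end{pmatrix}^{N},$$ and, if moreover $z_1,\dots,z_k$ are distinct and $w_1,\dots,w_k$ are distinct, this equals $$\Big(\prod_{j=1}^{k}(N+j-1)!\Big)\frac{\det\Big\{\sum_{l=0}^{N+k-1}\frac{(z_iw_j)^l}{l!}\Big\}_{i,j=1}^{k}}{\Delta(\bm z)\Delta(\bm w)}.$$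
   Context: An $n\times n$ complex Ginibre matrix is a random matrix with law $\pi^{-n^2}\exp(-\mathrm{Tr}(GG^\dagger))\,dG$ on $\mathbb{C}^{n\times n}$, where $dG$ is Lebesgue measure (i.i.d. standard complex Gaussian entries with $\mathbb{E}|G_{ij}|^2=1$). $\otimes$ is the Kronecker product, $\dagger$ the conjugate transpose, and $\Delta(\bm z)=\prod_{1\le i<j\le k}(z_j-z_i)$. In the integral, $dX$ is Lebesgue measure on $\mathbb{C}^{k\times k}$. *)

theory Defs
  imports "HOL-Analysis.Analysis"
begin

definition conj_transpose :: "complex^'m^'n \<Rightarrow> complex^'n^'m" where
  "conj_transpose A = (\<chi> i j. cnj (A $ j $ i))"

definition diag_mat :: "'a::zero^'n \<Rightarrow> 'a^'n^'n" where
  "diag_mat v = (\<chi> i j. if i = j then v $ i else 0)"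

definition kronecker :: "'a::times^'n^'m \<Rightarrow> 'a^'q^'p \<Rightarrow> 'a^('n \<times> 'q)^('m \<times> 'p)" where
  "kronecker A B = (\<chi> r c. A $ fst r $ fst c * B $ snd r $ snd c)"

definition block_mat ::
  "'a^'n^'m \<Rightarrow> 'a^'q^'m \<Rightarrow> 'a^'n^'p \<Rightarrow> 'a^'q^'p \<Rightarrow> 'a^('n + 'q)^('m + 'p)" where
  "block_mat A B C D =
     (\<chi> r c. case r of
        Inl i \<Rightarrow> (case c of Inl j \<Rightarrow> A $ i $ j | Inr j \<Rightarrow> B $ i $ j)
      | Inr i \<Rightarrow> (case c of Inl j \<Rightarrow> C $ i $ j | Inr j \<Rightarrow> D $ i $ j))"

definition vandermonde :: "'a::comm_ring_1^'k::{finite,linorder} \<Rightarrow> 'a" where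
  "vandermonde z = (\<Prod>(i, j) \<in> {(i, j). i < j}. z $ j - z $ i)"

(* lborel on complex^'n^'n is Lebesgue measure in the real and imaginary parts of the entries;
   Tr (G G^dagger) is real, so Re only adjusts the type. *)
definition ginibre :: "(complex^'n^'n) measure" where
  "ginibre = density lborel
     (\<lambda>G. ennreal (exp (- Re (trace (G ** conj_transpose G))) / pi ^ (CARD('n)\<^sup>2)))"

(* The expectation of a function of a Ginibre matrix is the Bochner
   integral against its law; all integrands are polynomials in the real and imaginary parts of
   the entries, so the convention for non-integrable functions plays no role. *)
definition R_N ::
  "complex^'k \<Rightarrow> complex^'k \<Rightarrow> complex^'n^'n \<Rightarrow> complex^'n^'n \<Rightarrow> complex" where
  "R_N z w Om Sg =
     (LINT G|ginibre. (\<Prod>j\<in>UNIV. det (Om ** G - mat (z $ j)) *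
                                det (Sg ** conj_transpose G - mat (w $ j))))"

end

theory Submission
  imports Defs "HOL-Probability.Distributions" "HOL-Computational_Algebra.Polynomial"
begin

text \<open>
  By Gaussian integration by parts the expectation of \<open>det (M + L x)\<close>, with \<open>L\<close> linear, depends on \<open>L\<close>
  only through the covariances of pairs of rows, antisymmetrised in their columns: a pair of rows of a
  determinant is alternating. The block diagonal matrix with blocks \<open>\<Omega>G \<otimes> I\<close> and \<open>\<Sigma>G\<^sup>\<dagger> \<otimes> I\<close> and the
  block off-diagonal one with blocks \<open>-\<Omega> \<otimes> X\<close> and \<open>\<Sigma> \<otimes> X\<^sup>\<dagger>\<close> have the same antisymmetrised covariances, so the
  average over \<open>G\<close> equals one over \<open>X\<close>; a Schur complement gives (i), and the block structure
  for \<open>\<Omega> = \<Sigma> = I\<close> gives the integral in (ii).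

  For the determinant, write \<open>\<Delta>(z) \<Prod>i. det (z_i - G) = (\<Sum>\<alpha>. S_\<alpha>(G) z^\<alpha>)\<close> with exponents at most
  \<open>m = N + k - 1\<close>. On this sum the operator \<open>tr (G\<^sup>2 \<partial>) - k tr G\<close> acts as a first-order differential
  operator in \<open>z\<close>, and its Gaussian adjoint as a second-order one. Hence the matrix with entries
  \<open>E S_\<alpha>(G) S_\<beta>(G\<^sup>\<dagger>) \<Prod>i. \<alpha>_i!\<close> commutes with the action of a raising and a lowering matrix on
  the exterior power \<open>\<Lambda>\<^sup>k \<complex>\<^sup>m\<^sup>+\<^sup>1\<close>. The commutator of these two matrices is diagonal with distinct gaps,
  so together they generate all matrix units, and the Gram matrix is scalar. Its value is found at the
  top exponents, where \<open>S_\<alpha>\<close> is \<open>\<plusminus>1\<close>; the Cauchy--Binet formula then sums the series.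
\<close>

section \<open>Gaussian integration by parts\<close>

text \<open>The two random matrices in the duality have different covariances; they agree only after
  exchanging the two columns with a sign, hence the comparison in antisymmetrised form. The
  determinant formula uses no group integral and no eigenvalue density. The operator in
  \<open>G\<close> is chosen so that in \<open>z\<close> it becomes
  \<open>\<Sum>i. m z_i - z_i^2 \<partial>_i\<close>, which sends \<open>z^a\<close> to
  \<open>(m - a) z^(a+1)\<close> and so stops exactly at the largest exponent; the term
  \<open>k tr G\<close> cancels the traces produced by the \<open>k\<close> factors. The Gaussian
  adjoint becomes \<open>\<Sum>i. m \<partial>_i - z_i \<partial>_i^2\<close>. The resulting
  relation carries different weights on its two sides, and the factors \<open>\<alpha>_i!\<close>
  turn it into commutation with a single matrix. Derivatives of \<open>\<Delta>\<close> bring in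
  \<open>1 / (z_i - z_j)\<close>, so these identities hold at distinct points; coefficients are
  recovered because a polynomial that vanishes at all points with distinct coordinates is
  zero.\<close>

definition gauss :: "'a::euclidean_space measure" where
  "gauss = density lborel (\<lambda>x. ennreal (exp (- (norm x)\<^sup>2) / sqrt pi ^ DIM('a)))"

text \<open>Polynomial growth is closed under sums and products and is beaten by the Gaussian
  weight, so integrability of every integrand below follows from its algebraic form.\<close>

definition tame :: "('a::euclidean_space \<Rightarrow> complex) \<Rightarrow> bool" where
  "tame f \<longleftrightarrow> f \<in> borel_measurable borel \<and> (\<exists>C p. \<forall>x. norm (f x) \<le> C * (1 + norm x) ^ p)"

lemma nn_integral_exp_neg_square:
  assumes "0 < c"
  shows "(\<integral>\<^sup>+x. ennreal (exp (- c * x\<^sup>2)) \<partial>lborel) = ennreal (sqrt (pi / c))"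
proof -
  \<comment> \<open>The standard deviation whose normal density is proportional to
    \<open>exp (- c * x\<^sup>2)\<close>; total mass 1 then gives the integral.\<close>
  define s where "s = sqrt (1 / (2 * c))"
  have s: "s > 0" "2 * s\<^sup>2 = 1 / c" using assms by (auto simp: s_def)
  have "exp (- c * x\<^sup>2) = sqrt (pi / c) * normal_density 0 s x" for x
  proof -
    have "- x\<^sup>2 / (2 * s\<^sup>2) = - c * x\<^sup>2" unfolding s(2) using assms by simp
    moreover have "2 * pi * s\<^sup>2 = pi / c" using s(2) assms by (simp add: field_simps)
    ultimately show ?thesis using assms by (simp add: normal_density_def)
  qed
  then have "(\<integral>\<^sup>+x. ennreal (exp (- c * x\<^sup>2)) \<partial>lborel)
      = (\<integral>\<^sup>+x. ennreal (sqrt (pi / c)) * ennreal (normal_density 0 s x) \<partial>lborel)"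
    using assms by (simp add: ennreal_mult')
  also have "\<dots> = ennreal (sqrt (pi / c)) * (\<integral>\<^sup>+x. ennreal (normal_density 0 s x) \<partial>lborel)"
    by (rule nn_integral_cmult) auto
  also have "(\<integral>\<^sup>+x. ennreal (normal_density 0 s x) \<partial>lborel) = 1"
    using s(1) by (subst nn_integral_eq_integral) auto
  finally show ?thesis by simp
qed

lemma norm_square_sum_Basis: "(norm (x::'a::euclidean_space))\<^sup>2 = (\<Sum>b\<in>Basis. (x \<bullet> b)\<^sup>2)"
  by (subst power2_norm_eq_inner, subst euclidean_inner) (simp add: power2_eq_square)

lemma nn_integral_exp_neg_norm_square:
  assumes "0 < c"
  shows "(\<integral>\<^sup>+(x::'a::euclidean_space). ennreal (exp (- c * (norm x)\<^sup>2)) \<partial>lborel)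
    = ennreal (sqrt (pi / c) ^ DIM('a))"
proof -
  have "ennreal (exp (- c * (norm x)\<^sup>2)) = (\<Prod>b\<in>Basis. ennreal (exp (- c * (x \<bullet> b)\<^sup>2)))" for x :: 'a
    by (simp add: norm_square_sum_Basis sum_distrib_left exp_sum prod_ennreal sum_negf [symmetric])
  then have "(\<integral>\<^sup>+(x::'a). ennreal (exp (- c * (norm x)\<^sup>2)) \<partial>lborel)
     = (\<integral>\<^sup>+(x::'a). (\<Prod>b\<in>Basis. ennreal (exp (- c * (x \<bullet> b)\<^sup>2))) \<partial>lborel)" by simp
  also have "\<dots> = (\<Prod>b\<in>(Basis::'a set). (\<integral>\<^sup>+x. ennreal (exp (- c * x\<^sup>2)) \<partial>lborel))"
    by (rule nn_integral_lborel_prod) auto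
  also have "\<dots> = ennreal (sqrt (pi / c) ^ DIM('a))"
    using nn_integral_exp_neg_square[OF assms] assms by (simp add: ennreal_power)
  finally show ?thesis .
qed

lemma integrable_exp_neg_norm_square:
  assumes "0 < c"
  shows "integrable lborel (\<lambda>x::'a::euclidean_space. exp (- c * (norm x)\<^sup>2))"
  using nn_integral_exp_neg_norm_square[OF assms, where 'a='a]
  by (intro integrableI_nonneg) (auto simp: ennreal_less_top)

lemma space_gauss [simp]: "space gauss = UNIV" "sets gauss = sets borel"
  by (auto simp: gauss_def)

lemma prob_space_gauss: "prob_space (gauss :: 'a::euclidean_space measure)"
proof
  have "emeasure (gauss::'a measure) (space gauss)
     = (\<integral>\<^sup>+(x::'a). ennreal (exp (- (norm x)\<^sup>2) / sqrt pi ^ DIM('a)) \<partial>lborel)"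
    by (simp add: gauss_def emeasure_density)
  also have "\<dots> = (\<integral>\<^sup>+(x::'a). ennreal (1 / sqrt pi ^ DIM('a)) * ennreal (exp (- 1 * (norm x)\<^sup>2)) \<partial>lborel)"
    by (simp add: ennreal_mult'[symmetric])
  also have "\<dots> = ennreal (1 / sqrt pi ^ DIM('a)) * (\<integral>\<^sup>+(x::'a). ennreal (exp (- 1 * (norm x)\<^sup>2)) \<partial>lborel)"
    by (rule nn_integral_cmult) auto
  also have "\<dots> = ennreal (1 / sqrt pi ^ DIM('a)) * ennreal (sqrt pi ^ DIM('a))"
    by (subst nn_integral_exp_neg_norm_square) auto
  also have "\<dots> = 1"
    by (subst ennreal_mult'[symmetric]) auto
  finally show "emeasure (gauss::'a measure) (space gauss) = 1" .
qed

lemma integral_gauss: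
  fixes f :: "'a::euclidean_space \<Rightarrow> complex"
  assumes "f \<in> borel_measurable borel"
  shows "(LINT x|gauss. f x) =
    (LINT x|lborel. of_real (exp (- (norm x)\<^sup>2)) * f x) / of_real (sqrt pi ^ DIM('a))"
proof -
  have "(LINT x|gauss. f x) = (LINT x|lborel. (exp (- (norm x)\<^sup>2) / sqrt pi ^ DIM('a)) *\<^sub>R f x)"
    unfolding gauss_def by (rule integral_density) (use assms in auto)
  also have "\<dots> = (LINT x|lborel. (of_real (exp (- (norm x)\<^sup>2)) * f x) / of_real (sqrt pi ^ DIM('a)))"
    by (intro Bochner_Integration.integral_cong) (auto simp: scaleR_conv_of_real)
  finally show ?thesis by simp
qed

text \<open>One term of the exponential series bounds \<open>(1 + r) ^ p / fact p\<close> by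
  \<open>exp (1 + r)\<close>, and \<open>1 + r \<le> 3/2 + r\<^sup>2 / 2\<close> is
  \<open>(r - 1)\<^sup>2 \<ge> 0\<close>. The rate 1/2 spent here leaves half of the Gaussian weight
  for integrability.\<close>

lemma power_le_exp_norm_square:
  fixes r :: real
  assumes "0 \<le> r"
  shows "(1 + r) ^ p \<le> fact p * exp (3/2) * exp (r\<^sup>2 / 2)"
proof -
  have "(1 + r) ^ p / fact p \<le> exp (1 + r)"
  proof -
    have "(\<Sum>k\<in>{p}. (1 + r) ^ k /\<^sub>R fact k) \<le> (\<Sum>k. (1 + r) ^ k /\<^sub>R fact k)"
      by (rule sum_le_suminf) (use assms summable_exp_generic[of "1 + r"] in auto)
    then show ?thesis by (simp add: exp_def divide_inverse_commute)
  qed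
  also have "\<dots> \<le> exp (3/2 + r\<^sup>2 / 2)"
    using zero_le_power2[of "r - 1"] by (simp add: power2_eq_square algebra_simps)
  finally show ?thesis unfolding exp_add by (simp add: field_simps)
qed

lemma tameE:
  assumes "tame f"
  obtains C where "0 \<le> C" "\<And>x. norm (f x) \<le> C * exp ((norm x)\<^sup>2 / 2)"
proof -
  from assms obtain C p where *: "\<And>x. norm (f x) \<le> C * (1 + norm x) ^ p" by (auto simp: tame_def)
  have "norm (f x) \<le> \<bar>C\<bar> * (fact p * exp (3/2)) * exp ((norm x)\<^sup>2 / 2)" for x
  proof -
    have "norm (f x) \<le> \<bar>C\<bar> * (1 + norm x) ^ p"
      using *[of x] by (smt (verit) mult_right_mono norm_ge_zero zero_le_power)
    also have "\<dots> \<le> \<bar>C\<bar> * (fact p * exp (3/2) * exp ((norm x)\<^sup>2 / 2))"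
      by (intro mult_left_mono power_le_exp_norm_square) auto
    finally show ?thesis by (simp add: mult.assoc)
  qed
  then show ?thesis by (intro that[of "\<bar>C\<bar> * (fact p * exp (3/2))"]) auto
qed

lemma tame_measurable: "tame f \<Longrightarrow> f \<in> borel_measurable borel"
  by (simp add: tame_def)

lemma tame_gauss_bound:
  assumes "tame f"
  obtains C where "0 \<le> C" "\<And>x. norm (of_real (exp (- (norm x)\<^sup>2)) * f x) \<le> C * exp (- (1/2) * (norm x)\<^sup>2)"
proof -
  obtain C where C: "0 \<le> C" "\<And>x. norm (f x) \<le> C * exp ((norm x)\<^sup>2 / 2)" using tameE[OF assms] by blast
  have "norm (of_real (exp (- (norm x)\<^sup>2)) * f x) \<le> C * exp (- (1/2) * (norm x)\<^sup>2)" for x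
  proof -
    have "norm (of_real (exp (- (norm x)\<^sup>2)) * f x) \<le> exp (- (norm x)\<^sup>2) * (C * exp ((norm x)\<^sup>2 / 2))"
      unfolding norm_mult using C(2)[of x] by (intro mult_mono) auto
    also have "\<dots> = C * (exp (- (norm x)\<^sup>2) * exp ((norm x)\<^sup>2 / 2))" by simp
    also have "exp (- (norm x)\<^sup>2) * exp ((norm x)\<^sup>2 / 2) = exp (- (1/2) * (norm x)\<^sup>2)"
      unfolding exp_add[symmetric] by simp
    finally show ?thesis .
  qed
  then show ?thesis using C(1) that by blast
qed

lemma tame_integrable_lborel:
  assumes "tame f"
  shows "integrable lborel (\<lambda>x. of_real (exp (- (norm x)\<^sup>2)) * f x)"
proof -
  obtain C where C: "0 \<le> C" "\<And>x. norm (of_real (exp (- (norm x)\<^sup>2)) * f x) \<le> C * exp (- (1/2) * (norm x)\<^sup>2)"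
    using tame_gauss_bound[OF assms] by blast
  show ?thesis
  proof (rule Bochner_Integration.integrable_bound)
    show "integrable lborel (\<lambda>x::'a. C * exp (- (1/2) * (norm x)\<^sup>2))"
      by (intro integrable_mult_right integrable_exp_neg_norm_square) auto
    show "AE x in lborel. norm (complex_of_real (exp (- (norm x)\<^sup>2)) * f x) \<le> norm (C * exp (- (1/2) * (norm x)\<^sup>2))"
      using C by (intro AE_I2) (smt (verit) real_norm_def)
  qed (use tame_measurable[OF assms] in measurable)
qed

lemma tame_integrable:
  assumes "tame f"
  shows "integrable gauss f"
proof -
  have "integrable lborel (\<lambda>x. (exp (- (norm x)\<^sup>2) / sqrt pi ^ DIM('a)) *\<^sub>R f x)"
    using integrable_divide[OF tame_integrable_lborel[OF assms], of "of_real (sqrt pi ^ DIM('a))"]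
    by (simp add: scaleR_conv_of_real)
  then show ?thesis unfolding gauss_def
    by (subst integrable_density) (use tame_measurable[OF assms] in auto)
qed

section \<open>Stability of polynomial growth\<close>

lemma tame_add:
  assumes "tame f" "tame g"
  shows "tame (\<lambda>x. f x + g x)"
proof -
  from assms obtain C p D q where
    *: "\<And>x. norm (f x) \<le> C * (1 + norm x) ^ p" "\<And>x. norm (g x) \<le> D * (1 + norm x) ^ q"
    by (auto simp: tame_def)
  have "norm (f x + g x) \<le> (\<bar>C\<bar> + \<bar>D\<bar>) * (1 + norm x) ^ (p + q)" for x
  proof -
    have "norm (f x) \<le> \<bar>C\<bar> * (1 + norm x) ^ (p + q)"
      using *(1)[of x] mult_mono[of C "\<bar>C\<bar>" "(1 + norm x) ^ p" "(1 + norm x) ^ (p+q)"]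
      by (smt (verit) norm_ge_zero power_increasing le_add1 zero_le_power)
    moreover have "norm (g x) \<le> \<bar>D\<bar> * (1 + norm x) ^ (p + q)"
      using *(2)[of x] mult_mono[of D "\<bar>D\<bar>" "(1 + norm x) ^ q" "(1 + norm x) ^ (p+q)"]
      by (smt (verit) norm_ge_zero power_increasing le_add2 zero_le_power)
    ultimately show ?thesis using norm_triangle_ineq[of "f x" "g x"] by (simp add: distrib_right)
  qed
  moreover have "(\<lambda>x. f x + g x) \<in> borel_measurable borel"
    using assms by (auto dest!: tame_measurable)
  ultimately show ?thesis unfolding tame_def by blast
qed

lemma tame_mult:
  assumes "tame f" "tame g"
  shows "tame (\<lambda>x. f x * g x)"
proof -
  from assms obtain C p D q where
    *: "\<And>x. norm (f x) \<le> C * (1 + norm x) ^ p" "\<And>x. norm (g x) \<le> D * (1 + norm x) ^ q"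
    by (auto simp: tame_def)
  have "norm (f x * g x) \<le> (C * D) * (1 + norm x) ^ (p + q)" for x
    using mult_mono'[OF *(1)[of x] *(2)[of x]] by (simp add: norm_mult power_add mult_ac)
  moreover have "(\<lambda>x. f x * g x) \<in> borel_measurable borel"
    using assms by (auto dest!: tame_measurable)
  ultimately show ?thesis unfolding tame_def by blast
qed

lemma tame_const: "tame (\<lambda>x. c)"
  unfolding tame_def by (intro conjI exI[of _ "norm c"] exI[of _ 0]) auto

lemma tame_linear:
  assumes "bounded_linear f"
  shows "tame f"
proof -
  interpret bounded_linear f by fact
  obtain K where K: "\<And>x. norm (f x) \<le> norm x * K" "K \<ge> 0" using nonneg_bounded by blast
  have "norm (f x) \<le> K * (1 + norm x) ^ 1" for x
    using K(1)[of x] K(2) by (simp add: algebra_simps)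
  moreover have "f \<in> borel_measurable borel"
    by (intro borel_measurable_continuous_onI linear_continuous_on assms)
  ultimately show ?thesis unfolding tame_def by blast
qed

lemma tame_sum:
  assumes "\<And>i. i \<in> I \<Longrightarrow> tame (f i)"
  shows "tame (\<lambda>x. \<Sum>i\<in>I. f i x)"
  using assms by (induction I rule: infinite_finite_induct) (auto intro: tame_const tame_add)

lemma tame_prod:
  assumes "\<And>i. i \<in> I \<Longrightarrow> tame (f i)"
  shows "tame (\<lambda>x. \<Prod>i\<in>I. f i x)"
  using assms by (induction I rule: infinite_finite_induct) (auto intro: tame_const tame_mult)

lemmas tame_intros = tame_const tame_add tame_mult tame_sum tame_prod

text \<open>By translation invariance of Lebesgue measure every difference quotient of
  \<open>h\<close> has integral zero, and dominated convergence passes to the derivative. This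
  replaces integration by parts in one coordinate followed by Fubini.\<close>

lemma integral_directional_derivative_eq_0:
  fixes h h' :: "'a::euclidean_space \<Rightarrow> complex"
  assumes [measurable]: "h \<in> borel_measurable borel" "h' \<in> borel_measurable borel"
    and C: "\<And>x. norm (h x) \<le> C * exp (- (1/2) * (norm x)\<^sup>2)" "\<And>x. norm (h' x) \<le> C * exp (- (1/2) * (norm x)\<^sup>2)"
    and b: "norm b \<le> 1"
    and der: "\<And>x. ((\<lambda>t. h (x + t *\<^sub>R b)) has_vector_derivative h' x) (at 0)"
  shows "(LINT x|lborel. h' x) = 0"
proof -
  have C0: "0 \<le> C" using order_trans[OF norm_ge_zero C(1)[of 0]] by simp
  have inth: "integrable lborel h"
  proof (rule Bochner_Integration.integrable_bound)
    show "integrable lborel (\<lambda>x::'a. C * exp (- (1/2) * (norm x)\<^sup>2))"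
      by (intro integrable_mult_right integrable_exp_neg_norm_square) auto
    show "AE x in lborel. norm (h x) \<le> norm (C * exp (- (1/2) * (norm x)\<^sup>2))"
      using C(1) C0 by (intro AE_I2) (smt (verit) real_norm_def)
  qed auto
  have der': "((\<lambda>t. h (x + t *\<^sub>R b)) has_vector_derivative h' (x + s *\<^sub>R b)) (at s)" for x s
  proof -
    have *: "((\<lambda>t. h ((x + s *\<^sub>R b) + t *\<^sub>R b)) has_vector_derivative h' (x + s *\<^sub>R b)) (at (s - s))"
      using der[of "x + s *\<^sub>R b"] by simp
    have "((\<lambda>u. u - s) has_vector_derivative 1) (at s)"
      by (auto intro!: derivative_eq_intros)
    from vector_diff_chain_at[OF this, of "\<lambda>t. h ((x + s *\<^sub>R b) + t *\<^sub>R b)"] * show ?thesis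
      by (simp add: o_def algebra_simps)
  qed
  \<comment> \<open>The dominating function: the mean value bound evaluates \<open>h'\<close> at a
    point moved by at most 1, and \<open>|x|^2 \<le> 2 |x + s b|^2 + 2\<close> lowers the decay rate
    from 1/2 to 1/4 at the cost of the constant \<open>exp (1/2)\<close>.\<close>
  have bnd: "norm (h (x + t *\<^sub>R b) - h x) \<le> (C * exp (1/2) * exp (- (1/4) * (norm x)\<^sup>2)) * t"
    if t: "0 \<le> t" "t \<le> 1" for x t
  proof -
    have "norm (h (x + t *\<^sub>R b) - h (x + 0 *\<^sub>R b)) \<le> (C * exp (1/2) * exp (- (1/4) * (norm x)\<^sup>2)) * norm (t - 0)"
    proof (rule differentiable_bound[where S="{0..t}"])
      show "((\<lambda>t. h (x + t *\<^sub>R b)) has_derivative (\<lambda>y. y *\<^sub>R h' (x + s *\<^sub>R b))) (at s within {0..t})" for s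
        using der'[of x s] unfolding has_vector_derivative_def by (rule has_derivative_at_withinI)
      show "onorm (\<lambda>y. y *\<^sub>R h' (x + s *\<^sub>R b)) \<le> C * exp (1/2) * exp (- (1/4) * (norm x)\<^sup>2)" if "s \<in> {0..t}" for s
      proof (rule onorm_le)
        fix y :: real
        have "norm (s *\<^sub>R b) \<le> 1" using that t b mult_mono[of s 1 "norm b" 1] by auto
        then have "norm x \<le> norm (x + s *\<^sub>R b) + 1"
          by (smt (verit) add_diff_cancel norm_triangle_ineq4)
        then have "(norm x)\<^sup>2 \<le> (norm (x + s *\<^sub>R b) + 1)\<^sup>2" by (intro power_mono) auto
        also have "\<dots> \<le> 2 * (norm (x + s *\<^sub>R b))\<^sup>2 + 2"
          using zero_le_power2[of "norm (x + s *\<^sub>R b) - 1"] by (simp add: power2_eq_square algebra_simps)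
        finally have "exp (- (1/2) * (norm (x + s *\<^sub>R b))\<^sup>2) \<le> exp (1/2 + - (1/4) * (norm x)\<^sup>2)" by simp
        also have "\<dots> = exp (1/2) * exp (- (1/4) * (norm x)\<^sup>2)" by (rule exp_add)
        finally have "norm (h' (x + s *\<^sub>R b)) \<le> C * (exp (1/2) * exp (- (1/4) * (norm x)\<^sup>2))"
          using C(2)[of "x + s *\<^sub>R b"] C0 by (smt (verit) mult_left_mono)
        then have "\<bar>y\<bar> * norm (h' (x + s *\<^sub>R b)) \<le> \<bar>y\<bar> * (C * (exp (1/2) * exp (- (1/4) * (norm x)\<^sup>2)))"
          by (intro mult_left_mono) auto
        then show "norm (y *\<^sub>R h' (x + s *\<^sub>R b)) \<le> C * exp (1/2) * exp (- (1/4) * (norm x)\<^sup>2) * norm y"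
          by (simp add: mult_ac)
      qed
    qed (use t in auto)
    then show ?thesis using t by simp
  qed
  define s where "s n x = (h (x + inverse (real (Suc n)) *\<^sub>R b) - h x) /\<^sub>R inverse (real (Suc n))" for n x
  have [measurable]: "s n \<in> borel_measurable borel" for n unfolding s_def by measurable
  have shift: "integrable lborel (\<lambda>x. h (x + c))" "(LINT x|lborel. h (x + c)) = (LINT x|lborel. h x)" for c
  proof -
    have "integrable (distr lborel borel ((+) c)) h" using inth by (simp add: lborel_distr_plus)
    then show "integrable lborel (\<lambda>x. h (x + c))"
      by (subst (asm) integrable_distr_eq) (auto simp: add.commute)
    have "(LINT x|lborel. h x) = (LINT x|distr lborel borel ((+) c). h x)" by (simp add: lborel_distr_plus)
    also have "\<dots> = (LINT x|lborel. h (c + x))" by (subst integral_distr) auto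
    finally show "(LINT x|lborel. h (x + c)) = (LINT x|lborel. h x)" by (simp add: add.commute)
  qed
  have "(\<lambda>n. LINT x|lborel. s n x) \<longlonglongrightarrow> (LINT x|lborel. h' x)"
  proof (rule integral_dominated_convergence)
    show "integrable lborel (\<lambda>x::'a. C * exp (1/2) * exp (- (1/4) * (norm x)\<^sup>2))"
      by (intro integrable_mult_right integrable_exp_neg_norm_square) auto
    show "AE x in lborel. (\<lambda>n. s n x) \<longlonglongrightarrow> h' x"
    proof (rule AE_I2)
      fix x
      have "((\<lambda>t. (h (x + t *\<^sub>R b) - h x) /\<^sub>R t) \<longlongrightarrow> h' x) (at 0)"
      proof -
        have "((\<lambda>t. norm (h (x + t *\<^sub>R b) - h x - t *\<^sub>R h' x) / norm t) \<longlongrightarrow> 0) (at 0)"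
          using der[of x] by (simp add: has_vector_derivative_def has_derivative_at)
        also have "?this \<longleftrightarrow> ((\<lambda>t. norm ((h (x + t *\<^sub>R b) - h x) /\<^sub>R t - h' x)) \<longlongrightarrow> 0) (at 0)"
        proof (rule filterlim_cong[OF refl refl], rule eventually_at_topological[THEN iffD2], intro exI[of _ UNIV] conjI ballI impI)
          fix t :: real assume "t \<noteq> 0"
          then have "(h (x + t *\<^sub>R b) - h x) /\<^sub>R t - h' x = (h (x + t *\<^sub>R b) - h x - t *\<^sub>R h' x) /\<^sub>R t"
            by (simp add: scaleR_diff_right)
          then show "norm (h (x + t *\<^sub>R b) - h x - t *\<^sub>R h' x) / norm t = norm ((h (x + t *\<^sub>R b) - h x) /\<^sub>R t - h' x)"
            by (simp add: divide_inverse_commute)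
        qed auto
        finally show ?thesis by (simp add: tendsto_norm_zero_iff LIM_zero_iff)
      qed
      moreover have "filterlim (\<lambda>n. inverse (real (Suc n))) (at 0) sequentially"
        using LIMSEQ_inverse_real_of_nat by (auto simp: filterlim_at)
      ultimately show "(\<lambda>n. s n x) \<longlonglongrightarrow> h' x"
        unfolding s_def by (rule filterlim_compose)
    qed
    show "AE x in lborel. norm (s n x) \<le> C * exp (1/2) * exp (- (1/4) * (norm x)\<^sup>2)" for n
    proof (rule AE_I2)
      fix x
      have "norm (h (x + inverse (real (Suc n)) *\<^sub>R b) - h x)
        \<le> (C * exp (1/2) * exp (- (1/4) * (norm x)\<^sup>2)) * inverse (real (Suc n))"
        by (rule bnd) (auto simp: field_simps)
      then show "norm (s n x) \<le> C * exp (1/2) * exp (- (1/4) * (norm x)\<^sup>2)"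
        unfolding s_def norm_scaleR by (simp add: field_simps)
    qed
  qed auto
  moreover have "(LINT x|lborel. s n x) = 0" for n
    unfolding s_def using shift inth by simp
  ultimately show ?thesis by (simp add: LIMSEQ_const_iff)
qed

text \<open>The derivative of \<open>exp (- |x|^2) f x\<close> along \<open>b\<close> is
  \<open>exp (- |x|^2)\<close> times \<open>f' x - 2 (x \<bullet> b) f x\<close>, and its integral
  vanishes. The factor 1/2 is the variance of one real coordinate in this normalisation.\<close>

theorem Stein:
  fixes f f' :: "'a::euclidean_space \<Rightarrow> complex"
  assumes "tame f" "tame f'" and b: "b \<in> Basis"
    and der: "\<And>x. ((\<lambda>t. f (x + t *\<^sub>R b)) has_vector_derivative f' x) (at 0)"
  shows "(LINT x|gauss. of_real (x \<bullet> b) * f x) = (LINT x|gauss. f' x) / 2"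
proof -
  have tb: "tame (\<lambda>x::'a. of_real (x \<bullet> b))"
    by (intro tame_linear bounded_linear_compose[OF bounded_linear_of_real bounded_linear_inner_left])
  define g where "g x = f' x + (- 2) * (of_real (x \<bullet> b) * f x)" for x
  have tg: "tame g" unfolding g_def by (intro tame_intros assms tb)
  obtain C1 where C1: "\<And>x. norm (of_real (exp (- (norm x)\<^sup>2)) * f x) \<le> C1 * exp (- (1/2) * (norm x)\<^sup>2)"
    using tame_gauss_bound[OF assms(1)] by blast
  obtain C2 where C2: "\<And>x. norm (of_real (exp (- (norm x)\<^sup>2)) * g x) \<le> C2 * exp (- (1/2) * (norm x)\<^sup>2)"
    using tame_gauss_bound[OF tg] by blast
  have "(LINT x|lborel. of_real (exp (- (norm x)\<^sup>2)) * g x) = 0"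
  proof (rule integral_directional_derivative_eq_0[where b=b and C="max C1 C2"])
    show "(\<lambda>x. of_real (exp (- (norm x)\<^sup>2)) * f x) \<in> borel_measurable borel"
      "(\<lambda>x. of_real (exp (- (norm x)\<^sup>2)) * g x) \<in> borel_measurable borel"
      using tame_measurable[OF assms(1)] tame_measurable[OF tg] by measurable
    show "norm (of_real (exp (- (norm x)\<^sup>2)) * f x) \<le> max C1 C2 * exp (- (1/2) * (norm x)\<^sup>2)" for x
      using C1[of x] by (rule order_trans) (intro mult_right_mono, auto)
    show "norm (of_real (exp (- (norm x)\<^sup>2)) * g x) \<le> max C1 C2 * exp (- (1/2) * (norm x)\<^sup>2)" for x
      using C2[of x] by (rule order_trans) (intro mult_right_mono, auto)
    show "norm b \<le> 1" using b by simp
    fix x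
    have "(norm (x + t *\<^sub>R b))\<^sup>2 = (norm x)\<^sup>2 + 2 * t * (x \<bullet> b) + t\<^sup>2" for t
      using b unfolding power2_norm_eq_inner by (simp add: inner_simps power2_eq_square inner_commute)
    then have "((\<lambda>t. complex_of_real (exp (- (norm (x + t *\<^sub>R b))\<^sup>2))) has_vector_derivative
        of_real (- 2 * (x \<bullet> b) * exp (- (norm x)\<^sup>2))) (at 0)"
      by (auto intro!: derivative_eq_intros has_vector_derivative_of_real simp flip: has_real_derivative_iff_has_vector_derivative)
    from has_vector_derivative_mult[OF this der[of x]]
    show "((\<lambda>t. of_real (exp (- (norm (x + t *\<^sub>R b))\<^sup>2)) * f (x + t *\<^sub>R b)) has_vector_derivative
        of_real (exp (- (norm x)\<^sup>2)) * g x) (at 0)"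
      by (simp add: g_def algebra_simps)
  qed
  then have "(LINT x|gauss. g x) = 0"
    using tame_measurable[OF tg] by (simp add: integral_gauss)
  moreover have "(LINT x|gauss. g x) = (LINT x|gauss. f' x) + (- 2) * (LINT x|gauss. of_real (x \<bullet> b) * f x)"
    unfolding g_def using tame_integrable[OF assms(2)] tame_integrable[OF tame_mult[OF tb assms(1)]]
    by (subst Bochner_Integration.integral_add) (auto simp del: mult_minus_left)
  ultimately show ?thesis by simp
qed

lemma tame_det:
  fixes A :: "'a::euclidean_space \<Rightarrow> complex^'m^'m"
  assumes "\<And>i j. tame (\<lambda>x. A x $ i $ j)"
  shows "tame (\<lambda>x. det (A x))"
  unfolding det_def by (intro tame_intros assms)

text \<open>One step of Wick's rule. Expanding \<open>u\<close> in coordinates reduces to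
  \<open>Stein\<close>, and the product rule deletes one factor \<open>s\<close> at a time;
  \<open>(\<Sum>b\<in>Basis. u b * l s b) / 2\<close> is the covariance of \<open>u\<close> and
  \<open>l s\<close>.\<close>

lemma Wick_affine:
  fixes u :: "'a::euclidean_space \<Rightarrow> complex" and l :: "'t \<Rightarrow> 'a \<Rightarrow> complex"
  assumes u: "bounded_linear u" and l: "\<And>t. t \<in> T \<Longrightarrow> bounded_linear (l t)" and T: "finite T"
  shows "(LINT x|gauss. u x * (\<Prod>t\<in>T. c t + l t x))
    = (\<Sum>s\<in>T. \<Sum>b\<in>Basis. u b * l s b * (LINT x|gauss. (\<Prod>t\<in>T - {s}. c t + l t x))) / 2"
proof -
  have tf: "tame (\<lambda>x. \<Prod>t\<in>T'. c t + l t x)" if "T' \<subseteq> T" for T'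
    using that by (intro tame_intros tame_linear l) auto
  have ti: "tame (\<lambda>x. of_real (x \<bullet> b) * (\<Prod>t\<in>T. c t + l t x))" for b
    by (intro tame_mult tf tame_linear bounded_linear_compose[OF bounded_linear_of_real bounded_linear_inner_left]) auto
  have rep: "u x = (\<Sum>b\<in>Basis. u b * of_real (x \<bullet> b))" for x
  proof -
    have "u x = u (\<Sum>b\<in>Basis. (x \<bullet> b) *\<^sub>R b)" by (simp add: euclidean_representation)
    also have "\<dots> = (\<Sum>b\<in>Basis. (x \<bullet> b) *\<^sub>R u b)"
      using u by (simp add: linear_sum linear_cmul bounded_linear.linear)
    finally show ?thesis by (simp add: scaleR_conv_of_real mult.commute)
  qed
  have "(LINT x|gauss. u x * (\<Prod>t\<in>T. c t + l t x))
     = (LINT x|gauss. (\<Sum>b\<in>Basis. u b * (of_real (x \<bullet> b) * (\<Prod>t\<in>T. c t + l t x))))"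
    by (intro Bochner_Integration.integral_cong refl, subst rep) (simp add: sum_distrib_right mult.assoc)
  also have "\<dots> = (\<Sum>b\<in>Basis. u b * (LINT x|gauss. of_real (x \<bullet> b) * (\<Prod>t\<in>T. c t + l t x)))"
    using tame_integrable[OF ti] by (subst Bochner_Integration.integral_sum) auto
  also have "\<dots> = (\<Sum>b\<in>Basis. u b * ((\<Sum>s\<in>T. l s b * (LINT x|gauss. (\<Prod>t\<in>T - {s}. c t + l t x))) / 2))"
  proof (intro sum.cong refl arg_cong2[where f="(*)"])
    fix b :: 'a assume b: "b \<in> Basis"
    have "(LINT x|gauss. of_real (x \<bullet> b) * (\<Prod>t\<in>T. c t + l t x))
       = (LINT x|gauss. (\<Sum>s\<in>T. l s b * (\<Prod>t\<in>T - {s}. c t + l t x))) / 2"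
    proof (rule Stein[OF _ _ b])
      show "tame (\<lambda>x. \<Sum>s\<in>T. l s b * (\<Prod>t\<in>T - {s}. c t + l t x))"
        by (intro tame_sum tame_mult tame_const tf) auto
      fix x
      have lin: "l t (x + r *\<^sub>R b) = l t x + of_real r * l t b" if "t \<in> T" for t r
        using l[OF that] by (simp add: linear_add linear_cmul bounded_linear.linear scaleR_conv_of_real)
      \<comment> \<open>The product is differentiated in a complex parameter, where the field
        product rule applies, and then restricted to the real line.\<close>
      have "((\<lambda>z. \<Prod>t\<in>T. c t + (l t x + z * l t b)) has_field_derivative
          (\<Sum>s\<in>T. l s b * (\<Prod>t\<in>T - {s}. c t + (l t x + 0 * l t b)))) (at 0)"
        by (rule has_field_derivative_prod) (auto intro!: derivative_eq_intros)
      then have "((\<lambda>z. \<Prod>t\<in>T. c t + (l t x + z * l t b)) has_field_derivative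
          (\<Sum>s\<in>T. l s b * (\<Prod>t\<in>T - {s}. c t + l t x))) (at (of_real 0))" by simp
      from has_vector_derivative_real_field[OF this]
      have "((\<lambda>r. \<Prod>t\<in>T. c t + (l t x + of_real r * l t b)) has_vector_derivative
          (\<Sum>s\<in>T. l s b * (\<Prod>t\<in>T - {s}. c t + l t x))) (at 0)" .
      then show "((\<lambda>r. \<Prod>t\<in>T. c t + l t (x + r *\<^sub>R b)) has_vector_derivative
          (\<Sum>s\<in>T. l s b * (\<Prod>t\<in>T - {s}. c t + l t x))) (at 0)"
        by (simp add: lin)
    qed (auto intro!: tf)
    also have "(LINT x|gauss. (\<Sum>s\<in>T. l s b * (\<Prod>t\<in>T - {s}. c t + l t x)))
       = (\<Sum>s\<in>T. l s b * (LINT x|gauss. (\<Prod>t\<in>T - {s}. c t + l t x)))"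
      using tame_integrable[OF tf] by (subst Bochner_Integration.integral_sum) auto
    finally show "(LINT x|gauss. of_real (x \<bullet> b) * (\<Prod>t\<in>T. c t + l t x))
      = (\<Sum>s\<in>T. l s b * (LINT x|gauss. (\<Prod>t\<in>T - {s}. c t + l t x))) / 2" .
  qed
  also have "\<dots> = (\<Sum>s\<in>T. \<Sum>b\<in>Basis. u b * l s b * (LINT x|gauss. (\<Prod>t\<in>T - {s}. c t + l t x))) / 2"
    by (subst sum.swap) (simp add: sum_distrib_left sum_divide_distrib mult.assoc)
  finally show ?thesis .
qed

section \<open>Expectations of determinants\<close>

lemma det_upd_sum:
  fixes w :: "'m::finite \<Rightarrow> 'a::comm_ring_1^'m"
  assumes "finite J"
  shows "det (vec_lambda (w(r := \<Sum>j\<in>J. c j *s a j))) = (\<Sum>j\<in>J. c j * det (vec_lambda (w(r := a j))))"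
  using det_linear_row_sum[OF assms, of r "\<lambda>_ j. c j *s a j" w]
    det_row_mul[of r _ "\<lambda>_. a _" w] by (simp add: fun_upd_def)

lemma det_upd_add:
  fixes w :: "'m::finite \<Rightarrow> 'a::comm_ring_1^'m"
  shows "det (vec_lambda (w(r := a + b))) = det (vec_lambda (w(r := a))) + det (vec_lambda (w(r := b)))"
  using det_row_add[of r "\<lambda>_. a" "\<lambda>_. b" w] by (simp add: fun_upd_def)

lemma det_upd_swap:
  fixes w :: "'m::finite \<Rightarrow> 'a::comm_ring_1^'m"
  assumes "r \<noteq> s"
  shows "det (vec_lambda (w(r := a, s := b))) = - det (vec_lambda (w(r := b, s := a)))"
proof -
  define A where "A = vec_lambda (w(r := a, s := b))"
  have "det (\<chi> i. A $ Transposition.transpose r s i) = of_int (sign (Transposition.transpose r s)) * det A"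
    by (rule det_permute_rows) (simp add: permutes_swap_id)
  also have "(\<chi> i. A $ Transposition.transpose r s i) = vec_lambda (w(r := b, s := a))"
    using assms by (auto simp: A_def vec_eq_iff Transposition.transpose_def)
  also have "of_int (sign (Transposition.transpose r s)) = (- 1 :: 'a)"
    using assms by (simp add: sign_swap_id)
  finally show ?thesis by (simp only: A_def) (metis minus_minus mult_minus1)
qed

lemma vec_sum_axis: "(a::'a::comm_ring_1^'m) = (\<Sum>p\<in>UNIV. a $ p *s axis p 1)"
  by (simp add: vec_eq_iff axis_def if_distrib cong: if_cong)

lemma det_upd_two:
  fixes w :: "'m::finite \<Rightarrow> 'a::comm_ring_1^'m"
  assumes "r \<noteq> s"
  shows "det (vec_lambda (w(r := a, s := b)))
    = (\<Sum>p\<in>UNIV. \<Sum>q\<in>UNIV. a $ p * b $ q * det (vec_lambda (w(r := axis p 1, s := axis q 1))))"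
proof -
  have "det (vec_lambda (w(r := a, s := b))) = det (vec_lambda ((w(s := b))(r := a)))"
    using assms by (simp add: fun_upd_twist)
  also have "\<dots> = (\<Sum>p\<in>UNIV. a $ p * det (vec_lambda ((w(s := b))(r := axis p 1))))"
    by (subst (1) vec_sum_axis[of a], subst det_upd_sum) simp_all
  also have "\<dots> = (\<Sum>p\<in>UNIV. a $ p * det (vec_lambda ((w(r := axis p 1))(s := b))))"
    using assms by (simp add: fun_upd_twist)
  also have "\<dots> = (\<Sum>p\<in>UNIV. a $ p * (\<Sum>q\<in>UNIV. b $ q * det (vec_lambda (w(r := axis p 1, s := axis q 1)))))"
    by (subst (1) vec_sum_axis[of b], subst det_upd_sum) simp_all
  finally show ?thesis by (simp add: sum_distrib_left mult.assoc)
qed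

text \<open>Expanding both rows in unit vectors pairs the coefficients \<open>c p q\<close> with
  determinants that change sign under \<open>p \<leftrightarrow> q\<close>. Averaging the sum with
  its transposed copy leaves only the antisymmetric part of \<open>c\<close>, with the factor
  1/2.\<close>

lemma sum_det_upd_antisym:
  fixes w :: "'m::finite \<Rightarrow> complex^'m"
  assumes "r \<noteq> s"
  shows "(\<Sum>b\<in>I. det (vec_lambda (w(r := L b $ r, s := L b $ s))))
    = (\<Sum>p\<in>UNIV. \<Sum>q\<in>UNIV. (\<Sum>b\<in>I. L b $ r $ p * L b $ s $ q - L b $ r $ q * L b $ s $ p)
        * det (vec_lambda (w(r := axis p 1, s := axis q 1)))) / 2"
proof -
  define D where "D p q = det (vec_lambda (w(r := axis p 1, s := axis q 1)))" for p q
  define c where "c p q = (\<Sum>b\<in>I. L b $ r $ p * L b $ s $ q)" for p q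
  have asym: "D p q = - D q p" for p q unfolding D_def by (rule det_upd_swap[OF assms])
  have "(\<Sum>b\<in>I. det (vec_lambda (w(r := L b $ r, s := L b $ s)))) = (\<Sum>b\<in>I. \<Sum>p\<in>UNIV. \<Sum>q\<in>UNIV. L b $ r $ p * L b $ s $ q * D p q)"
    unfolding D_def by (intro sum.cong refl det_upd_two assms)
  also have "\<dots> = (\<Sum>p\<in>UNIV. \<Sum>q\<in>UNIV. c p q * D p q)"
    unfolding c_def sum_distrib_right by (subst sum.swap, rule sum.cong[OF refl], rule sum.swap)
  finally have 1: "(\<Sum>b\<in>I. det (vec_lambda (w(r := L b $ r, s := L b $ s)))) = (\<Sum>p\<in>UNIV. \<Sum>q\<in>UNIV. c p q * D p q)" .
  also have "\<dots> = (\<Sum>p\<in>UNIV. \<Sum>q\<in>UNIV. c q p * D q p)" by (rule sum.swap)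
  also have "\<dots> = (\<Sum>p\<in>UNIV. \<Sum>q\<in>UNIV. - c q p * D p q)"
  proof (intro sum.cong refl)
    fix p q show "c q p * D q p = - c q p * D p q" using asym[of q p] by simp
  qed
  finally have 2: "(\<Sum>b\<in>I. det (vec_lambda (w(r := L b $ r, s := L b $ s)))) = (\<Sum>p\<in>UNIV. \<Sum>q\<in>UNIV. - c q p * D p q)" .
  have half: "x = (y + z) / 2" if "x = y" "x = z" for x y z :: complex
    using that by simp
  have "(\<Sum>b\<in>I. det (vec_lambda (w(r := L b $ r, s := L b $ s))))
     = ((\<Sum>p\<in>UNIV. \<Sum>q\<in>UNIV. c p q * D p q) + (\<Sum>p\<in>UNIV. \<Sum>q\<in>UNIV. - c q p * D p q)) / 2"
    by (rule half[OF 1 2])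
  also have "(\<Sum>p\<in>UNIV. \<Sum>q\<in>UNIV. c p q * D p q) + (\<Sum>p\<in>UNIV. \<Sum>q\<in>UNIV. - c q p * D p q)
     = (\<Sum>p\<in>UNIV. \<Sum>q\<in>UNIV. (c p q - c q p) * D p q)"
    by (simp add: sum.distrib[symmetric] left_diff_distrib)
  finally have "(\<Sum>b\<in>I. det (vec_lambda (w(r := L b $ r, s := L b $ s))))
     = (\<Sum>p\<in>UNIV. \<Sum>q\<in>UNIV. (c p q - c q p) * D p q) / 2" .
  then show ?thesis unfolding D_def c_def sum_subtractf .
qed

text \<open>Contracting two random rows leaves a matrix in which those rows are deterministic. An
  induction over contractions therefore needs arbitrary fixed rows \<open>v\<close> outside the set
  \<open>S\<close> of rows that are still random.\<close>

definition some_random_rows :: "complex^'m^'m \<Rightarrow> ('a::euclidean_space \<Rightarrow> complex^'m^'m) \<Rightarrow> 'm set \<Rightarrow> ('m \<Rightarrow> complex^'m) \<Rightarrow> 'a \<Rightarrow> complex^'m^'m" where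
  "some_random_rows M L S v x = (\<chi> r. if r \<in> S then M $ r + L x $ r else v r)"

context
  fixes M :: "complex^'m::finite^'m" and L :: "'a::euclidean_space \<Rightarrow> complex^'m^'m"
  assumes L: "bounded_linear L"
begin

lemma bounded_linear_entry: "bounded_linear (\<lambda>x. L x $ i $ j)"
  by (intro bounded_linear_compose[OF bounded_linear_vec_nth] bounded_linear_compose[OF bounded_linear_vec_nth L])

lemma tame_det_some_random_rows: "tame (\<lambda>x. det (some_random_rows M L S v x))"
proof (rule tame_det)
  fix i j
  show "tame (\<lambda>x. some_random_rows M L S v x $ i $ j)"
    by (cases "i \<in> S") (simp_all add: some_random_rows_def tame_const tame_add tame_linear bounded_linear_entry)
qed

text \<open>In each term of the Leibniz expansion \<open>Wick_affine\<close> contracts the entry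
  from row \<open>r\<close> with an entry from another random row \<open>s\<close>. Summed over
  permutations again, this is a determinant whose rows \<open>r\<close> and \<open>s\<close> are
  frozen to the values of \<open>L\<close> at one basis vector.\<close>

lemma expectation_det_random_row:
  assumes "r \<notin> S"
  shows "(LINT x|gauss. det (some_random_rows M L S (v(r := L x $ r)) x))
   = (\<Sum>s\<in>S. \<Sum>b\<in>Basis. (LINT x|gauss. det (some_random_rows M L (S - {s}) (v(r := L b $ r, s := L b $ s)) x))) / 2"
proof -
  define sg where "sg p = complex_of_int (sign p)" for p :: "'m \<Rightarrow> 'm"
  define P where "P = {p. p permutes (UNIV :: 'm set)}"
  \<comment> \<open>The contribution of the deterministic rows, which passes unchanged through the
    contraction.\<close>
  define K where "K p = (\<Prod>t\<in>- insert r S. v t $ p t)" for p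
  have tf: "tame (\<lambda>x. \<Prod>t\<in>S'. M $ t $ p t + L x $ t $ p t)" for p S'
    by (intro tame_intros tame_linear bounded_linear_entry)
  have ti: "tame (\<lambda>x. L x $ r $ p r * (\<Prod>t\<in>S. M $ t $ p t + L x $ t $ p t))" for p
    by (intro tame_mult tf tame_linear bounded_linear_entry)
  have split: "(\<Prod>t\<in>UNIV. f t) = f r * (\<Prod>t\<in>S. f t) * (\<Prod>t\<in>- insert r S. f t)" for f :: "'m \<Rightarrow> complex"
  proof -
    have "(\<Prod>t\<in>UNIV. f t) = (\<Prod>t\<in>insert r S. f t) * (\<Prod>t\<in>- insert r S. f t)"
      by (subst prod.union_disjoint[symmetric]) (auto simp: Un_commute intro: prod.cong)
    then show ?thesis using assms by simp
  qed
  have 1: "det (some_random_rows M L S (v(r := L x $ r)) x)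
     = (\<Sum>p\<in>P. sg p * K p * (L x $ r $ p r * (\<Prod>t\<in>S. M $ t $ p t + L x $ t $ p t)))" for x
    unfolding det_def P_def[symmetric] sg_def[symmetric]
  proof (intro sum.cong refl)
    fix p
    have "(\<Prod>t\<in>- insert r S. some_random_rows M L S (v(r := L x $ r)) x $ t $ p t) = K p"
      unfolding K_def by (intro prod.cong) (auto simp: some_random_rows_def)
    moreover have "(\<Prod>t\<in>S. some_random_rows M L S (v(r := L x $ r)) x $ t $ p t) = (\<Prod>t\<in>S. M $ t $ p t + L x $ t $ p t)"
      by (intro prod.cong) (auto simp: some_random_rows_def)
    ultimately show "sg p * (\<Prod>t\<in>UNIV. some_random_rows M L S (v(r := L x $ r)) x $ t $ p t)
      = sg p * K p * (L x $ r $ p r * (\<Prod>t\<in>S. M $ t $ p t + L x $ t $ p t))"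
      using assms by (subst split) (simp add: some_random_rows_def mult_ac)
  qed
  have 2: "(LINT x|gauss. det (some_random_rows M L (S - {s}) (v(r := L b $ r, s := L b $ s)) x))
    = (\<Sum>p\<in>P. sg p * K p * (L b $ r $ p r * L b $ s $ p s * (LINT x|gauss. (\<Prod>t\<in>S - {s}. M $ t $ p t + L x $ t $ p t))))"
    if s: "s \<in> S" for s b
  proof -
    have rs: "r \<noteq> s" using s assms by auto
    have "det (some_random_rows M L (S - {s}) (v(r := L b $ r, s := L b $ s)) x)
       = (\<Sum>p\<in>P. sg p * K p * L b $ r $ p r * L b $ s $ p s * (\<Prod>t\<in>S - {s}. M $ t $ p t + L x $ t $ p t))" for x
      unfolding det_def P_def[symmetric] sg_def[symmetric]
    proof (intro sum.cong refl)
      fix p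
      let ?R = "some_random_rows M L (S - {s}) (v(r := L b $ r, s := L b $ s)) x"
      have "(\<Prod>t\<in>- insert r S. ?R $ t $ p t) = K p"
        unfolding K_def using s by (intro prod.cong) (auto simp: some_random_rows_def)
      moreover have "(\<Prod>t\<in>S. ?R $ t $ p t) = L b $ s $ p s * (\<Prod>t\<in>S - {s}. ?R $ t $ p t)"
        using s by (subst prod.remove[of _ s]) (auto simp: some_random_rows_def)
      moreover have "(\<Prod>t\<in>S - {s}. ?R $ t $ p t) = (\<Prod>t\<in>S - {s}. M $ t $ p t + L x $ t $ p t)"
        by (intro prod.cong) (auto simp: some_random_rows_def)
      moreover have "?R $ r $ p r = L b $ r $ p r" using assms rs by (simp add: some_random_rows_def)
      ultimately show "sg p * (\<Prod>t\<in>UNIV. ?R $ t $ p t)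
        = sg p * K p * L b $ r $ p r * L b $ s $ p s * (\<Prod>t\<in>S - {s}. M $ t $ p t + L x $ t $ p t)"
        by (subst split) (simp add: mult_ac)
    qed
    then have "(LINT x|gauss. det (some_random_rows M L (S - {s}) (v(r := L b $ r, s := L b $ s)) x))
       = (LINT x|gauss. (\<Sum>p\<in>P. sg p * K p * L b $ r $ p r * L b $ s $ p s * (\<Prod>t\<in>S - {s}. M $ t $ p t + L x $ t $ p t)))"
      by simp
    also have "\<dots> = (\<Sum>p\<in>P. sg p * K p * L b $ r $ p r * L b $ s $ p s * (LINT x|gauss. (\<Prod>t\<in>S - {s}. M $ t $ p t + L x $ t $ p t)))"
      using tame_integrable[OF tf] by (subst Bochner_Integration.integral_sum) auto
    finally show ?thesis by (simp add: mult_ac)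
  qed
  have "(LINT x|gauss. det (some_random_rows M L S (v(r := L x $ r)) x))
     = (\<Sum>p\<in>P. sg p * K p * (LINT x|gauss. L x $ r $ p r * (\<Prod>t\<in>S. M $ t $ p t + L x $ t $ p t)))"
    unfolding 1 using tame_integrable[OF ti] by (subst Bochner_Integration.integral_sum) auto
  also have "\<dots> = (\<Sum>p\<in>P. sg p * K p * ((\<Sum>s\<in>S. \<Sum>b\<in>Basis. L b $ r $ p r * L b $ s $ p s
       * (LINT x|gauss. (\<Prod>t\<in>S - {s}. M $ t $ p t + L x $ t $ p t))) / 2))"
    by (subst Wick_affine[OF bounded_linear_entry bounded_linear_entry]) auto
  also have "\<dots> = (\<Sum>p\<in>P. (\<Sum>s\<in>S. \<Sum>b\<in>Basis. sg p * K p * (L b $ r $ p r * L b $ s $ p s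
       * (LINT x|gauss. (\<Prod>t\<in>S - {s}. M $ t $ p t + L x $ t $ p t))))) / 2"
    by (simp add: sum_distrib_left sum_divide_distrib)
  also have "(\<Sum>p\<in>P. (\<Sum>s\<in>S. \<Sum>b\<in>Basis. sg p * K p * (L b $ r $ p r * L b $ s $ p s
       * (LINT x|gauss. (\<Prod>t\<in>S - {s}. M $ t $ p t + L x $ t $ p t)))))
     = (\<Sum>s\<in>S. \<Sum>b\<in>Basis. \<Sum>p\<in>P. sg p * K p * (L b $ r $ p r * L b $ s $ p s
       * (LINT x|gauss. (\<Prod>t\<in>S - {s}. M $ t $ p t + L x $ t $ p t))))"
    by (subst sum.swap, rule sum.cong[OF refl], rule sum.swap)
  also have "\<dots> = (\<Sum>s\<in>S. \<Sum>b\<in>Basis. (LINT x|gauss. det (some_random_rows M L (S - {s}) (v(r := L b $ r, s := L b $ s)) x)))"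
    by (intro sum.cong refl 2[symmetric])
  finally show ?thesis .
qed

text \<open>Linearity in row \<open>r\<close> splits it into its mean, which is frozen, and its
  centred part, which is contracted. Either way fewer random rows remain.\<close>

lemma expectation_det_random_rows_step:
  assumes "r \<notin> S"
  shows "(LINT x|gauss. det (some_random_rows M L (insert r S) v x))
   = (LINT x|gauss. det (some_random_rows M L S (v(r := M $ r)) x))
   + (\<Sum>s\<in>S. \<Sum>b\<in>Basis. (LINT x|gauss. det (some_random_rows M L (S - {s}) (v(r := L b $ r, s := L b $ s)) x))) / 2"
proof -
  define w where "w x t = (if t \<in> S then M $ t + L x $ t else v t)" for x t
  have 1: "some_random_rows M L S (v(r := a)) x = vec_lambda ((w x)(r := a))" for a x
    using assms by (auto simp: some_random_rows_def w_def vec_eq_iff)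
  have "det (some_random_rows M L (insert r S) v x)
      = det (some_random_rows M L S (v(r := M $ r)) x) + det (some_random_rows M L S (v(r := L x $ r)) x)" for x
  proof -
    have "some_random_rows M L (insert r S) v x = vec_lambda ((w x)(r := M $ r + L x $ r))"
      using assms by (auto simp: some_random_rows_def w_def vec_eq_iff)
    then show ?thesis by (simp add: 1 det_upd_add)
  qed
  moreover have "tame (\<lambda>x. det (some_random_rows M L S (v(r := L x $ r)) x))"
  proof (rule tame_det)
    fix i j
    show "tame (\<lambda>x. some_random_rows M L S (v(r := L x $ r)) x $ i $ j)"
      by (cases "i \<in> S"; cases "i = r") (simp_all add: some_random_rows_def tame_const tame_add tame_linear bounded_linear_entry)
  qed
  ultimately have "(LINT x|gauss. det (some_random_rows M L (insert r S) v x))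
   = (LINT x|gauss. det (some_random_rows M L S (v(r := M $ r)) x)) + (LINT x|gauss. det (some_random_rows M L S (v(r := L x $ r)) x))"
    using Bochner_Integration.integral_add[OF tame_integrable[OF tame_det_some_random_rows] tame_integrable]
    by simp
  then show ?thesis by (simp only: expectation_det_random_row[OF assms])
qed

end

text \<open>Both expectations obey the recursion of \<open>expectation_det_random_rows_step\<close>,
  in which the linear map enters only through basis sums of contracted row pairs. By
  \<open>sum_det_upd_antisym\<close> these see nothing but the antisymmetrised covariances, so the
  Gaussian vectors may even live in spaces of different dimension.\<close>

theorem expectation_det_eqI:
  fixes M :: "complex^'m::finite^'m" and L :: "'a::euclidean_space \<Rightarrow> complex^'m^'m"
    and L' :: "'b::euclidean_space \<Rightarrow> complex^'m^'m"
  assumes L: "bounded_linear L" and L': "bounded_linear L'"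
    and cov: "\<And>r s p q. r \<noteq> s \<Longrightarrow> (\<Sum>b\<in>Basis. L b $ r $ p * L b $ s $ q - L b $ r $ q * L b $ s $ p)
        = (\<Sum>b\<in>Basis. L' b $ r $ p * L' b $ s $ q - L' b $ r $ q * L' b $ s $ p)"
  shows "(LINT x|gauss. det (M + L x)) = (LINT y|gauss. det (M + L' y))"
proof -
  interpret ga: prob_space "gauss :: 'a measure" by (rule prob_space_gauss)
  interpret gb: prob_space "gauss :: 'b measure" by (rule prob_space_gauss)
  have "(LINT x|gauss. det (some_random_rows M L S v x)) = (LINT y|gauss. det (some_random_rows M L' S v y))" for S v
  proof (induction "card S" arbitrary: S v rule: less_induct)
    case less
    show ?case
    proof (cases "S = {}")
      case True
      then show ?thesis using ga.prob_space gb.prob_space by (simp add: some_random_rows_def)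
    next
      case False
      then obtain r S' where S: "S = insert r S'" "r \<notin> S'" by (meson Set.set_insert all_not_in_conv)
      then have c: "card S' < card S" "\<And>s. card (S' - {s}) < card S"
        by (auto intro: le_less_trans[OF card_Diff1_le])
      have "(\<Sum>b\<in>Basis. (LINT x|gauss. det (some_random_rows M L (S' - {s}) (v(r := L b $ r, s := L b $ s)) x)))
        = (\<Sum>b\<in>Basis. (LINT y|gauss. det (some_random_rows M L' (S' - {s}) (v(r := L' b $ r, s := L' b $ s)) y)))"
        if s: "s \<in> S'" for s
      proof -
        have rs: "r \<noteq> s" using s S by auto
        define w where "w y t = (if t \<in> S' - {s} then M $ t + L' y $ t else v t)" for y t
        have w: "some_random_rows M L' (S' - {s}) (v(r := a, s := c)) y = vec_lambda ((w y)(r := a, s := c))" for a c y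
          using S by (auto simp: some_random_rows_def w_def vec_eq_iff)
        have "(\<Sum>b\<in>Basis. (LINT x|gauss. det (some_random_rows M L (S' - {s}) (v(r := L b $ r, s := L b $ s)) x)))
          = (\<Sum>b\<in>Basis. (LINT y|gauss. det (some_random_rows M L' (S' - {s}) (v(r := L b $ r, s := L b $ s)) y)))"
          by (intro sum.cong refl less c)
        also have "\<dots> = (LINT y|gauss. (\<Sum>b\<in>Basis. det (some_random_rows M L' (S' - {s}) (v(r := L b $ r, s := L b $ s)) y)))"
          by (subst Bochner_Integration.integral_sum) (auto intro: tame_integrable tame_det_some_random_rows L')
        also have "\<dots> = (LINT y|gauss. (\<Sum>b\<in>Basis. det (some_random_rows M L' (S' - {s}) (v(r := L' b $ r, s := L' b $ s)) y)))"
          unfolding w sum_det_upd_antisym[OF rs] using cov[OF rs] by simp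
        also have "\<dots> = (\<Sum>b\<in>Basis. (LINT y|gauss. det (some_random_rows M L' (S' - {s}) (v(r := L' b $ r, s := L' b $ s)) y)))"
          by (subst Bochner_Integration.integral_sum) (auto intro: tame_integrable tame_det_some_random_rows L')
        finally show ?thesis .
      qed
      then show ?thesis unfolding S
        by (subst (1 2) expectation_det_random_rows_step[OF _ S(2)])
          (simp_all add: L L' less[OF c(1)])
    qed
  qed
  from this[of UNIV] show ?thesis by (simp add: some_random_rows_def plus_vec_def)
qed

section \<open>The duality formula\<close>

text \<open>A permutation that moves an index outside \<open>range f\<close> picks a zero from a
  unit row. The remaining ones permute \<open>range f\<close>, and transport along \<open>f\<close>
  preserves their signs.\<close>

lemma det_embed:
  fixes A :: "'a::comm_ring_1^'n^'n" and M :: "'a^'m^'m"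
  assumes f: "inj f" and A: "\<And>i j. M $ f i $ f j = A $ i $ j"
    and out: "\<And>r s. r \<notin> range f \<Longrightarrow> M $ r $ s = (if r = s then 1 else 0)"
  shows "det M = det A"
proof -
  have "det M = (\<Sum>p\<in>{p. p permutes range f}. of_int (sign p) * (\<Prod>r\<in>UNIV. M $ r $ p r))"
    unfolding det_def
  proof (rule sum.mono_neutral_right)
    show "{p. p permutes range f} \<subseteq> {p. p permutes UNIV}"
      by (auto intro: permutes_subset)
    show "\<forall>p\<in>{p. p permutes UNIV} - {p. p permutes range f}. of_int (sign p) * (\<Prod>r\<in>UNIV. M $ r $ p r) = 0"
    proof
      fix p assume "p \<in> {p. p permutes UNIV} - {p. p permutes range f}"
      then obtain r where r: "r \<notin> range f" "p r \<noteq> r"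
        by (auto simp: permutes_def)
      then have "M $ r $ p r = 0" using out[OF r(1), of "p r"] by auto
      then have "(\<Prod>r\<in>UNIV. M $ r $ p r) = 0" by (intro prod_zero) auto
      then show "of_int (sign p) * (\<Prod>r\<in>UNIV. M $ r $ p r) = 0" by simp
    qed
  qed simp
  also have "\<dots> = (\<Sum>p\<in>{p. p permutes UNIV}. of_int (sign (map_permutation UNIV f p)) * (\<Prod>r\<in>UNIV. M $ r $ map_permutation UNIV f p r))"
  proof (rule sum.reindex_bij_betw[symmetric])
    have "map_permutation UNIV f = (\<lambda>\<pi> x. if x \<in> range f then f (\<pi> (inv_into UNIV f x)) else x)"
      by (auto simp: map_permutation_def restrict_id_def fun_eq_iff)
    then show "bij_betw (map_permutation UNIV f) {p. p permutes UNIV} {p. p permutes range f}"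
      using bij_betw_permutations[of f UNIV "range f"] f by (simp add: bij_betw_def)
  qed
  also have "\<dots> = det A"
    unfolding det_def
  proof (intro sum.cong refl)
    fix p assume "p \<in> {p. p permutes (UNIV :: 'n set)}"
    then have p: "p permutes UNIV" by simp
    have "(\<Prod>r\<in>UNIV. M $ r $ map_permutation UNIV f p r) = (\<Prod>r\<in>range f. M $ r $ map_permutation UNIV f p r)"
    proof (rule prod.mono_neutral_right)
      show "\<forall>r\<in>UNIV - range f. M $ r $ map_permutation UNIV f p r = 1"
        using out by (auto simp: map_permutation_def restrict_id_def)
    qed auto
    also have "\<dots> = (\<Prod>i\<in>UNIV. M $ f i $ map_permutation UNIV f p (f i))"
      by (rule prod.reindex[OF f, unfolded o_def])
    also have "\<dots> = (\<Prod>i\<in>UNIV. A $ i $ p i)"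
      using f by (simp add: map_permutation_apply A)
    finally show "of_int (sign (map_permutation UNIV f p)) * (\<Prod>r\<in>UNIV. M $ r $ map_permutation UNIV f p r)
        = of_int (sign p) * (\<Prod>i\<in>UNIV. A $ i $ p i)"
      using f p by (simp add: sign_map_permutation)
  qed
  finally show ?thesis .
qed

text \<open>Blocks are given by embeddings \<open>f j\<close> and a label \<open>g\<close>, so that
  one lemma covers both orders of a Kronecker index as well as direct sums. \<open>MS S\<close>
  keeps the rows with label in \<open>S\<close> and is the identity elsewhere; adding a label
  multiplies it by a matrix with a single nontrivial block, to which \<open>det_embed\<close>
  applies.\<close>

lemma det_block_diag:
  fixes A :: "'k::finite \<Rightarrow> 'a::comm_ring_1^'n^'n" and M :: "'a^'m^'m"
    and f :: "'k \<Rightarrow> 'n \<Rightarrow> 'm" and g :: "'m \<Rightarrow> 'k"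
  assumes f: "\<And>j. inj (f j)" and g: "\<And>j. range (f j) = {r. g r = j}"
    and A: "\<And>j p q. M $ f j p $ f j q = A j $ p $ q"
    and 0: "\<And>r s. g r \<noteq> g s \<Longrightarrow> M $ r $ s = 0"
  shows "det M = (\<Prod>j\<in>UNIV. det (A j))"
proof -
  define MS where "MS S = (\<chi> r c. if g r \<in> S then M $ r $ c else if r = c then 1 else 0)" for S
  have single: "det (MS {j}) = det (A j)" for j
  proof (rule det_embed[of "f j"])
    have "g (f j i) = j" for i using g[of j] by auto
    then show "MS {j} $ f j p $ f j q = A j $ p $ q" for p q by (simp add: MS_def A)
    show "MS {j} $ r $ s = (if r = s then 1 else 0)" if "r \<notin> range (f j)" for r s
      using that g[of j] by (simp add: MS_def)
  qed (rule f)
  have "det (MS S) = (\<Prod>j\<in>S. det (A j))" for S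
  proof (induction S rule: infinite_finite_induct)
    case empty
    have "MS {} = mat 1" by (simp add: MS_def mat_def)
    then show ?case by simp
  next
    case (insert j S)
    have "MS (insert j S) = MS S ** MS {j}"
    proof (simp only: vec_eq_iff, intro allI)
      fix r c
      have "(MS S ** MS {j}) $ r $ c = (\<Sum>t\<in>UNIV. MS S $ r $ t * MS {j} $ t $ c)"
        by (simp add: matrix_matrix_mult_def)
      also have "\<dots> = MS (insert j S) $ r $ c"
      proof (cases "g r \<in> S")
        case True
        have "MS S $ r $ t * MS {j} $ t $ c = (if t = c then M $ r $ c else 0)" for t
        proof (cases "g t = g r")
          case True
          then show ?thesis using \<open>g r \<in> S\<close> insert(2) by (auto simp: MS_def)
        next
          case False
          then show ?thesis using \<open>g r \<in> S\<close> 0[of r t] by (auto simp: MS_def)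
        qed
        then show ?thesis using True by (simp add: MS_def)
      next
        case False
        then show ?thesis by (simp add: MS_def if_distrib[of "\<lambda>x. x * _"] cong: if_cong)
      qed
      finally show "MS (insert j S) $ r $ c = (MS S ** MS {j}) $ r $ c" by simp
    qed
    then show ?case using insert by (simp add: det_mul single mult.commute)
  qed simp
  from this[of UNIV] show ?thesis by (simp add: MS_def vec_lambda_eta)
qed

section \<open>Block and Kronecker matrices\<close>

lemma sum_UNIV_sum:
  "(\<Sum>x\<in>(UNIV :: ('a::finite + 'b::finite) set). f x) = (\<Sum>a\<in>UNIV. f (Inl a)) + (\<Sum>b\<in>UNIV. f (Inr b))"
  unfolding UNIV_Plus_UNIV[symmetric] by (simp add: sum.Plus del: UNIV_Plus_UNIV)

lemma sum_UNIV_prod: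
  "(\<Sum>x\<in>(UNIV :: ('a::finite \<times> 'b::finite) set). f x) = (\<Sum>a\<in>UNIV. \<Sum>b\<in>UNIV. f (a, b))"
  unfolding UNIV_Times_UNIV[symmetric] by (simp add: sum.cartesian_product)

lemma block_mat_nth [simp]:
  "block_mat A B C D $ Inl i $ Inl j = A $ i $ j" "block_mat A B C D $ Inl i $ Inr j' = B $ i $ j'"
  "block_mat A B C D $ Inr i' $ Inl j = C $ i' $ j" "block_mat A B C D $ Inr i' $ Inr j' = D $ i' $ j'"
  by (simp_all add: block_mat_def)

lemma block_mat_eqI:
  assumes "\<And>i j. M $ Inl i $ Inl j = A $ i $ j" "\<And>i j. M $ Inl i $ Inr j = B $ i $ j"
    "\<And>i j. M $ Inr i $ Inl j = C $ i $ j" "\<And>i j. M $ Inr i $ Inr j = D $ i $ j"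
  shows "M = block_mat A B C D"
proof (simp only: vec_eq_iff, intro allI)
  fix r c show "M $ r $ c = block_mat A B C D $ r $ c"
    by (cases r; cases c) (simp_all add: assms)
qed

lemma block_mat_mult:
  fixes A :: "'a::semiring_1^'n::finite^'m::finite" and B :: "'a^'q::finite^'m" and C :: "'a^'n^'p::finite"
  shows "block_mat A B C D ** block_mat A' B' C' D'
    = block_mat (A ** A' + B ** C') (A ** B' + B ** D') (C ** A' + D ** C') (C ** B' + D ** D')"
  by (rule block_mat_eqI) (simp_all add: matrix_matrix_mult_def sum_UNIV_sum)

lemma det_block_upper_1:
  fixes A :: "'a::comm_ring_1^'n::finite^'n"
  shows "det (block_mat A B 0 (mat 1 :: 'a^'m::finite^'m)) = det A"
proof (rule det_embed[of Inl])
  show "block_mat A B 0 (mat 1) $ r $ s = (if r = s then 1 else 0)" if "r \<notin> range Inl" for r s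
    using that by (cases r; cases s) (auto simp: mat_def)
qed auto

lemma det_block_diag_1:
  fixes D :: "'a::comm_ring_1^'m::finite^'m"
  shows "det (block_mat (mat 1 :: 'a^'n::finite^'n) 0 0 D) = det D"
proof (rule det_embed[of Inr])
  show "block_mat (mat 1) 0 0 D $ r $ s = (if r = s then 1 else 0)" if "r \<notin> range Inr" for r s
    using that by (cases r; cases s) (auto simp: mat_def)
qed auto

lemma det_block_upper:
  fixes A :: "'a::comm_ring_1^'n::finite^'n" and D :: "'a^'m::finite^'m"
  shows "det (block_mat A B 0 D) = det A * det D"
proof -
  have "block_mat A B 0 D = block_mat (mat 1) 0 0 D ** block_mat A B 0 (mat 1)"
    by (simp add: block_mat_mult)
  then show ?thesis by (simp add: det_mul det_block_upper_1 det_block_diag_1)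
qed

text \<open>\<open>C\<close> is eliminated by splitting off the lower unitriangular matrix with
  corner \<open>D' ** C\<close>, whose determinant is read off after transposing.\<close>

lemma det_block_Schur:
  fixes A :: "'a::comm_ring_1^'n::finite^'n" and D :: "'a^'m::finite^'m"
  assumes D: "D ** D' = mat 1" "D' ** D = mat 1"
  shows "det (block_mat A B C D) = det (A - B ** D' ** C) * det D"
proof -
  have 1: "det (block_mat (mat 1 :: 'a^'n^'n) 0 (D' ** C) (mat 1 :: 'a^'m^'m)) = 1"
  proof -
    have "transpose (block_mat (mat 1 :: 'a^'n^'n) 0 (D' ** C) (mat 1 :: 'a^'m^'m))
        = block_mat (mat 1) (transpose (D' ** C)) 0 (mat 1)"
      by (rule block_mat_eqI) (auto simp: transpose_def mat_def)
    then show ?thesis by (metis det_transpose det_block_upper_1 det_I)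
  qed
  have "block_mat A B C D = block_mat (A - B ** D' ** C) B 0 D ** block_mat (mat 1) 0 (D' ** C) (mat 1)"
    by (simp add: block_mat_mult matrix_mul_assoc D)
  then show ?thesis by (simp add: det_mul det_block_upper 1)
qed

lemma kronecker_mult:
  fixes A :: "'a::comm_semiring_1^'n::finite^'m" and B :: "'a^'q::finite^'p"
  shows "kronecker A B ** kronecker C D = kronecker (A ** C) (B ** D)"
  by (simp add: vec_eq_iff kronecker_def matrix_matrix_mult_def sum_UNIV_prod sum_product mult_ac)

lemma kronecker_1: "kronecker (mat 1) (mat 1 :: 'a::semiring_1^'q^'q) = mat 1"
  by (auto simp: vec_eq_iff kronecker_def mat_def)

lemma det_kronecker_1_left:
  fixes B :: "'a::comm_ring_1^'q::finite^'q"
  shows "det (kronecker (mat 1 :: 'a^'n::finite^'n) B) = det B ^ CARD('n)"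
proof -
  have "det (kronecker (mat 1 :: 'a^'n^'n) B) = (\<Prod>j\<in>(UNIV :: 'n set). det B)"
    by (rule det_block_diag[of Pair fst]) (auto simp: kronecker_def mat_def image_iff inj_def)
  then show ?thesis by simp
qed

lemma det_uminus_even:
  fixes A :: "'a::comm_ring_1^'m^'m"
  assumes "even (CARD('m))"
  shows "det (- A) = det A"
  using assms unfolding det_def by (simp add: prod_uminus)

section \<open>Covariances of complex Gaussian matrix entries\<close>

lemma sum_image_eq: "inj_on f A \<Longrightarrow> B = f ` A \<Longrightarrow> sum g B = (\<Sum>x\<in>A. g (f x))"
  by (simp add: sum.reindex)

lemma sum_Basis_complex_matrix:
  fixes F :: "complex^'n::finite^'m::finite \<Rightarrow> complex"
  shows "(\<Sum>b\<in>Basis. F b) = (\<Sum>i\<in>UNIV. \<Sum>j\<in>UNIV. F (axis i (axis j 1)) + F (axis i (axis j \<i>)))"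
proof -
  have 1: "(\<Sum>b\<in>Basis. F' b) = (\<Sum>j\<in>UNIV. F' (axis j 1) + F' (axis j \<i>))" for F' :: "complex^'n \<Rightarrow> complex"
  proof -
    have B: "(Basis :: (complex^'n) set) = (\<lambda>x. axis (fst x) (snd x)) ` (UNIV \<times> {1, \<i>})"
    proof -
      have "(Basis :: (complex^'n) set) = {axis i u | i u. u \<in> Basis}"
        unfolding Basis_vec_def by auto
      then have "(Basis :: (complex^'n) set) = (\<lambda>x. axis (fst x) (snd x)) ` (UNIV \<times> Basis)"
        by (simp add: image_def) blast
      then show ?thesis by (simp only: Basis_complex_def)
    qed
    have "inj_on (\<lambda>x. axis (fst x) (snd x) :: complex^'n) (UNIV \<times> {1, \<i>})"
      by (auto simp: inj_on_def axis_eq_axis)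
    then have "(\<Sum>b\<in>Basis. F' b) = (\<Sum>x\<in>UNIV \<times> {1, \<i>}. F' (axis (fst x) (snd x)))"
      by (rule sum_image_eq[OF _ B])
    also have "\<dots> = (\<Sum>j\<in>UNIV. \<Sum>u\<in>{1, \<i>}. F' (axis j u))"
      by (simp only: sum.cartesian_product case_prod_beta')
    finally show ?thesis by simp
  qed
  have B: "(Basis :: (complex^'n^'m) set) = (\<lambda>x. axis (fst x) (snd x)) ` (UNIV \<times> Basis)"
  proof -
    have "(Basis :: (complex^'n^'m) set) = {axis i u | i u. u \<in> Basis}"
      unfolding Basis_vec_def[where 'a="complex^'n"] by auto
    then show ?thesis by (simp add: image_def) blast
  qed
  have "inj_on (\<lambda>x. axis (fst x) (snd x) :: complex^'n^'m) (UNIV \<times> Basis)"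
    by (auto simp: inj_on_def axis_eq_axis nonzero_Basis)
  then have "(\<Sum>b\<in>Basis. F b) = (\<Sum>x\<in>UNIV \<times> Basis. F (axis (fst x) (snd x)))"
    by (rule sum_image_eq[OF _ B])
  also have "\<dots> = (\<Sum>i\<in>UNIV. \<Sum>u\<in>Basis. F (axis i u))"
    by (simp only: sum.cartesian_product case_prod_beta')
  finally show ?thesis by (simp add: 1)
qed

text \<open>The real basis contains the directions 1 and \<i> of each entry: two unconjugated
  factors give \<open>1 + \<i>\<^sup>2 = 0\<close>, a conjugated and an unconjugated one give
  \<open>1 + 1 = 2\<close>. With the factor 1/2 from \<open>Stein\<close> this is the standard
  complex Gaussian covariance.\<close>

lemma sum_Basis_entries:
  fixes i k :: "'m::finite" and j l :: "'n::finite"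
  shows "(\<Sum>b\<in>(Basis :: (complex^'n^'m) set). b $ i $ j * b $ k $ l) = 0"
    "(\<Sum>b\<in>(Basis :: (complex^'n^'m) set). cnj (b $ i $ j) * cnj (b $ k $ l)) = 0"
    "(\<Sum>b\<in>(Basis :: (complex^'n^'m) set). b $ i $ j * cnj (b $ k $ l)) = (if i = k \<and> j = l then 2 else 0)"
proof -
  have axis: "(axis a (axis c u) :: complex^'n^'m) $ i $ j = (if i = a \<and> j = c then u else 0)" for a c u i j
    by (simp add: axis_def)
  show "(\<Sum>b\<in>(Basis :: (complex^'n^'m) set). b $ i $ j * b $ k $ l) = 0"
    "(\<Sum>b\<in>(Basis :: (complex^'n^'m) set). cnj (b $ i $ j) * cnj (b $ k $ l)) = 0"
    by (auto simp: sum_Basis_complex_matrix axis intro!: sum.neutral)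
  have "(\<Sum>b\<in>(Basis :: (complex^'n^'m) set). b $ i $ j * cnj (b $ k $ l))
     = (\<Sum>a\<in>UNIV. \<Sum>c\<in>UNIV. if c = j then (if a = i then (if i = k \<and> j = l then 2 else 0) else 0) else 0)"
    unfolding sum_Basis_complex_matrix axis by (intro sum.cong refl) auto
  then show "(\<Sum>b\<in>(Basis :: (complex^'n^'m) set). b $ i $ j * cnj (b $ k $ l)) = (if i = k \<and> j = l then 2 else 0)"
    by simp
qed

lemma trace_mult_conj_transpose:
  fixes X :: "complex^'n::finite^'m::finite"
  shows "trace (X ** conj_transpose X) = of_real ((norm X)\<^sup>2)"
proof -
  have "(norm X)\<^sup>2 = (\<Sum>i\<in>UNIV. \<Sum>j\<in>UNIV. (norm (X $ i $ j))\<^sup>2)"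
    by (simp add: power2_norm_eq_inner inner_vec_def)
  then show ?thesis
    by (simp add: trace_def matrix_matrix_mult_def conj_transpose_def complex_norm_square flip: of_real_power)
qed

lemma sqrt_pi_power_DIM: "sqrt pi ^ DIM(complex^'n^'n) = pi ^ (CARD('n::finite))\<^sup>2"
proof -
  have "DIM(complex^'n^'n) = 2 * (CARD('n))\<^sup>2" by (simp add: power2_eq_square)
  then show ?thesis by (simp only: power_mult) simp
qed

lemma ginibre_eq_gauss: "(ginibre :: (complex^'n::finite^'n) measure) = gauss"
  unfolding ginibre_def gauss_def sqrt_pi_power_DIM by (simp add: trace_mult_conj_transpose)

lemma sum_mult_bilinear:
  fixes f :: "'t \<Rightarrow> 'b \<Rightarrow> 'a::comm_semiring_0"
  shows "(\<Sum>b\<in>I. (\<Sum>t\<in>T. A t * f t b) * (\<Sum>u\<in>U. B u * g u b))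
    = (\<Sum>t\<in>T. \<Sum>u\<in>U. A t * B u * (\<Sum>b\<in>I. f t b * g u b))"
proof -
  have "(\<Sum>b\<in>I. (\<Sum>t\<in>T. A t * f t b) * (\<Sum>u\<in>U. B u * g u b))
    = (\<Sum>b\<in>I. \<Sum>t\<in>T. \<Sum>u\<in>U. A t * B u * (f t b * g u b))"
    by (simp only: sum_product) (simp add: mult_ac)
  also have "\<dots> = (\<Sum>t\<in>T. \<Sum>u\<in>U. \<Sum>b\<in>I. A t * B u * (f t b * g u b))"
    by (subst sum.swap, rule sum.cong[OF refl], rule sum.swap)
  finally show ?thesis by (simp add: sum_distrib_left)
qed

lemma sum_Basis_mult_entries:
  fixes A :: "complex^'n::finite^'n"
  shows "(\<Sum>b\<in>(Basis :: (complex^'n^'n) set). (A ** b) $ i $ j * (B ** b) $ k $ l) = 0"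
    "(\<Sum>b\<in>(Basis :: (complex^'n^'n) set). (A ** conj_transpose b) $ i $ j * (B ** conj_transpose b) $ k $ l) = 0"
    "(\<Sum>b\<in>(Basis :: (complex^'n^'n) set). (A ** b) $ i $ j * (B ** conj_transpose b) $ k $ l) = 2 * A $ i $ l * B $ k $ j"
proof -
  have "(\<Sum>b\<in>(Basis :: (complex^'n^'n) set). (A ** b) $ i $ j * (B ** conj_transpose b) $ k $ l)
    = (\<Sum>t\<in>UNIV. \<Sum>u\<in>UNIV. A $ i $ t * B $ k $ u * (if t = l \<and> j = u then 2 else 0))"
    by (simp add: matrix_matrix_mult_def conj_transpose_def sum_mult_bilinear sum_Basis_entries)
  also have "\<dots> = (\<Sum>t\<in>UNIV. \<Sum>u\<in>UNIV. if u = j then (if t = l then 2 * A $ i $ t * B $ k $ u else 0) else 0)"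
    by (intro sum.cong refl) auto
  finally show "(\<Sum>b\<in>(Basis :: (complex^'n^'n) set). (A ** b) $ i $ j * (B ** conj_transpose b) $ k $ l) = 2 * A $ i $ l * B $ k $ j"
    by simp
qed (simp_all add: matrix_matrix_mult_def conj_transpose_def sum_mult_bilinear sum_Basis_entries)

lemma sum_Basis_entries_swap:
  fixes A :: "complex^'n::finite^'n"
  shows "(\<Sum>b\<in>(Basis :: (complex^'n^'n) set). (B ** conj_transpose b) $ k $ l * (A ** b) $ i $ j) = 2 * A $ i $ l * B $ k $ j"
    "(\<Sum>b\<in>(Basis :: (complex^'n^'n) set). cnj (b $ k $ l) * b $ i $ j) = (if i = k \<and> j = l then 2 else 0)"
  using sum_Basis_mult_entries(3)[of A i j B k l] sum_Basis_entries(3)[of i j k l]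
  by (simp_all only: mult.commute)

lemma sum_mult_mult_consts:
  fixes f g :: "'b \<Rightarrow> 'a::comm_semiring_0"
  shows "(\<Sum>b\<in>I. (f b * c) * (g b * d)) = c * d * (\<Sum>b\<in>I. f b * g b)"
    "(\<Sum>b\<in>I. (c * f b) * (d * g b)) = c * d * (\<Sum>b\<in>I. f b * g b)"
  by (simp_all add: sum_distrib_left mult_ac)

lemma det_kronecker_1_minus_diag:
  fixes A :: "complex^'n::finite^'n" and z :: "complex^'k::finite"
  shows "det (kronecker A (mat 1) - kronecker (mat 1) (diag_mat z)) = (\<Prod>j\<in>UNIV. det (A - mat (z $ j)))"
  by (rule det_block_diag[of "\<lambda>j p. (p, j)" snd])
    (auto simp: kronecker_def mat_def diag_mat_def image_iff inj_def)

text \<open>Contractions occur only between a row of the first half and one of the second. For rows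
  \<open>(i, a)\<close>, \<open>(k, c)\<close> and columns \<open>(j, a')\<close>,
  \<open>(l, c')\<close> of the two halves, both maps give \<open>Om $ i $ l * Sg $ k $ j\<close>
  with \<open>a = a'\<close> and \<open>c = c'\<close>, but \<open>L\<close> joins each row to a
  column of its own half and \<open>L'\<close> to one of the other half. The exchange of columns
  costs a sign, which the \<open>- Om\<close> in \<open>L'\<close> supplies.\<close>

theorem R_N_dual:
  fixes z w :: "complex^'k::finite" and Om Sg :: "complex^'n::finite^'n"
  shows "R_N z w Om Sg = (LINT X|(gauss :: (complex^'k^'k) measure).
     det (block_mat (kronecker (mat 1) (diag_mat z)) (kronecker Om X)
       (- kronecker Sg (conj_transpose X)) (kronecker (mat 1) (diag_mat w))))"
proof -
  define L :: "complex^'n^'n \<Rightarrow> complex^(('n \<times> 'k) + ('n \<times> 'k))^(('n \<times> 'k) + ('n \<times> 'k))"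
    where "L G = block_mat (kronecker (Om ** G) (mat 1)) 0 0 (kronecker (Sg ** conj_transpose G) (mat 1))" for G
  define L' :: "complex^'k^'k \<Rightarrow> complex^(('n \<times> 'k) + ('n \<times> 'k))^(('n \<times> 'k) + ('n \<times> 'k))"
    where "L' X = block_mat 0 (kronecker (- Om) X) (kronecker Sg (conj_transpose X)) 0" for X
  define M where "M = block_mat (- kronecker (mat 1 :: complex^'n^'n) (diag_mat z)) 0 0 (- kronecker (mat 1 :: complex^'n^'n) (diag_mat w))"
  have lL: "bounded_linear L"
  proof (rule linear_conv_bounded_linear[THEN iffD1], rule linearI)
    fix x y show "L (x + y) = L x + L y"
      unfolding L_def by (rule block_mat_eqI[symmetric])
        (simp_all add: kronecker_def conj_transpose_def matrix_matrix_mult_def sum.distrib ring_distribs)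
    fix r x show "L (r *\<^sub>R x) = r *\<^sub>R L x"
      unfolding L_def by (rule block_mat_eqI[symmetric])
        (simp_all add: kronecker_def conj_transpose_def matrix_matrix_mult_def scaleR_sum_right[symmetric])
  qed
  have lL': "bounded_linear L'"
  proof (rule linear_conv_bounded_linear[THEN iffD1], rule linearI)
    fix x y show "L' (x + y) = L' x + L' y"
      unfolding L'_def by (rule block_mat_eqI[symmetric])
        (simp_all add: kronecker_def conj_transpose_def ring_distribs)
    fix r x show "L' (r *\<^sub>R x) = r *\<^sub>R L' x"
      unfolding L'_def by (rule block_mat_eqI[symmetric])
        (simp_all add: kronecker_def conj_transpose_def)
  qed
  have "(\<Prod>j\<in>UNIV. det (Om ** G - mat (z $ j)) * det (Sg ** conj_transpose G - mat (w $ j))) = det (M + L G)" for G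
  proof -
    have "M + L G = block_mat (kronecker (Om ** G) (mat 1) - kronecker (mat 1) (diag_mat z)) 0 0
        (kronecker (Sg ** conj_transpose G) (mat 1) - kronecker (mat 1) (diag_mat w))"
      by (rule block_mat_eqI) (simp_all add: M_def L_def)
    then show ?thesis by (simp add: det_block_upper det_kronecker_1_minus_diag prod.distrib)
  qed
  then have "R_N z w Om Sg = (LINT G|gauss. det (M + L G))"
    by (simp add: R_N_def ginibre_eq_gauss)
  also have "\<dots> = (LINT X|gauss. det (M + L' X))"
  proof (rule expectation_det_eqI[OF lL lL'])
    fix r s p q :: "('n \<times> 'k) + ('n \<times> 'k)"
    show "(\<Sum>b\<in>Basis. L b $ r $ p * L b $ s $ q - L b $ r $ q * L b $ s $ p)
        = (\<Sum>b\<in>Basis. L' b $ r $ p * L' b $ s $ q - L' b $ r $ q * L' b $ s $ p)"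
      unfolding sum_subtractf
      by (cases r; cases s; cases p; cases q)
        (simp_all add: L_def L'_def kronecker_def conj_transpose_def[of "_ :: complex^'k^'k"]
          sum_negf sum_mult_mult_consts sum_Basis_mult_entries sum_Basis_entries
          sum_Basis_entries_swap, (auto simp: mat_def))
  qed
  \<comment> \<open>All four blocks change sign at once, which the determinant does not see because
    the size of the matrix is even.\<close>
  moreover have "det (M + L' X) = det (block_mat (kronecker (mat 1) (diag_mat z)) (kronecker Om X)
       (- kronecker Sg (conj_transpose X)) (kronecker (mat 1) (diag_mat w)))" (is "_ = det ?B") for X
  proof -
    have "M + L' X = - ?B"
      by (simp only: vec_eq_iff, intro allI, case_tac i; case_tac ia)
        (simp_all add: M_def L'_def kronecker_def)
    moreover have "even (CARD(('n \<times> 'k) + ('n \<times> 'k)))" by simp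
    ultimately show ?thesis by (simp only: det_uminus_even)
  qed
  ultimately show ?thesis by simp
qed

lemma diag_mat_inverse:
  fixes z :: "complex^'k::finite"
  assumes "\<And>j. z $ j \<noteq> 0"
  shows "diag_mat z ** matrix_inv (diag_mat z) = mat 1" "matrix_inv (diag_mat z) ** diag_mat z = mat 1"
proof -
  have "det (diag_mat z) = (\<Prod>i\<in>UNIV. z $ i)"
    by (subst det_diagonal) (auto simp: diag_mat_def)
  then have "invertible (diag_mat z)" using assms by (simp add: invertible_det_nz)
  then show "diag_mat z ** matrix_inv (diag_mat z) = mat 1" "matrix_inv (diag_mat z) ** diag_mat z = mat 1"
    unfolding invertible_def matrix_inv_def by (metis (mono_tags, lifting) someI_ex)+
qed

text \<open>The Schur complement is taken with respect to the block of \<open>w\<close>, and the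
  block of \<open>z\<close> is then factored out on the left; nonzero entries make both blocks
  invertible. The two factored blocks contribute the power of
  \<open>det (diag_mat z ** diag_mat w)\<close>.\<close>

lemma R_N_dual_nonzero:
  fixes z w :: "complex^'k::finite" and Om Sg :: "complex^'n::finite^'n"
  assumes nz: "\<And>j. z $ j \<noteq> 0" "\<And>j. w $ j \<noteq> 0"
  shows "R_N z w Om Sg = det (diag_mat z ** diag_mat w) ^ CARD('n) *
      (LINT X|ginibre. det (mat 1 + kronecker (Om ** Sg)
        (matrix_inv (diag_mat z) ** X ** matrix_inv (diag_mat w) ** conj_transpose X)))"
proof -
  let ?Z = "diag_mat z" and ?W = "diag_mat w"
  let ?Zi = "matrix_inv ?Z" and ?Wi = "matrix_inv ?W"
  have "det (block_mat (kronecker (mat 1) ?Z) (kronecker Om X) (- kronecker Sg (conj_transpose X)) (kronecker (mat 1) ?W))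
    = det (?Z ** ?W) ^ CARD('n) * det (mat 1 + kronecker (Om ** Sg) (?Zi ** X ** ?Wi ** conj_transpose X))"
    (is "?l X = ?r X") for X
  proof -
    have "?l X = det (kronecker (mat 1) ?Z - kronecker Om X ** kronecker (mat 1) ?Wi ** (- kronecker Sg (conj_transpose X)))
        * det (kronecker (mat 1 :: complex^'n^'n) ?W)"
      by (rule det_block_Schur) (simp_all add: kronecker_mult diag_mat_inverse nz kronecker_1)
    also have "kronecker Om X ** kronecker (mat 1) ?Wi ** (- kronecker Sg (conj_transpose X))
        = - kronecker (Om ** Sg) (X ** ?Wi ** conj_transpose X)"
    proof -
      have "A ** (- B) = - (A ** B)" for A B :: "complex^('n \<times> 'k)^('n \<times> 'k)"
        by (simp add: vec_eq_iff matrix_matrix_mult_def sum_negf)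
      then show ?thesis by (simp add: kronecker_mult)
    qed
    also have "kronecker (mat 1) ?Z - - kronecker (Om ** Sg) (X ** ?Wi ** conj_transpose X)
        = kronecker (mat 1) ?Z ** (mat 1 + kronecker (Om ** Sg) (?Zi ** X ** ?Wi ** conj_transpose X))"
      by (simp add: matrix_add_ldistrib kronecker_mult matrix_mul_assoc diag_mat_inverse nz)
    finally show ?thesis
      by (simp add: det_mul det_kronecker_1_left power_mult_distrib)
  qed
  then show ?thesis by (simp add: R_N_dual ginibre_eq_gauss)
qed

text \<open>With identity matrices in the first Kronecker slot nothing mixes different values of
  that index, so the large matrix splits into \<open>CARD('n)\<close> equal blocks of size
  \<open>2 * CARD('k)\<close>.\<close>

lemma R_N_dual_identity:
  fixes z w :: "complex^'k::finite"
  shows "R_N z w (mat 1 :: complex^'n::finite^'n) (mat 1) = 1 / of_real pi ^ (CARD('k)\<^sup>2) *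
      (LINT X|lborel. exp (- trace (X ** conj_transpose X)) *
        det (block_mat (diag_mat z) X (- conj_transpose X) (diag_mat w)) ^ CARD('n))"
proof -
  define D where "D X = det (block_mat (diag_mat z) X (- conj_transpose X) (diag_mat w)) ^ CARD('n)" for X
  have "det (block_mat (kronecker (mat 1 :: complex^'n^'n) (diag_mat z)) (kronecker (mat 1) X)
      (- kronecker (mat 1) (conj_transpose X)) (kronecker (mat 1) (diag_mat w))) = D X" (is "det ?M = _") for X
  proof -
    have "det ?M = (\<Prod>i\<in>(UNIV :: 'n set). det (block_mat (diag_mat z) X (- conj_transpose X) (diag_mat w)))"
    proof (rule det_block_diag)
      \<comment> \<open>Regrouping by the first Kronecker index: \<open>?f i\<close> embeds block
        \<open>i\<close> across both halves, and \<open>?g\<close> reads \<open>i\<close>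
        back.\<close>
      let ?f = "\<lambda>(i :: 'n) (p :: 'k + 'k). (case p of Inl a \<Rightarrow> Inl (i, a) | Inr a \<Rightarrow> Inr (i, a))"
      let ?g = "\<lambda>p :: ('n \<times> 'k) + ('n \<times> 'k). case p of Inl a \<Rightarrow> fst a | Inr a \<Rightarrow> fst a"
      show "inj (?f j)" for j by (auto simp: inj_def split: sum.splits)
      show "range (?f j) = {r. ?g r = j}" for j
      proof (intro set_eqI)
        fix r show "r \<in> range (?f j) \<longleftrightarrow> r \<in> {r. ?g r = j}"
          by (cases r) (auto simp: image_iff split_sum_ex)
      qed
      show "?M $ ?f j p $ ?f j q = block_mat (diag_mat z) X (- conj_transpose X) (diag_mat w) $ p $ q" for j p q
        by (cases p; cases q) (simp_all add: kronecker_def mat_def)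
      show "?M $ r $ s = 0" if "?g r \<noteq> ?g s" for r s
        using that by (cases r; cases s) (simp_all add: kronecker_def mat_def)
    qed
    then show ?thesis by (simp add: D_def)
  qed
  then have "R_N z w (mat 1 :: complex^'n^'n) (mat 1) = (LINT X|gauss. D X)"
    by (simp add: R_N_dual)
  also have "\<dots> = (LINT X|lborel. of_real (exp (- (norm X)\<^sup>2)) * D X) / of_real (sqrt pi ^ DIM(complex^'k^'k))"
  proof (rule integral_gauss, rule tame_measurable)
    have "tame (\<lambda>X. det (block_mat (diag_mat z) X (- conj_transpose X) (diag_mat w)))"
    proof (rule tame_det)
      fix i j
      have 1: "tame (\<lambda>X :: complex^'k^'k. X $ a $ b)" for a b
        by (intro tame_linear bounded_linear_compose[OF bounded_linear_vec_nth] bounded_linear_vec_nth)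
      have 2: "tame (\<lambda>X :: complex^'k^'k. - cnj (X $ a $ b))" for a b
        by (intro tame_linear bounded_linear_minus bounded_linear_compose[OF bounded_linear_cnj] 
           bounded_linear_compose[OF bounded_linear_vec_nth] bounded_linear_vec_nth)
      show "tame (\<lambda>X. block_mat (diag_mat z) X (- conj_transpose X) (diag_mat w) $ i $ j)"
        by (cases i; cases j) (simp_all add: tame_const 1 2 conj_transpose_def)
    qed
    then have "tame (\<lambda>X. \<Prod>_\<in>(UNIV :: 'n set). det (block_mat (diag_mat z) X (- conj_transpose X) (diag_mat w)))"
      by (intro tame_prod)
    then show "tame D" by (simp add: D_def[abs_def])
  qed
  finally show ?thesis
    unfolding sqrt_pi_power_DIM by (simp add: trace_mult_conj_transpose D_def exp_of_real flip: of_real_minus of_real_power)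
qed

section \<open>Matrices commuting with a raising and a lowering operator\<close>

abbreviation box :: "nat \<Rightarrow> ('k \<Rightarrow> nat) set" where
  "box m \<equiv> PiE UNIV (\<lambda>_. {..m})"

text \<open>A function of \<open>\<alpha>\<close> and \<open>\<beta>\<close> is an operator on the \<open>k\<close>-fold tensor power of \<open>\<complex>\<^sup>m\<^sup>+\<^sup>1\<close>, on which
  an \<open>(m + 1) \<times> (m + 1)\<close> matrix \<open>x\<close> acts as a derivation; \<open>intertwines m r x\<close> says that \<open>r\<close> commutes
  with this action.\<close>
definition left_act :: "nat \<Rightarrow> (nat \<Rightarrow> nat \<Rightarrow> complex) \<Rightarrow> (('k::finite \<Rightarrow> nat) \<Rightarrow> 'c \<Rightarrow> complex) \<Rightarrow> ('k \<Rightarrow> nat) \<Rightarrow> 'c \<Rightarrow> complex" where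
  "left_act m x r \<alpha> \<beta> = (\<Sum>i\<in>UNIV. \<Sum>l\<le>m. x (\<alpha> i) l * r (\<alpha>(i := l)) \<beta>)"

definition right_act :: "nat \<Rightarrow> (nat \<Rightarrow> nat \<Rightarrow> complex) \<Rightarrow> ('c \<Rightarrow> ('k::finite \<Rightarrow> nat) \<Rightarrow> complex) \<Rightarrow> 'c \<Rightarrow> ('k \<Rightarrow> nat) \<Rightarrow> complex" where
  "right_act m x r \<alpha> \<beta> = (\<Sum>j\<in>UNIV. \<Sum>l\<le>m. x l (\<beta> j) * r \<alpha> (\<beta>(j := l)))"

definition commutator :: "nat \<Rightarrow> (nat \<Rightarrow> nat \<Rightarrow> complex) \<Rightarrow> (nat \<Rightarrow> nat \<Rightarrow> complex) \<Rightarrow> nat \<Rightarrow> nat \<Rightarrow> complex" where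
  "commutator m x y a b = (\<Sum>l\<le>m. x a l * y l b - y a l * x l b)"

definition intertwines :: "nat \<Rightarrow> (('k::finite \<Rightarrow> nat) \<Rightarrow> ('k \<Rightarrow> nat) \<Rightarrow> complex) \<Rightarrow> (nat \<Rightarrow> nat \<Rightarrow> complex) \<Rightarrow> bool" where
  "intertwines m r x \<longleftrightarrow> (\<forall>\<alpha> \<beta>. (\<forall>i. \<alpha> i \<le> m) \<longrightarrow> (\<forall>i. \<beta> i \<le> m) \<longrightarrow> left_act m x r \<alpha> \<beta> = right_act m x r \<alpha> \<beta>)"

lemma left_act_cong:
  assumes "\<And>\<alpha>. (\<forall>i. \<alpha> i \<le> m) \<Longrightarrow> r \<alpha> \<beta> = r' \<alpha> \<beta>" "\<forall>i. \<alpha> i \<le> m"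
  shows "left_act m x r \<alpha> \<beta> = left_act m x r' \<alpha> \<beta>"
  unfolding left_act_def using assms(2) by (intro sum.cong refl arg_cong2[where f="(*)"] assms(1)) auto

lemma right_act_cong:
  assumes "\<And>\<beta>. (\<forall>i. \<beta> i \<le> m) \<Longrightarrow> r \<alpha> \<beta> = r' \<alpha> \<beta>" "\<forall>i. \<beta> i \<le> m"
  shows "right_act m x r \<alpha> \<beta> = right_act m x r' \<alpha> \<beta>"
  unfolding right_act_def using assms(2) by (intro sum.cong refl arg_cong2[where f="(*)"] assms(1)) auto

text \<open>The first sum collects the terms in which both factors act in the same tensor slot and
  multiply as matrices; in the second they act in two different slots.\<close>

lemma left_act_left_act:
  "left_act m x (left_act m y r) \<alpha> \<beta>
    = (\<Sum>i\<in>UNIV. \<Sum>l\<le>m. (\<Sum>l'\<le>m. x (\<alpha> i) l' * y l' l) * r (\<alpha>(i := l)) \<beta>)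
    + (\<Sum>i\<in>UNIV. \<Sum>i'\<in>UNIV - {i}. \<Sum>l\<le>m. \<Sum>l'\<le>m. x (\<alpha> i) l * y (\<alpha> i') l' * r (\<alpha>(i := l, i' := l')) \<beta>)"
proof -
  have "left_act m x (left_act m y r) \<alpha> \<beta> =
      (\<Sum>i\<in>UNIV. \<Sum>l\<le>m. \<Sum>i'\<in>UNIV. \<Sum>l'\<le>m. x (\<alpha> i) l * y ((\<alpha>(i := l)) i') l' * r (\<alpha>(i := l, i' := l')) \<beta>)"
    unfolding left_act_def by (simp add: sum_distrib_left mult.assoc)
  also have "\<dots> = (\<Sum>i\<in>UNIV. \<Sum>i'\<in>UNIV. \<Sum>l\<le>m. \<Sum>l'\<le>m. x (\<alpha> i) l * y ((\<alpha>(i := l)) i') l' * r (\<alpha>(i := l, i' := l')) \<beta>)"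
    by (intro sum.cong refl sum.swap)
  also have "\<dots> = (\<Sum>i\<in>UNIV. (\<Sum>l\<le>m. \<Sum>l'\<le>m. x (\<alpha> i) l * y l l' * r (\<alpha>(i := l')) \<beta>)
      + (\<Sum>i'\<in>UNIV - {i}. \<Sum>l\<le>m. \<Sum>l'\<le>m. x (\<alpha> i) l * y (\<alpha> i') l' * r (\<alpha>(i := l, i' := l')) \<beta>))"
  proof (intro sum.cong refl)
    fix i :: 'a
    show "(\<Sum>i'\<in>UNIV. \<Sum>l\<le>m. \<Sum>l'\<le>m. x (\<alpha> i) l * y ((\<alpha>(i := l)) i') l' * r (\<alpha>(i := l, i' := l')) \<beta>)
     = (\<Sum>l\<le>m. \<Sum>l'\<le>m. x (\<alpha> i) l * y l l' * r (\<alpha>(i := l')) \<beta>)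
      + (\<Sum>i'\<in>UNIV - {i}. \<Sum>l\<le>m. \<Sum>l'\<le>m. x (\<alpha> i) l * y (\<alpha> i') l' * r (\<alpha>(i := l, i' := l')) \<beta>)"
      by (subst sum.remove[of _ i]) (auto intro!: sum.cong)
  qed
  also have "(\<Sum>i\<in>UNIV. (\<Sum>l\<le>m. \<Sum>l'\<le>m. x (\<alpha> i) l * y l l' * r (\<alpha>(i := l')) \<beta>)
      + (\<Sum>i'\<in>UNIV - {i}. \<Sum>l\<le>m. \<Sum>l'\<le>m. x (\<alpha> i) l * y (\<alpha> i') l' * r (\<alpha>(i := l, i' := l')) \<beta>))
     = (\<Sum>i\<in>UNIV. \<Sum>l\<le>m. (\<Sum>l'\<le>m. x (\<alpha> i) l' * y l' l) * r (\<alpha>(i := l)) \<beta>)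
    + (\<Sum>i\<in>UNIV. \<Sum>i'\<in>UNIV - {i}. \<Sum>l\<le>m. \<Sum>l'\<le>m. x (\<alpha> i) l * y (\<alpha> i') l' * r (\<alpha>(i := l, i' := l')) \<beta>)"
    unfolding sum.distrib sum_distrib_right
    by (intro arg_cong2[where f="(+)"] refl sum.cong sum.swap)
  finally show ?thesis .
qed

text \<open>Actions in different slots commute, so the cross terms cancel and only the commutator
  within one slot remains: the derivation action is a Lie algebra representation.\<close>

lemma left_act_commutator:
  "left_act m x (left_act m y r) \<alpha> \<beta> - left_act m y (left_act m x r) \<alpha> \<beta> = left_act m (commutator m x y) r \<alpha> \<beta>"
proof -
  have "(\<Sum>i\<in>UNIV. \<Sum>i'\<in>UNIV - {i}. \<Sum>l\<le>m. \<Sum>l'\<le>m. y (\<alpha> i) l * x (\<alpha> i') l' * r (\<alpha>(i := l, i' := l')) \<beta>)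
    = (\<Sum>i\<in>UNIV. \<Sum>i'\<in>UNIV. if i' = i then 0 else (\<Sum>l\<le>m. \<Sum>l'\<le>m. y (\<alpha> i) l * x (\<alpha> i') l' * r (\<alpha>(i := l, i' := l')) \<beta>))"
    by (intro sum.cong refl sum.mono_neutral_cong_left) auto
  also have "\<dots> = (\<Sum>i'\<in>UNIV. \<Sum>i\<in>UNIV. if i' = i then 0 else (\<Sum>l\<le>m. \<Sum>l'\<le>m. y (\<alpha> i) l * x (\<alpha> i') l' * r (\<alpha>(i := l, i' := l')) \<beta>))"
    by (rule sum.swap)
  also have "\<dots> = (\<Sum>i'\<in>UNIV. \<Sum>i\<in>UNIV - {i'}. \<Sum>l'\<le>m. \<Sum>l\<le>m. x (\<alpha> i') l' * y (\<alpha> i) l * r (\<alpha>(i' := l', i := l)) \<beta>)"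
  proof (rule sum.cong[OF refl])
    fix i' :: 'a
    have "(if i' = i then 0 else (\<Sum>l\<le>m. \<Sum>l'\<le>m. y (\<alpha> i) l * x (\<alpha> i') l' * r (\<alpha>(i := l, i' := l')) \<beta>))
       = (if i' = i then 0 else (\<Sum>l'\<le>m. \<Sum>l\<le>m. x (\<alpha> i') l' * y (\<alpha> i) l * r (\<alpha>(i' := l', i := l)) \<beta>))" for i
      by (subst sum.swap) (auto simp: fun_upd_twist mult_ac)
    then show "(\<Sum>i\<in>UNIV. if i' = i then 0 else (\<Sum>l\<le>m. \<Sum>l'\<le>m. y (\<alpha> i) l * x (\<alpha> i') l' * r (\<alpha>(i := l, i' := l')) \<beta>))
      = (\<Sum>i\<in>UNIV - {i'}. \<Sum>l'\<le>m. \<Sum>l\<le>m. x (\<alpha> i') l' * y (\<alpha> i) l * r (\<alpha>(i' := l', i := l)) \<beta>)"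
      by (simp only:) (intro sum.mono_neutral_cong_right, auto)
  qed
  finally have cross: "(\<Sum>i\<in>UNIV. \<Sum>i'\<in>UNIV - {i}. \<Sum>l\<le>m. \<Sum>l'\<le>m. y (\<alpha> i) l * x (\<alpha> i') l' * r (\<alpha>(i := l, i' := l')) \<beta>)
    = (\<Sum>i'\<in>UNIV. \<Sum>i\<in>UNIV - {i'}. \<Sum>l'\<le>m. \<Sum>l\<le>m. x (\<alpha> i') l' * y (\<alpha> i) l * r (\<alpha>(i' := l', i := l)) \<beta>)" .
  show ?thesis
    unfolding left_act_left_act cross
    by (simp add: left_act_def commutator_def sum_subtractf left_diff_distrib)
qed

lemma right_act_conv_left_act: "right_act m x r \<alpha> \<beta> = left_act m (\<lambda>a b. x b a) (\<lambda>\<beta> \<alpha>. r \<alpha> \<beta>) \<beta> \<alpha>"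
  by (simp add: right_act_def left_act_def)

text \<open>The right action is the left action of the transpose, and transposing reverses products;
  hence the opposite order of \<open>x\<close> and \<open>y\<close> compared with the left
  action.\<close>

lemma right_act_commutator:
  "right_act m y (right_act m x r) \<alpha> \<beta> - right_act m x (right_act m y r) \<alpha> \<beta> = right_act m (commutator m x y) r \<alpha> \<beta>"
proof -
  have "commutator m (\<lambda>a b. y b a) (\<lambda>a b. x b a) = (\<lambda>a b. commutator m x y b a)"
    by (simp add: fun_eq_iff commutator_def mult_ac)
  then show ?thesis
    using left_act_commutator[of m "\<lambda>a b. y b a" "\<lambda>a b. x b a" "\<lambda>\<beta> \<alpha>. r \<alpha> \<beta>" \<beta> \<alpha>]
    by (simp add: right_act_conv_left_act)
qed

lemma left_act_right_act: "left_act m x (right_act m y r) \<alpha> \<beta> = right_act m y (left_act m x r) \<alpha> \<beta>"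
proof -
  have "left_act m x (right_act m y r) \<alpha> \<beta>
    = (\<Sum>i\<in>UNIV. \<Sum>l\<le>m. \<Sum>j\<in>UNIV. \<Sum>l'\<le>m. x (\<alpha> i) l * (y l' (\<beta> j) * r (\<alpha>(i := l)) (\<beta>(j := l'))))"
    by (simp add: left_act_def right_act_def sum_distrib_left)
  also have "\<dots> = (\<Sum>i\<in>UNIV. \<Sum>j\<in>UNIV. \<Sum>l\<le>m. \<Sum>l'\<le>m. x (\<alpha> i) l * (y l' (\<beta> j) * r (\<alpha>(i := l)) (\<beta>(j := l'))))"
    by (intro sum.cong refl sum.swap)
  also have "\<dots> = (\<Sum>j\<in>UNIV. \<Sum>i\<in>UNIV. \<Sum>l\<le>m. \<Sum>l'\<le>m. x (\<alpha> i) l * (y l' (\<beta> j) * r (\<alpha>(i := l)) (\<beta>(j := l'))))"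
    by (rule sum.swap)
  also have "\<dots> = (\<Sum>j\<in>UNIV. \<Sum>i\<in>UNIV. \<Sum>l'\<le>m. \<Sum>l\<le>m. x (\<alpha> i) l * (y l' (\<beta> j) * r (\<alpha>(i := l)) (\<beta>(j := l'))))"
    by (intro sum.cong refl sum.swap)
  also have "\<dots> = (\<Sum>j\<in>UNIV. \<Sum>l'\<le>m. \<Sum>i\<in>UNIV. \<Sum>l\<le>m. x (\<alpha> i) l * (y l' (\<beta> j) * r (\<alpha>(i := l)) (\<beta>(j := l'))))"
    by (intro sum.cong refl sum.swap)
  also have "\<dots> = right_act m y (left_act m x r) \<alpha> \<beta>"
    by (simp add: left_act_def right_act_def sum_distrib_left mult.left_commute)
  finally show ?thesis .
qed

text \<open>Left and right actions commute with each other. The intertwined matrices therefore form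
  a Lie algebra, which can be enlarged from two generators.\<close>

lemma intertwines_commutator:
  assumes x: "intertwines m r x" and y: "intertwines m r y"
  shows "intertwines m r (commutator m x y)"
  unfolding intertwines_def
proof (intro allI impI)
  fix \<alpha> \<beta> :: "'a \<Rightarrow> nat" assume ab: "\<forall>i. \<alpha> i \<le> m" "\<forall>i. \<beta> i \<le> m"
  have 1: "left_act m x (left_act m y r) \<alpha> \<beta> = right_act m y (right_act m x r) \<alpha> \<beta>"
    if x: "intertwines m r x" and y: "intertwines m r y" for x y
  proof -
    have "left_act m x (left_act m y r) \<alpha> \<beta> = left_act m x (right_act m y r) \<alpha> \<beta>"
      by (rule left_act_cong) (use ab y in \<open>auto simp: intertwines_def\<close>)
    also have "\<dots> = right_act m y (left_act m x r) \<alpha> \<beta>" by (rule left_act_right_act)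
    also have "\<dots> = right_act m y (right_act m x r) \<alpha> \<beta>"
      by (rule right_act_cong) (use ab x in \<open>auto simp: intertwines_def\<close>)
    finally show ?thesis .
  qed
  show "left_act m (commutator m x y) r \<alpha> \<beta> = right_act m (commutator m x y) r \<alpha> \<beta>"
    using 1[OF x y] 1[OF y x] by (simp flip: left_act_commutator right_act_commutator)
qed

lemma intertwines_lincomb:
  assumes "intertwines m r x" "intertwines m r y"
  shows "intertwines m r (\<lambda>a b. c * x a b + d * y a b)"
proof -
  have "left_act m (\<lambda>a b. c * x a b + d * y a b) r \<alpha> \<beta> = c * left_act m x r \<alpha> \<beta> + d * left_act m y r \<alpha> \<beta>" for \<alpha> \<beta>
    by (simp add: left_act_def sum.distrib ring_distribs sum_distrib_left mult.assoc)
  moreover have "right_act m (\<lambda>a b. c * x a b + d * y a b) r \<alpha> \<beta> = c * right_act m x r \<alpha> \<beta> + d * right_act m y r \<alpha> \<beta>" for \<alpha> \<beta>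
    by (simp add: right_act_def sum.distrib ring_distribs sum_distrib_left mult.assoc)
  ultimately show ?thesis using assms by (simp add: intertwines_def)
qed

lemma intertwines_cong:
  assumes "intertwines m r x" "\<And>a b. a \<le> m \<Longrightarrow> b \<le> m \<Longrightarrow> x a b = y a b"
  shows "intertwines m r y"
proof -
  have "left_act m x r \<alpha> \<beta> = left_act m y r \<alpha> \<beta>" if "\<forall>i. \<alpha> i \<le> m" for \<alpha> \<beta>
    unfolding left_act_def using that by (intro sum.cong refl) (simp add: assms(2))
  moreover have "right_act m x r \<alpha> \<beta> = right_act m y r \<alpha> \<beta>" if "\<forall>i. \<beta> i \<le> m" for \<alpha> \<beta>
    unfolding right_act_def using that by (intro sum.cong refl) (simp add: assms(2))
  ultimately show ?thesis using assms(1) by (simp add: intertwines_def)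
qed

text \<open>The weight is that of \<open>m z - z^2 d/dz\<close> on \<open>z^a\<close>. It vanishes
  at \<open>a = m\<close>, so no exponent leaves the box.\<close>

abbreviation raising :: "nat \<Rightarrow> nat \<Rightarrow> nat \<Rightarrow> complex" where
  "raising m \<equiv> \<lambda>a b. if b = Suc a then of_nat (m - a) else 0"

text \<open>The entry in row \<open>a\<close> is \<open>a (m + 1 - a)\<close>, the weight of
  \<open>m d/dz - z d^2/dz^2\<close> on \<open>z^a\<close>.\<close>

abbreviation lowering :: "nat \<Rightarrow> nat \<Rightarrow> nat \<Rightarrow> complex" where
  "lowering m \<equiv> \<lambda>a b. if a = Suc b then of_nat (Suc b * (m - b)) else 0"

lemma act_raise:
  "left_act m (\<lambda>a b. if b = Suc a then f a else 0) r \<alpha> \<beta>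
    = (\<Sum>i\<in>UNIV. if \<alpha> i < m then f (\<alpha> i) * r (\<alpha>(i := Suc (\<alpha> i))) \<beta> else 0)"
  "\<forall>j. \<beta> j \<le> m \<Longrightarrow> right_act m (\<lambda>a b. if b = Suc a then f a else 0) r \<alpha> \<beta>
    = (\<Sum>j\<in>UNIV. if 0 < \<beta> j then f (\<beta> j - 1) * r \<alpha> (\<beta>(j := \<beta> j - 1)) else 0)"
proof -
  show "left_act m (\<lambda>a b. if b = Suc a then f a else 0) r \<alpha> \<beta>
    = (\<Sum>i\<in>UNIV. if \<alpha> i < m then f (\<alpha> i) * r (\<alpha>(i := Suc (\<alpha> i))) \<beta> else 0)"
    unfolding left_act_def
    by (intro sum.cong refl) (simp add: if_distrib[of "\<lambda>x. x * _"] Suc_le_eq cong: if_cong)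
  assume b: "\<forall>j. \<beta> j \<le> m"
  show "right_act m (\<lambda>a b. if b = Suc a then f a else 0) r \<alpha> \<beta>
    = (\<Sum>j\<in>UNIV. if 0 < \<beta> j then f (\<beta> j - 1) * r \<alpha> (\<beta>(j := \<beta> j - 1)) else 0)"
    unfolding right_act_def
  proof (intro sum.cong refl)
    fix j
    have "(\<Sum>l\<le>m. (if \<beta> j = Suc l then f l else 0) * r \<alpha> (\<beta>(j := l)))
      = (\<Sum>l\<le>m. if l = \<beta> j - 1 then (if 0 < \<beta> j then f l * r \<alpha> (\<beta>(j := l)) else 0) else 0)"
      by (intro sum.cong refl) auto
    also have "\<dots> = (if 0 < \<beta> j then f (\<beta> j - 1) * r \<alpha> (\<beta>(j := \<beta> j - 1)) else 0)"
      using b[rule_format, of j] by (subst sum.delta) auto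
    finally show "(\<Sum>l\<le>m. (if \<beta> j = Suc l then f l else 0) * r \<alpha> (\<beta>(j := l)))
      = (if 0 < \<beta> j then f (\<beta> j - 1) * r \<alpha> (\<beta>(j := \<beta> j - 1)) else 0)" .
  qed
qed

lemma act_lower:
  "right_act m (\<lambda>a b. if a = Suc b then f b else 0) r \<alpha> \<beta>
    = (\<Sum>j\<in>UNIV. if \<beta> j < m then f (\<beta> j) * r \<alpha> (\<beta>(j := Suc (\<beta> j))) else 0)"
  "\<forall>i. \<alpha> i \<le> m \<Longrightarrow> left_act m (\<lambda>a b. if a = Suc b then f b else 0) r \<alpha> \<beta>
    = (\<Sum>i\<in>UNIV. if 0 < \<alpha> i then f (\<alpha> i - 1) * r (\<alpha>(i := \<alpha> i - 1)) \<beta> else 0)"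
  using act_raise(1)[of m f "\<lambda>\<beta> \<alpha>. r \<alpha> \<beta>" \<beta> \<alpha>] act_raise(2)[of \<alpha> m f "\<lambda>\<beta> \<alpha>. r \<alpha> \<beta>" \<beta>]
  by (simp_all add: right_act_conv_left_act)

lemma act_diag:
  "\<forall>i. \<alpha> i \<le> m \<Longrightarrow> left_act m (\<lambda>a b. if a = b then f a else 0) r \<alpha> \<beta> = (\<Sum>i\<in>UNIV. f (\<alpha> i)) * r \<alpha> \<beta>"
  "\<forall>j. \<beta> j \<le> m \<Longrightarrow> right_act m (\<lambda>a b. if a = b then f a else 0) r \<alpha> \<beta> = (\<Sum>j\<in>UNIV. f (\<beta> j)) * r \<alpha> \<beta>"
  by (simp_all add: left_act_def right_act_def if_distrib[of "\<lambda>x. x * _"] sum_distrib_right cong: if_cong)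

context
  fixes m :: nat and r :: "('k::finite \<Rightarrow> nat) \<Rightarrow> ('k \<Rightarrow> nat) \<Rightarrow> complex"
  assumes up: "intertwines m r (raising m)"
    and down: "intertwines m r (lowering m)"
begin

text \<open>\<open>cub a\<close> is the product of the raising entry \<open>(a - 1, a)\<close> and
  the lowering entry \<open>(a, a - 1)\<close>, so its differences form the diagonal of the
  commutator. Its zeros at \<open>0\<close> and \<open>m + 1\<close> account for both ends of the
  box.\<close>

abbreviation "cub \<equiv> (\<lambda>a. (of_nat a * (of_nat m + 1 - of_nat a)\<^sup>2 :: complex))"
abbreviation "dg \<equiv> (\<lambda>a. cub (Suc a) - cub a)"

lemma intertwines_diag: "intertwines m r (\<lambda>a b. if a = b then dg a else 0)"
proof (rule intertwines_cong[OF intertwines_commutator[OF up down]])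
  fix a b assume ab: "a \<le> m" "b \<le> m"
  let ?u = "raising m"
  let ?v = "lowering m"
  have 1: "(\<Sum>l\<le>m. ?u a l * ?v l b) = (if a = b then cub (Suc a) else 0)"
  proof -
    have "(\<Sum>l\<le>m. ?u a l * ?v l b) = (\<Sum>l\<le>m. if l = Suc a then (if a = b then of_nat (m - a) * of_nat (Suc a * (m - a)) else 0) else 0)"
      by (intro sum.cong refl) auto
    also have "\<dots> = (if a = b then cub (Suc a) else 0)"
    proof -
      obtain d where d: "m = a + d" using ab le_Suc_ex by blast
      show ?thesis by (cases d) (simp_all add: d power2_eq_square algebra_simps)
    qed
    finally show ?thesis .
  qed
  have 2: "(\<Sum>l\<le>m. ?v a l * ?u l b) = (if a = b then cub a else 0)"
  proof -
    have "(\<Sum>l\<le>m. ?v a l * ?u l b) = (\<Sum>l\<le>m. if l = a - 1 then (if 0 < a \<and> a = b then of_nat (a * (m - (a - 1))) * of_nat (m - (a - 1)) else 0) else 0)"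
      by (intro sum.cong refl) auto
    also have "\<dots> = (if a = b then cub a else 0)"
    proof -
      obtain d where d: "m = a + d" using ab le_Suc_ex by blast
      show ?thesis by (cases a) (simp_all add: d power2_eq_square algebra_simps)
    qed
    finally show ?thesis .
  qed
  show "commutator m ?u ?v a b = (if a = b then dg a else 0)"
    unfolding commutator_def sum_subtractf 1 2 by simp
qed

text \<open>Since \<open>cub\<close> is cubic, its second differences are linear with slope 6 and
  hence distinct. For a standard sl_2 pair the corresponding product is quadratic and the gaps are
  constant, so no single matrix unit could be isolated.\<close>

lemma dg_gap_inj:
  assumes "dg a - dg (Suc a) = dg b - dg (Suc b)"
  shows "a = b"
proof -
  have "dg a - dg (Suc a) = 4 * (of_nat m + 1) - 6 * (of_nat a + 1)" for a
    by (simp add: power2_eq_square algebra_simps)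
  then have "6 * (of_nat a + 1) = (6 * (of_nat b + 1) :: complex)" using assms by (simp only:) simp
  then show ?thesis by simp
qed

text \<open>Bracketing with the diagonal matrix multiplies the entries of \<open>x\<close> by \<open>g\<close>; as the gaps of \<open>dg\<close> are
  distinct, products of the \<open>g a - c s\<close> isolate single matrix units.\<close>
lemma intertwines_ad_diag:
  assumes x: "intertwines m r x" and g: "\<And>a b. x a b \<noteq> 0 \<Longrightarrow> dg a - dg b = g a"
  shows "intertwines m r (\<lambda>a b. (\<Prod>s\<in>S. g a - c s) * x a b)"
proof (induction S rule: infinite_finite_induct)
  case (insert s S)
  let ?y = "\<lambda>a b. (\<Prod>s\<in>S. g a - c s) * x a b"
  have "intertwines m r (\<lambda>a b. 1 * commutator m (\<lambda>a b. if a = b then dg a else 0) ?y a b + (- c s) * ?y a b)"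
    by (intro intertwines_lincomb intertwines_commutator intertwines_diag insert.IH)
  then show ?case
  proof (rule intertwines_cong)
    fix a b assume ab: "a \<le> m" "b \<le> m"
    have "commutator m (\<lambda>a b. if a = b then dg a else 0) ?y a b = dg a * ?y a b - ?y a b * dg b"
      using ab by (simp add: commutator_def sum_subtractf if_distrib[of "\<lambda>x. x * _"] if_distrib[of "(*) _"] cong: if_cong)
    also have "\<dots> = (dg a - dg b) * ?y a b" by (simp add: algebra_simps)
    also have "\<dots> = g a * ?y a b" using g[of a b] by (cases "x a b = 0") simp_all
    finally show "1 * commutator m (\<lambda>a b. if a = b then dg a else 0) ?y a b + (- c s) * ?y a b
        = (\<Prod>s\<in>insert s S. g a - c s) * x a b"
      using insert.hyps by (simp add: algebra_simps)
  qed
qed (use x in auto)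

lemma intertwines_raise_unit:
  assumes "l < m"
  shows "intertwines m r (\<lambda>a b. if a = l \<and> b = Suc l then 1 else 0)"
proof -
  define g where "g a = dg a - dg (Suc a)" for a
  \<comment> \<open>A Lagrange factor: it vanishes in every row \<open>a < m\<close> except
    \<open>l\<close>, and row \<open>m\<close> of the raising matrix has no entry inside the
    box.\<close>
  let ?P = "\<lambda>a. \<Prod>s\<in>{..<m} - {l}. g a - g s"
  have gg: "dg a - dg b = g a" if "raising m a b \<noteq> 0" for a b
  proof -
    have "b = Suc a" using that by (auto split: if_splits)
    then show ?thesis by (simp only: g_def)
  qed
  have "?P l \<noteq> 0" unfolding g_def using dg_gap_inj by auto
  \<comment> \<open>The second summand is zero; it gives the scalar multiple the shape of a linear
    combination.\<close>
  have "intertwines m r (\<lambda>a b. (1 / (?P l * of_nat (m - l))) * (?P a * raising m a b) + 0 * (?P a * raising m a b))"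
    by (intro intertwines_lincomb intertwines_ad_diag[OF up gg])
  then show ?thesis
  proof (rule intertwines_cong)
    fix a b assume ab: "a \<le> m" "b \<le> m"
    have "?P a = 0" if "a < m" "a \<noteq> l" using that by (intro prod_zero) auto
    then show "(1 / (?P l * of_nat (m - l))) * (?P a * raising m a b) + 0 * (?P a * raising m a b) = (if a = l \<and> b = Suc l then 1 else 0)"
      using ab assms \<open>?P l \<noteq> 0\<close> by (cases "a = m"; cases "a = l") auto
  qed
qed

lemma intertwines_lower_unit:
  assumes "l < m"
  shows "intertwines m r (\<lambda>a b. if a = Suc l \<and> b = l then 1 else 0)"
proof -
  define g where "g a = dg a - dg (a - 1)" for a
  \<comment> \<open>The nonzero rows of the lowering matrix are \<open>Suc s\<close> with
    \<open>s < m\<close>, hence the shift by one against the raising case.\<close>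
  let ?P = "\<lambda>a. \<Prod>s\<in>{..<m} - {l}. g a - g (Suc s)"
  have gg: "dg a - dg b = g a" if "lowering m a b \<noteq> 0" for a b
  proof -
    have "a = Suc b" using that by (auto split: if_splits)
    then show ?thesis by (simp only: g_def diff_Suc_1)
  qed
  define K where "K = complex_of_nat (Suc l * (m - l))"
  have "K \<noteq> 0" unfolding K_def of_nat_eq_0_iff using assms by simp
  have "?P (Suc l) \<noteq> 0" unfolding g_def using dg_gap_inj by (auto simp: algebra_simps)
  have "intertwines m r (\<lambda>a b. (1 / (?P (Suc l) * K)) * (?P a * lowering m a b) + 0 * (?P a * lowering m a b))"
    by (intro intertwines_lincomb intertwines_ad_diag[OF down gg])
  then show ?thesis
  proof (rule intertwines_cong)
    fix a b assume ab: "a \<le> m" "b \<le> m"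
    have "?P (Suc b) = 0" if "b < m" "b \<noteq> l" using that by (intro prod_zero) auto
    then show "(1 / (?P (Suc l) * K)) * (?P a * lowering m a b) + 0 * (?P a * lowering m a b) = (if a = Suc l \<and> b = l then 1 else 0)"
      using ab assms \<open>?P (Suc l) \<noteq> 0\<close> \<open>K \<noteq> 0\<close> by (cases "b = m"; cases "b = l") (auto simp flip: K_def simp del: of_nat_Suc of_nat_mult mult_Suc)
  qed
qed

section \<open>Consequences of commuting with the elementary raising and lowering units\<close>

lemma sum_of_bool_eq_card: "(\<Sum>i\<in>(UNIV :: 'k set). if P i then 1 else 0 :: complex) = of_nat (card {i. P i})"
  by (simp add: sum.If_cases)

text \<open>A weight argument: the commutator of the units at \<open>l\<close> is diagonal with
  entries 1 at \<open>l\<close> and -1 at \<open>Suc l\<close>, and it acts on either side by a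
  difference of multiplicities. Where \<open>r\<close> is nonzero, the excess \<open>d l\<close> of
  \<open>\<alpha>\<close> over \<open>\<beta>\<close> is thus independent of
  \<open>l\<close>.\<close>

lemma nonzero_imp_count_eq:
  assumes ab: "\<forall>i. \<alpha> i \<le> m" "\<forall>i. \<beta> i \<le> m" and nz: "r \<alpha> \<beta> \<noteq> 0"
  shows "card {i. \<alpha> i = l} = card {i. \<beta> i = l}"
proof -
  define d where "d l = complex_of_nat (card {i. \<alpha> i = l}) - of_nat (card {i. \<beta> i = l})" for l
  have step: "d l = d (Suc l)" if l: "l < m" for l
  proof -
    let ?f = "\<lambda>a. (if a = l then 1 else 0) + (-1) * (if a = Suc l then 1 else 0) :: complex"
    have "intertwines m r (\<lambda>a b. if a = b then ?f a else 0)"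
    proof (rule intertwines_cong[OF intertwines_commutator[OF intertwines_raise_unit[OF l] intertwines_lower_unit[OF l]]])
      fix a b assume "a \<le> m" "b \<le> m"
      have 1: "(\<Sum>k\<le>m. (if a = l \<and> k = Suc l then 1 else 0) * (if k = Suc l \<and> b = l then 1 else 0) :: complex)
         = (\<Sum>k\<le>m. if k = Suc l then (if a = l \<and> b = l then 1 else 0) else 0)"
        by (intro sum.cong refl) auto
      have 2: "(\<Sum>k\<le>m. (if a = Suc l \<and> k = l then 1 else 0) * (if k = l \<and> b = Suc l then 1 else 0) :: complex)
         = (\<Sum>k\<le>m. if k = l then (if a = Suc l \<and> b = Suc l then 1 else 0) else 0)"
        by (intro sum.cong refl) auto
      show "commutator m (\<lambda>a b. if a = l \<and> b = Suc l then 1 else 0) (\<lambda>a b. if a = Suc l \<and> b = l then 1 else 0) a b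
        = (if a = b then ?f a else 0)"
        unfolding commutator_def sum_subtractf 1 2 using l by (auto simp: Suc_le_eq)
    qed
    then have "left_act m (\<lambda>a b. if a = b then ?f a else 0) r \<alpha> \<beta> = right_act m (\<lambda>a b. if a = b then ?f a else 0) r \<alpha> \<beta>"
      using ab unfolding intertwines_def by blast
    then have "(\<Sum>i\<in>UNIV. ?f (\<alpha> i)) = (\<Sum>j\<in>UNIV. ?f (\<beta> j))"
      unfolding act_diag[OF ab(1)] act_diag[OF ab(2)] using nz by simp
    then show ?thesis
      unfolding sum.distrib sum_distrib_left[symmetric] sum_of_bool_eq_card d_def by (simp add: algebra_simps)
  qed
  have d0: "d l = d 0" if "l \<le> m" for l
    using that by (induction l) (auto simp: step[symmetric])
  have total: "(\<Sum>l\<le>m. complex_of_nat (card {i. \<gamma> i = l})) = of_nat (CARD('k))" if "\<forall>i. \<gamma> i \<le> m" for \<gamma> :: "'k \<Rightarrow> nat"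
  proof -
    have "(\<Sum>l\<le>m. complex_of_nat (card {i. \<gamma> i = l})) = (\<Sum>l\<le>m. \<Sum>i\<in>UNIV. if \<gamma> i = l then 1 else 0)"
      by (simp only: sum_of_bool_eq_card)
    also have "\<dots> = (\<Sum>i\<in>(UNIV :: 'k set). \<Sum>l\<le>m. if \<gamma> i = l then 1 else 0)" by (rule sum.swap)
    also have "\<dots> = (\<Sum>i\<in>(UNIV :: 'k set). 1)" using that by (intro sum.cong refl) simp
    finally show ?thesis by simp
  qed
  \<comment> \<open>Both families of multiplicities sum to \<open>CARD('k)\<close>, so the constant
    excess, added over the \<open>m + 1\<close> values, is zero.\<close>
  have "(\<Sum>l\<le>m. d l) = 0" unfolding d_def sum_subtractf total[OF ab(1)] total[OF ab(2)] by simp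
  moreover have "(\<Sum>l\<le>m. d l) = (\<Sum>l\<le>m. d 0)" by (rule sum.cong[OF refl], rule d0) simp
  ultimately have "of_nat (Suc m) * d 0 = 0" by simp
  then have z: "d 0 = 0" by (simp del: of_nat_Suc)
  show ?thesis
  proof (cases "l \<le> m")
    case True
    then have "d l = 0" using d0 z by metis
    then show ?thesis unfolding d_def right_minus_eq of_nat_eq_iff .
  next
    case False
    then have "\<alpha> i \<noteq> l" "\<beta> i \<noteq> l" for i using ab by metis+
    then show ?thesis by simp
  qed
qed

text \<open>The intertwining relation for the unit that raises \<open>\<alpha> i\<close> is read at
  the entry from \<open>\<alpha>\<close> to the raised vector. As \<open>\<alpha> i\<close> occurs
  once in \<open>\<alpha>\<close> and its successor is free, each side has a single term, and both
  terms are diagonal entries of \<open>r\<close>.\<close>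

lemma diagonal_raise:
  assumes inj: "inj \<alpha>" and box: "\<forall>i. \<alpha> i \<le> m" and i: "\<alpha> i < m" "Suc (\<alpha> i) \<notin> range \<alpha>"
  shows "r (\<alpha>(i := Suc (\<alpha> i))) (\<alpha>(i := Suc (\<alpha> i))) = r \<alpha> \<alpha>"
proof -
  define \<beta> where "\<beta> = \<alpha>(i := Suc (\<alpha> i))"
  have bb: "\<forall>j. \<beta> j \<le> m" using box i by (auto simp: \<beta>_def)
  have uniq: "\<alpha> j = \<alpha> i \<longleftrightarrow> j = i" for j using inj by (auto simp: inj_def)
  have uniq': "\<beta> j = Suc (\<alpha> i) \<longleftrightarrow> j = i" for j
    using i(2) by (auto simp: \<beta>_def) (metis rangeI)
  let ?f = "\<lambda>a. if a = \<alpha> i then 1 else 0 :: complex"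
  have "intertwines m r (\<lambda>a b. if b = Suc a then ?f a else 0)"
    by (rule intertwines_cong[OF intertwines_raise_unit[OF i(1)]]) auto
  then have "left_act m (\<lambda>a b. if b = Suc a then ?f a else 0) r \<alpha> \<beta> = right_act m (\<lambda>a b. if b = Suc a then ?f a else 0) r \<alpha> \<beta>"
    using box bb unfolding intertwines_def by blast
  moreover have "left_act m (\<lambda>a b. if b = Suc a then ?f a else 0) r \<alpha> \<beta> = r \<beta> \<beta>"
  proof -
    have "left_act m (\<lambda>a b. if b = Suc a then ?f a else 0) r \<alpha> \<beta> = (\<Sum>j\<in>UNIV. if j = i then r \<beta> \<beta> else 0)"
      unfolding act_raise(1) using i by (intro sum.cong refl) (auto simp: uniq \<beta>_def)
    then show ?thesis by simp
  qed
  moreover have "right_act m (\<lambda>a b. if b = Suc a then ?f a else 0) r \<alpha> \<beta> = r \<alpha> \<alpha>"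
  proof -
    have "right_act m (\<lambda>a b. if b = Suc a then ?f a else 0) r \<alpha> \<beta> = (\<Sum>j\<in>UNIV. if j = i then r \<alpha> \<alpha> else 0)"
      unfolding act_raise(2)[OF bb]
    proof (intro sum.cong refl)
      fix j
      have "0 < \<beta> j \<and> \<beta> j - 1 = \<alpha> i \<longleftrightarrow> j = i" using uniq'[of j] by auto
      moreover have "\<beta>(i := \<alpha> i) = \<alpha>" by (simp add: \<beta>_def fun_upd_idem)
      ultimately show "(if 0 < \<beta> j then ?f (\<beta> j - 1) * r \<alpha> (\<beta>(j := \<beta> j - 1)) else 0) = (if j = i then r \<alpha> \<alpha> else 0)"
        by auto
    qed
    then show ?thesis by simp
  qed
  ultimately show ?thesis by (simp add: \<beta>_def)
qed

section \<open>Antisymmetric intertwiners are scalar\<close>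

context
  fixes \<rho> :: complex
  assumes antisym_left: "\<And>\<alpha> \<beta> \<sigma>. \<sigma> permutes UNIV \<Longrightarrow> r (\<alpha> \<circ> \<sigma>) \<beta> = of_int (sign \<sigma>) * r \<alpha> \<beta>"
    and antisym_right: "\<And>\<alpha> \<beta> \<sigma>. \<sigma> permutes UNIV \<Longrightarrow> r \<alpha> (\<beta> \<circ> \<sigma>) = of_int (sign \<sigma>) * r \<alpha> \<beta>"
    and top: "\<And>\<alpha>. inj \<alpha> \<Longrightarrow> range \<alpha> = {Suc m - CARD('k)..m} \<Longrightarrow> r \<alpha> \<alpha> = \<rho>"
begin

text \<open>Exponents are pushed upwards one at a time by \<open>diagonal_raise\<close>, which
  lowers the total distance to \<open>m\<close>. When no exponent can move, the range is an interval
  ending at \<open>m\<close>, which is the case covered by \<open>top\<close>.\<close>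

lemma diagonal_const:
  assumes "inj \<alpha>" "\<forall>i. \<alpha> i \<le> m"
  shows "r \<alpha> \<alpha> = \<rho>"
  using assms
proof (induction "\<Sum>i\<in>UNIV. m - \<alpha> i" arbitrary: \<alpha> rule: less_induct)
  case less
  show ?case
  proof (cases "\<exists>i. \<alpha> i < m \<and> Suc (\<alpha> i) \<notin> range \<alpha>")
    case True
    then obtain i where i: "\<alpha> i < m" "Suc (\<alpha> i) \<notin> range \<alpha>" by blast
    define \<beta> where "\<beta> = \<alpha>(i := Suc (\<alpha> i))"
    have "(\<Sum>j\<in>UNIV. m - \<beta> j) < (\<Sum>j\<in>UNIV. m - \<alpha> j)"
      by (rule sum_strict_mono_ex1) (use i in \<open>auto simp: \<beta>_def intro!: exI[of _ i]\<close>)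
    moreover have "inj \<beta>"
      using less.prems(1) i(2) by (auto simp: \<beta>_def inj_def) (metis rangeI)
    moreover have "\<forall>j. \<beta> j \<le> m" using less.prems(2) i by (auto simp: \<beta>_def)
    ultimately have "r \<beta> \<beta> = \<rho>" by (rule less.hyps)
    then show ?thesis using diagonal_raise[OF less.prems i] by (simp add: \<beta>_def)
  next
    case False
    define a where "a = Min (range \<alpha>)"
    have ain: "a \<in> range \<alpha>" unfolding a_def by (intro Min_in) auto
    have sub: "range \<alpha> \<subseteq> {a..m}" unfolding a_def using less.prems(2) by auto
    have "a + d \<in> range \<alpha>" if "a + d \<le> m" for d
      using that
    proof (induction d)
      case (Suc d)
      then obtain i where "\<alpha> i = a + d" by (metis Suc_leD add_Suc_right imageE)
      then show ?case using False Suc.prems by (metis Suc_le_eq add_Suc_right)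
    qed (use ain in simp)
    then have "{a..m} \<subseteq> range \<alpha>" by (metis atLeastAtMost_iff le_Suc_ex subsetI)
    with sub have eq: "range \<alpha> = {a..m}" by blast
    have "CARD('k) = card (range \<alpha>)" using less.prems(1) by (simp add: card_image)
    then have "CARD('k) = Suc m - a" unfolding eq by simp
    moreover have "a \<le> m" using ain sub by auto
    ultimately have "a = Suc m - CARD('k)" by simp
    then show ?thesis using top[OF less.prems(1)] eq by simp
  qed
qed

text \<open>For injective \<open>\<alpha>\<close>, equal multiplicities leave only the
  rearrangements of \<open>\<alpha>\<close> in the row; antisymmetry gives them the values
  \<open>\<plusminus>\<rho>\<close>, and the sum is a Leibniz expansion. A repeated exponent makes
  both sides zero.\<close>

lemma row_sum_eq_det:
  fixes w :: "complex^'k"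
  assumes box: "\<forall>i. \<alpha> i \<le> m"
  shows "(\<Sum>\<beta>\<in>box m. r \<alpha> \<beta> * (\<Prod>j\<in>UNIV. (w $ j) ^ \<beta> j)) = \<rho> * det (\<chi> i j. (w $ j) ^ \<alpha> i)"
proof (cases "inj \<alpha>")
  case False
  then obtain i j where ij: "i \<noteq> j" "\<alpha> i = \<alpha> j" by (auto simp: inj_def)
  have "\<alpha> \<circ> Transposition.transpose i j = \<alpha>" using ij by (auto simp: fun_eq_iff Transposition.transpose_def)
  then have "r \<alpha> \<beta> = 0" for \<beta>
    using antisym_left[of "Transposition.transpose i j" \<alpha> \<beta>] ij by (simp add: permutes_swap_id sign_swap_id)
  moreover have "det (\<chi> i j. (w $ j) ^ \<alpha> i) = 0"
    by (rule det_identical_rows[OF ij(1)]) (simp add: row_def ij(2))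
  ultimately show ?thesis by simp
next
  case True
  let ?P = "{\<sigma>. \<sigma> permutes (UNIV :: 'k set)}"
  have "(\<Sum>\<beta>\<in>box m. r \<alpha> \<beta> * (\<Prod>j\<in>UNIV. (w $ j) ^ \<beta> j))
    = (\<Sum>\<beta>\<in>(\<lambda>\<sigma>. \<alpha> \<circ> \<sigma>) ` ?P. r \<alpha> \<beta> * (\<Prod>j\<in>UNIV. (w $ j) ^ \<beta> j))"
  proof (rule sum.mono_neutral_right)
    show "finite (PiE (UNIV :: 'k set) (\<lambda>_. {..m}))" by (rule finite_PiE) auto
    show "(\<lambda>\<sigma>. \<alpha> \<circ> \<sigma>) ` ?P \<subseteq> box m" using box by auto
    show "\<forall>\<beta>\<in>box m - (\<lambda>\<sigma>. \<alpha> \<circ> \<sigma>) ` ?P. r \<alpha> \<beta> * (\<Prod>j\<in>UNIV. (w $ j) ^ \<beta> j) = 0"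
    proof (rule ballI, rule ccontr)
      fix \<beta> assume b: "\<beta> \<in> box m - (\<lambda>\<sigma>. \<alpha> \<circ> \<sigma>) ` ?P"
        and nz: "r \<alpha> \<beta> * (\<Prod>j\<in>UNIV. (w $ j) ^ \<beta> j) \<noteq> 0"
      then have bb: "\<forall>i. \<beta> i \<le> m" and cnt: "\<And>l. card {i. \<alpha> i = l} = card {i. \<beta> i = l}"
        using nonzero_imp_count_eq[OF box, of \<beta>] by (auto simp: PiE_iff)
      have sub: "\<beta> i \<in> range \<alpha>" for i
      proof (rule ccontr)
        assume "\<beta> i \<notin> range \<alpha>"
        then have "{j. \<alpha> j = \<beta> i} = {}" by (metis (mono_tags, lifting) Collect_empty_eq rangeI)
        then have "card {j. \<beta> j = \<beta> i} = 0" using cnt[of "\<beta> i"] by simp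
        then show False by (simp add: card_eq_0_iff) blast
      qed
      have injb: "inj \<beta>"
      proof (rule injI)
        fix i j assume e: "\<beta> i = \<beta> j"
        have "card {l. \<alpha> l = \<beta> i} \<le> 1" using True by (auto simp: card_le_Suc0_iff_eq inj_def)
        then have "card {l. \<beta> l = \<beta> i} \<le> 1" using cnt by metis
        then show "i = j" using e by (auto simp: card_le_Suc0_iff_eq)
      qed
      \<comment> \<open>The permutation that rearranges \<open>\<alpha>\<close> into
        \<open>\<beta>\<close>; it exists because \<open>\<beta>\<close> is injective with values in
        \<open>range \<alpha>\<close>.\<close>
      define \<sigma> where "\<sigma> = inv \<alpha> \<circ> \<beta>"
      have as: "\<alpha> \<circ> \<sigma> = \<beta>" using sub by (auto simp: \<sigma>_def fun_eq_iff f_inv_into_f)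
      have "inj \<sigma>" using injb by (metis as inj_on_imageI2)
      then have "\<sigma> permutes UNIV" by (intro bij_imp_permutes) (auto simp: bij_betw_def finite_UNIV_inj_surj)
      then show False using b as by blast
    qed
  qed
  also have "\<dots> = (\<Sum>\<sigma>\<in>?P. r \<alpha> (\<alpha> \<circ> \<sigma>) * (\<Prod>j\<in>UNIV. (w $ j) ^ (\<alpha> \<circ> \<sigma>) j))"
  proof (rule sum.reindex[unfolded o_def[of "\<lambda>x. r _ _ * _ x"], THEN trans])
    show "inj_on (\<lambda>\<sigma>. \<alpha> \<circ> \<sigma>) ?P" using True by (auto simp: inj_on_def fun_eq_iff inj_def)
  qed (simp add: o_def)
  also have "\<dots> = (\<Sum>\<sigma>\<in>?P. \<rho> * (of_int (sign \<sigma>) * (\<Prod>j\<in>UNIV. (w $ j) ^ \<alpha> (\<sigma> j))))"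
    using diagonal_const[OF True box] by (intro sum.cong refl) (simp add: antisym_right)
  also have "\<dots> = \<rho> * det (transpose (\<chi> i j. (w $ j) ^ \<alpha> i))"
    by (simp add: det_def transpose_def sum_distrib_left)
  finally show ?thesis by simp
qed

end

end

text \<open>Cauchy--Binet before grouping: every row is expanded separately and the sum runs over
  all exponent functions, not over subsets.\<close>

lemma det_sum_rows:
  fixes f :: "'k::finite \<Rightarrow> nat \<Rightarrow> complex" and g :: "nat \<Rightarrow> 'k \<Rightarrow> complex"
  shows "det (\<chi> i j. \<Sum>l\<le>m. f i l * g l j)
    = (\<Sum>\<alpha>\<in>box m. (\<Prod>i\<in>UNIV. f i (\<alpha> i)) * det (\<chi> i j. g (\<alpha> i) j))"
proof -
  have "det (\<chi> i j. \<Sum>l\<le>m. f i l * g l j) = (\<Sum>\<sigma> | \<sigma> permutes UNIV. of_int (sign \<sigma>) *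
      (\<Sum>\<alpha>\<in>box m. \<Prod>i\<in>UNIV. f i (\<alpha> i) * g (\<alpha> i) (\<sigma> i)))"
    unfolding det_def by (simp add: prod_sum_PiE)
  also have "\<dots> = (\<Sum>\<alpha>\<in>box m. \<Sum>\<sigma> | \<sigma> permutes UNIV. of_int (sign \<sigma>) *
      (\<Prod>i\<in>UNIV. f i (\<alpha> i) * g (\<alpha> i) (\<sigma> i)))"
    unfolding sum_distrib_left by (rule sum.swap)
  also have "\<dots> = (\<Sum>\<alpha>\<in>box m. (\<Prod>i\<in>UNIV. f i (\<alpha> i)) * det (\<chi> i j. g (\<alpha> i) j))"
    unfolding det_def by (simp add: prod.distrib sum_distrib_left mult_ac)
  finally show ?thesis .
qed

section \<open>Polynomials in the matrix entries\<close>

text \<open>Polynomials are kept as functions, so that the same one can be evaluated at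
  \<open>G\<close> and at its conjugate transpose; conjugates of entries are excluded, which makes
  complex differentiation possible.\<close>

inductive_set mat_poly :: "(complex^'n^'n \<Rightarrow> complex) set" where
  const: "(\<lambda>A. c) \<in> mat_poly"
| entry: "(\<lambda>A. A $ i $ j) \<in> mat_poly"
| add: "f \<in> mat_poly \<Longrightarrow> g \<in> mat_poly \<Longrightarrow> (\<lambda>A. f A + g A) \<in> mat_poly"
| mult: "f \<in> mat_poly \<Longrightarrow> g \<in> mat_poly \<Longrightarrow> (\<lambda>A. f A * g A) \<in> mat_poly"

definition shift :: "complex \<Rightarrow> complex^'n^'n \<Rightarrow> complex^'n^'n \<Rightarrow> complex^'n^'n" where
  "shift s H A = (\<chi> i j. A $ i $ j + s * H $ i $ j)"

definition unit_mat :: "'n \<Rightarrow> 'n \<Rightarrow> complex^'n^'n" where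
  "unit_mat a b = axis a (axis b 1)"

definition pd :: "'n \<Rightarrow> 'n \<Rightarrow> (complex^'n^'n \<Rightarrow> complex) \<Rightarrow> complex^'n^'n \<Rightarrow> complex" where
  "pd a b f A = deriv (\<lambda>s. f (shift s (unit_mat a b) A)) 0"

lemma shift_0 [simp]: "shift 0 H A = A"
  by (simp add: shift_def vec_eq_iff)

text \<open>The induction carries a full gradient of polynomials valid for every direction
  \<open>H\<close>. Besides the matrix units, the direction \<open>- mat 1\<close> is needed later
  to convert derivatives in \<open>G\<close> into derivatives in the spectral parameter.\<close>

lemma mat_poly_deriv_ex:
  assumes "f \<in> mat_poly"
  shows "\<exists>D. (\<forall>a b. D a b \<in> mat_poly) \<and>
    (\<forall>A H. ((\<lambda>s. f (shift s H A)) has_field_derivative (\<Sum>a\<in>UNIV. \<Sum>b\<in>UNIV. H $ a $ b * D a b A)) (at 0))"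
  using assms
proof induction
  case (const c)
  show ?case by (rule exI[of _ "\<lambda>_ _ _. 0"]) (auto intro: mat_poly.const)
next
  case (entry i j)
  have "(\<Sum>a\<in>UNIV. \<Sum>b\<in>UNIV. H $ a $ b * (if a = i \<and> b = j then 1 else 0)) = H $ i $ j" for H :: "complex^'a^'a"
  proof -
    have "(\<Sum>a\<in>UNIV. \<Sum>b\<in>UNIV. H $ a $ b * (if a = i \<and> b = j then 1 else 0))
       = (\<Sum>a\<in>UNIV. \<Sum>b\<in>UNIV. if b = j then (if a = i then H $ a $ b else 0) else 0)"
      by (intro sum.cong refl) auto
    then show ?thesis by simp
  qed
  then show ?case
    by (intro exI[of _ "\<lambda>a b _. if a = i \<and> b = j then 1 else 0"])
      (auto intro!: mat_poly.const derivative_eq_intros simp: shift_def)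
next
  case (add f g)
  then obtain D E where D: "\<forall>a b. D a b \<in> mat_poly" "\<And>A H. ((\<lambda>s. f (shift s H A)) has_field_derivative (\<Sum>a\<in>UNIV. \<Sum>b\<in>UNIV. H $ a $ b * D a b A)) (at 0)"
    and E: "\<forall>a b. E a b \<in> mat_poly" "\<And>A H. ((\<lambda>s. g (shift s H A)) has_field_derivative (\<Sum>a\<in>UNIV. \<Sum>b\<in>UNIV. H $ a $ b * E a b A)) (at 0)"
    by blast
  show ?case
    using D(1) E(1) DERIV_add[OF D(2) E(2)]
    by (intro exI[of _ "\<lambda>a b A. D a b A + E a b A"]) (auto intro: mat_poly.add simp: ring_distribs sum.distrib)
next
  case (mult f g)
  then obtain D E where D: "\<forall>a b. D a b \<in> mat_poly" "\<And>A H. ((\<lambda>s. f (shift s H A)) has_field_derivative (\<Sum>a\<in>UNIV. \<Sum>b\<in>UNIV. H $ a $ b * D a b A)) (at 0)"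
    and E: "\<forall>a b. E a b \<in> mat_poly" "\<And>A H. ((\<lambda>s. g (shift s H A)) has_field_derivative (\<Sum>a\<in>UNIV. \<Sum>b\<in>UNIV. H $ a $ b * E a b A)) (at 0)"
    by blast
  show ?case
  proof (intro exI[of _ "\<lambda>a b A. D a b A * g A + E a b A * f A"] conjI allI)
    fix a b show "(\<lambda>A. D a b A * g A + E a b A * f A) \<in> mat_poly"
      by (intro mat_poly.add mat_poly.mult mult.hyps D(1)[rule_format] E(1)[rule_format])
    fix A H
    show "((\<lambda>s. f (shift s H A) * g (shift s H A)) has_field_derivative
        (\<Sum>a\<in>UNIV. \<Sum>b\<in>UNIV. H $ a $ b * (D a b A * g A + E a b A * f A))) (at 0)"
      using DERIV_mult[OF D(2)[of H A] E(2)[of H A]]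
      by (simp add: ring_distribs sum.distrib sum_distrib_left mult_ac)
  qed
qed

lemma sum_unit_mat: "(\<Sum>i\<in>UNIV. \<Sum>j\<in>UNIV. unit_mat a b $ i $ j * f i j) = f a b"
proof -
  have "(\<Sum>i\<in>UNIV. \<Sum>j\<in>UNIV. unit_mat a b $ i $ j * f i j) = (\<Sum>i\<in>UNIV. \<Sum>j\<in>UNIV. if j = b then (if i = a then f i j else 0) else 0)"
    by (intro sum.cong refl) (auto simp: unit_mat_def axis_def)
  then show ?thesis by simp
qed

lemma
  assumes "f \<in> mat_poly"
  shows pd_mat_poly: "pd a b f \<in> mat_poly"
    and has_field_derivative_shift: "((\<lambda>s. f (shift s H A)) has_field_derivative (\<Sum>i\<in>UNIV. \<Sum>j\<in>UNIV. H $ i $ j * pd i j f A)) (at 0)"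
proof -
  obtain D where D: "\<forall>a b. D a b \<in> mat_poly" "\<And>A H. ((\<lambda>s. f (shift s H A)) has_field_derivative (\<Sum>a\<in>UNIV. \<Sum>b\<in>UNIV. H $ a $ b * D a b A)) (at 0)"
    using mat_poly_deriv_ex[OF assms] by blast
  have pd: "pd a b f = D a b" for a b
    using D(2)[of "unit_mat a b"] unfolding pd_def sum_unit_mat by (auto simp: DERIV_imp_deriv)
  show "pd a b f \<in> mat_poly" using D(1) by (simp add: pd)
  show "((\<lambda>s. f (shift s H A)) has_field_derivative (\<Sum>i\<in>UNIV. \<Sum>j\<in>UNIV. H $ i $ j * pd i j f A)) (at 0)"
    using D(2) by (simp add: pd)
qed

lemma has_field_derivative_pd:
  assumes "f \<in> mat_poly"
  shows "((\<lambda>s. f (shift s (unit_mat a b) A)) has_field_derivative pd a b f A) (at 0)"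
  using has_field_derivative_shift[OF assms, of "unit_mat a b" A] by (simp only: sum_unit_mat)

lemma pdI: "((\<lambda>s. f (shift s (unit_mat a b) A)) has_field_derivative d) (at 0) \<Longrightarrow> pd a b f A = d"
  unfolding pd_def by (rule DERIV_imp_deriv)

lemma pd_const [simp]: "pd a b (\<lambda>A. c) A = 0"
  by (rule pdI) simp

lemma pd_entry: "pd a b (\<lambda>A. A $ i $ j) A = (if a = i \<and> b = j then 1 else 0)"
  by (rule pdI) (auto intro!: derivative_eq_intros simp: shift_def unit_mat_def axis_def)

lemma pd_add: "f \<in> mat_poly \<Longrightarrow> g \<in> mat_poly \<Longrightarrow> pd a b (\<lambda>A. f A + g A) A = pd a b f A + pd a b g A"
  by (rule pdI) (intro DERIV_add has_field_derivative_pd)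

lemma pd_mult: "f \<in> mat_poly \<Longrightarrow> g \<in> mat_poly \<Longrightarrow> pd a b (\<lambda>A. f A * g A) A = pd a b f A * g A + f A * pd a b g A"
  using DERIV_mult[OF has_field_derivative_pd has_field_derivative_pd, of f g a b A a b A]
  by (intro pdI) (simp add: add.commute mult.commute)

lemma mat_poly_sum: "(\<And>i. i \<in> I \<Longrightarrow> f i \<in> mat_poly) \<Longrightarrow> (\<lambda>A. \<Sum>i\<in>I. f i A) \<in> mat_poly"
  by (induction I rule: infinite_finite_induct) (auto intro: mat_poly.intros)

lemma mat_poly_prod: "(\<And>i. i \<in> I \<Longrightarrow> f i \<in> mat_poly) \<Longrightarrow> (\<lambda>A. \<Prod>i\<in>I. f i A) \<in> mat_poly"
  by (induction I rule: infinite_finite_induct) (auto intro: mat_poly.intros)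

lemma mat_poly_minus: "f \<in> mat_poly \<Longrightarrow> (\<lambda>A. - f A) \<in> mat_poly"
  using mat_poly.mult[OF mat_poly.const[of "-1"], of f] by simp

lemma mat_poly_diff: "f \<in> mat_poly \<Longrightarrow> g \<in> mat_poly \<Longrightarrow> (\<lambda>A. f A - g A) \<in> mat_poly"
  using mat_poly.add[OF _ mat_poly_minus[of g], of f] by simp

lemma mat_poly_det: "(\<And>i j. (\<lambda>A. M A $ i $ j) \<in> mat_poly) \<Longrightarrow> (\<lambda>A. det (M A)) \<in> mat_poly"
  unfolding det_def by (intro mat_poly_sum mat_poly_prod mat_poly.mult mat_poly.const)

lemma mat_poly_trace: "(\<lambda>A. trace A) \<in> mat_poly"
  unfolding trace_def by (intro mat_poly_sum mat_poly.entry)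

lemmas mat_poly_intros = mat_poly.intros mat_poly_sum mat_poly_prod mat_poly_minus mat_poly_diff
  mat_poly_det mat_poly_trace pd_mat_poly

lemma pd_sum: "(\<And>i. i \<in> I \<Longrightarrow> f i \<in> mat_poly) \<Longrightarrow> pd a b (\<lambda>A. \<Sum>i\<in>I. f i A) A = (\<Sum>i\<in>I. pd a b (f i) A)"
  by (induction I rule: infinite_finite_induct) (simp_all add: pd_add mat_poly_sum)

lemma pd_cmult: "f \<in> mat_poly \<Longrightarrow> pd a b (\<lambda>A. c * f A) A = c * pd a b f A"
  by (simp add: pd_mult mat_poly.const)

lemma pd_minus: "f \<in> mat_poly \<Longrightarrow> pd a b (\<lambda>A. - f A) A = - pd a b f A"
  using pd_cmult[of f a b "-1" A] by simp

lemma pd_prod: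
  "(\<And>i. i \<in> I \<Longrightarrow> f i \<in> mat_poly) \<Longrightarrow> pd a b (\<lambda>A. \<Prod>i\<in>I. f i A) A = (\<Sum>i\<in>I. pd a b (f i) A * (\<Prod>j\<in>I - {i}. f j A))"
  by (rule pdI, rule has_field_derivative_prod[THEN DERIV_cong]) (auto intro!: has_field_derivative_pd)

section \<open>The bilinear Gaussian pairing\<close>

lemma bounded_linear_mat_entry: "bounded_linear (\<lambda>G :: complex^'n^'m. G $ i $ j)"
  by (intro bounded_linear_compose[OF bounded_linear_vec_nth] bounded_linear_vec_nth)

lemma tame_mat_poly: "f \<in> mat_poly \<Longrightarrow> tame f"
  by (induction rule: mat_poly.induct) (auto intro: tame_intros tame_linear bounded_linear_mat_entry)

lemma tame_mat_poly_conj: "f \<in> mat_poly \<Longrightarrow> tame (\<lambda>G. f (conj_transpose G))"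
proof (induction rule: mat_poly.induct)
  case (entry i j)
  have "tame (\<lambda>G :: complex^'a^'a. cnj (G $ j $ i))"
    by (intro tame_linear bounded_linear_compose[OF bounded_linear_cnj] bounded_linear_mat_entry)
  then show ?case by (simp add: conj_transpose_def)
qed (auto intro: tame_intros)

text \<open>A bilinear form of the Bargmann--Fock product: the second argument is evaluated at the
  conjugate transpose and is not itself conjugated, matching the two kinds of determinants in
  \<open>R_N\<close>.\<close>

definition pairing :: "(complex^'n^'n \<Rightarrow> complex) \<Rightarrow> (complex^'n^'n \<Rightarrow> complex) \<Rightarrow> complex" where
  "pairing f g = (LINT G|gauss. f G * g (conj_transpose G))"

lemma tame_pairing: "f \<in> mat_poly \<Longrightarrow> g \<in> mat_poly \<Longrightarrow> tame (\<lambda>G. f G * g (conj_transpose G))"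
  by (intro tame_mult tame_mat_poly tame_mat_poly_conj)

text \<open>Along the direction \<open>u\<close> of entry \<open>(a, b)\<close> the product
  \<open>f G * g (conj_transpose G)\<close> has derivative \<open>u * h1 G + cnj u * h2 G\<close>.
  Combining \<open>Stein\<close> for \<open>u = 1\<close> and \<open>u = \<i>\<close> isolates
  multiplication by the entry or by its conjugate, and each leaves one of the two terms:
  multiplication and differentiation are adjoint.\<close>

lemma
  fixes f g :: "complex^'n^'n \<Rightarrow> complex"
  assumes f: "f \<in> mat_poly" and g: "g \<in> mat_poly"
  shows pairing_pd_left: "pairing (pd a b f) g = pairing f (\<lambda>B. B $ b $ a * g B)"
    and pairing_pd_right: "pairing f (pd b a g) = pairing (\<lambda>G. G $ a $ b * f G) g"
proof -
  define h where "h G = f G * g (conj_transpose G)" for G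
  define h1 where "h1 G = pd a b f G * g (conj_transpose G)" for G
  define h2 where "h2 G = f G * pd b a g (conj_transpose G)" for G
  have th: "tame h" "tame h1" "tame h2"
    unfolding h_def h1_def h2_def by (intro tame_pairing pd_mat_poly f g)+
  have Stein_dir: "(LINT G|gauss. of_real (G \<bullet> axis a (axis b u)) * h G) = (LINT G|gauss. u * h1 G + cnj u * h2 G) / 2"
    if u: "u \<in> {1, \<i>}" for u :: complex
  proof (rule Stein)
    show "tame h" "tame (\<lambda>G. u * h1 G + cnj u * h2 G)" by (intro tame_intros th)+
    show "axis a (axis b u) \<in> (Basis :: (complex^'n^'n) set)" using u by (auto simp: axis_in_Basis_iff Basis_complex_def)
    fix G :: "complex^'n^'n"
    have 1: "G + t *\<^sub>R axis a (axis b u) = shift (of_real t * u) (unit_mat a b) G" for t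
      by (auto simp: shift_def unit_mat_def vec_eq_iff axis_def scaleR_conv_of_real[where 'a=complex])
    have 2: "conj_transpose (shift (of_real t * u) (unit_mat a b) G) = shift (of_real t * cnj u) (unit_mat b a) (conj_transpose G)" for t
      by (auto simp: shift_def unit_mat_def vec_eq_iff axis_def conj_transpose_def)
    have sc: "((\<lambda>z. p (shift (z * v) H A)) has_field_derivative v * d) (at 0)"
      if "((\<lambda>s. p (shift s H A)) has_field_derivative d) (at 0)" for p and H A :: "complex^'n^'n" and v d
    proof -
      have "((\<lambda>z. z * v) has_field_derivative v) (at 0)" by (auto intro!: derivative_eq_intros)
      from DERIV_chain2[of "\<lambda>s. p (shift s H A)" d "\<lambda>z. z * v", OF _ this] that show ?thesis
        by (simp add: mult.commute)
    qed
    have "((\<lambda>z. f (shift (z * u) (unit_mat a b) G) * g (shift (z * cnj u) (unit_mat b a) (conj_transpose G)))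
        has_field_derivative (u * h1 G + cnj u * h2 G)) (at (of_real 0))"
      using DERIV_mult[OF sc[OF has_field_derivative_pd[OF f]] sc[OF has_field_derivative_pd[OF g]], of u a b G "cnj u" b a "conj_transpose G"]
      by (simp add: h1_def h2_def mult_ac)
    from has_vector_derivative_real_field[OF this]
    show "((\<lambda>t. h (G + t *\<^sub>R axis a (axis b u))) has_vector_derivative u * h1 G + cnj u * h2 G) (at 0)"
      by (simp add: 1 2 h_def)
  qed
  have ip: "G \<bullet> axis a (axis b 1) = Re (G $ a $ b)" "G \<bullet> axis a (axis b \<i>) = Im (G $ a $ b)" for G :: "complex^'n^'n"
    by (simp_all add: inner_axis)
  have split: "(LINT G|gauss. u * h1 G + v * h2 G) = u * (LINT G|gauss. h1 G) + v * (LINT G|gauss. h2 G)" for u v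
    using tame_integrable[OF th(2)] tame_integrable[OF th(3)] by simp
  have ti: "integrable gauss (\<lambda>G. of_real (Re (G $ a $ b)) * h G)" "integrable gauss (\<lambda>G. of_real (Im (G $ a $ b)) * h G)"
    by (intro tame_integrable tame_mult th tame_linear bounded_linear_compose[OF bounded_linear_of_real]
      bounded_linear_compose[OF bounded_linear_Re] bounded_linear_compose[OF bounded_linear_Im] bounded_linear_mat_entry)+
  have re: "(LINT G|gauss. of_real (Re (G $ a $ b)) * h G) = ((LINT G|gauss. h1 G) + (LINT G|gauss. h2 G)) / 2"
    using Stein_dir[of 1] unfolding ip split by simp
  have im: "(LINT G|gauss. of_real (Im (G $ a $ b)) * h G) = \<i> * ((LINT G|gauss. h1 G) - (LINT G|gauss. h2 G)) / 2"
    using Stein_dir[of \<i>] unfolding ip split by (simp add: algebra_simps)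
  have "(LINT G|gauss. cnj (G $ a $ b) * h G) = (LINT G|gauss. of_real (Re (G $ a $ b)) * h G - \<i> * (of_real (Im (G $ a $ b)) * h G))"
    by (intro Bochner_Integration.integral_cong refl) (simp add: complex_eq_iff)
  also have "\<dots> = (LINT G|gauss. h1 G)"
    using ti by (simp add: re im) (simp add: field_simps)
  finally show "pairing (pd a b f) g = pairing f (\<lambda>B. B $ b $ a * g B)"
    by (simp add: pairing_def h_def h1_def conj_transpose_def mult_ac)
  have "(LINT G|gauss. G $ a $ b * h G) = (LINT G|gauss. of_real (Re (G $ a $ b)) * h G + \<i> * (of_real (Im (G $ a $ b)) * h G))"
    by (intro Bochner_Integration.integral_cong refl) (simp add: complex_eq_iff)
  also have "\<dots> = (LINT G|gauss. h2 G)"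
    using ti by (simp add: re im) (simp add: field_simps)
  finally show "pairing f (pd b a g) = pairing (\<lambda>G. G $ a $ b * f G) g"
    by (simp add: pairing_def h_def h2_def mult_ac)
qed

lemma pairing_add_left: "f \<in> mat_poly \<Longrightarrow> f' \<in> mat_poly \<Longrightarrow> g \<in> mat_poly \<Longrightarrow> pairing (\<lambda>A. f A + f' A) g = pairing f g + pairing f' g"
  unfolding pairing_def distrib_right
  by (rule Bochner_Integration.integral_add) (auto intro: tame_integrable tame_pairing)

lemma pairing_add_right: "f \<in> mat_poly \<Longrightarrow> g \<in> mat_poly \<Longrightarrow> g' \<in> mat_poly \<Longrightarrow> pairing f (\<lambda>A. g A + g' A) = pairing f g + pairing f g'"
  unfolding pairing_def distrib_left
  by (rule Bochner_Integration.integral_add) (auto intro: tame_integrable tame_pairing)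

lemma pairing_cmult_left: "pairing (\<lambda>A. c * f A) g = c * pairing f g"
  by (simp add: pairing_def mult.assoc)

lemma pairing_cmult_right: "pairing f (\<lambda>A. c * g A) = c * pairing f g"
  by (simp add: pairing_def mult.left_commute)

text \<open>The hypotheses are symmetric under exchange of the arguments. One recursion, applied to
  the form and to its swapped version, will thus give both the raising and the lowering
  relation.\<close>

locale Stein_pairing =
  fixes P :: "(complex^'n^'n \<Rightarrow> complex) \<Rightarrow> (complex^'n^'n \<Rightarrow> complex) \<Rightarrow> complex"
  assumes add_left: "f \<in> mat_poly \<Longrightarrow> f' \<in> mat_poly \<Longrightarrow> g \<in> mat_poly \<Longrightarrow> P (\<lambda>A. f A + f' A) g = P f g + P f' g"
    and add_right: "f \<in> mat_poly \<Longrightarrow> g \<in> mat_poly \<Longrightarrow> g' \<in> mat_poly \<Longrightarrow> P f (\<lambda>A. g A + g' A) = P f g + P f g'"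
    and cmult_left: "P (\<lambda>A. c * f A) g = c * P f g"
    and cmult_right: "P f (\<lambda>A. c * g A) = c * P f g"
    and pd_left: "f \<in> mat_poly \<Longrightarrow> g \<in> mat_poly \<Longrightarrow> P (pd a b f) g = P f (\<lambda>B. B $ b $ a * g B)"
    and pd_right: "f \<in> mat_poly \<Longrightarrow> g \<in> mat_poly \<Longrightarrow> P f (pd b a g) = P (\<lambda>G. G $ a $ b * f G) g"
begin

lemma sum_left: "(\<And>i. i \<in> I \<Longrightarrow> f i \<in> mat_poly) \<Longrightarrow> g \<in> mat_poly \<Longrightarrow> P (\<lambda>A. \<Sum>i\<in>I. f i A) g = (\<Sum>i\<in>I. P (f i) g)"
proof (induction I rule: infinite_finite_induct)
  case empty
  show ?case using cmult_left[of 0 "\<lambda>_. 0" g] by simp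
next
  case (infinite I)
  then show ?case using cmult_left[of 0 "\<lambda>_. 0" g] by simp
qed (simp add: add_left mat_poly_sum)

lemma sum_right: "(\<And>i. i \<in> I \<Longrightarrow> g i \<in> mat_poly) \<Longrightarrow> f \<in> mat_poly \<Longrightarrow> P f (\<lambda>A. \<Sum>i\<in>I. g i A) = (\<Sum>i\<in>I. P f (g i))"
proof (induction I rule: infinite_finite_induct)
  case empty
  show ?case using cmult_right[of f 0 "\<lambda>_. 0"] by simp
next
  case (infinite I)
  then show ?case using cmult_right[of f 0 "\<lambda>_. 0"] by simp
qed (simp add: add_right mat_poly_sum)

lemma swapped: "Stein_pairing (\<lambda>f g. P g f)"
  by unfold_locales (simp_all add: add_left add_right cmult_left cmult_right pd_left pd_right)

end

lemma Stein_pairing_pairing: "Stein_pairing pairing"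
  by unfold_locales
    (rule pairing_add_left pairing_add_right pairing_cmult_left pairing_cmult_right pairing_pd_left pairing_pd_right; assumption?)+

section \<open>Characteristic polynomials\<close>

text \<open>The adjugate, written with a row replaced by a unit vector, so that no cofactor signs
  appear and row linearity applies directly.\<close>

definition adj :: "'a::comm_ring_1^'n^'n \<Rightarrow> 'a^'n^'n" where
  "adj M = (\<chi> b a. det (vec_lambda ((($) M)(a := axis b 1))))"

lemma mult_adj: "M ** adj M = mat (det (M :: 'a::comm_ring_1^'n::finite^'n))"
proof (simp only: vec_eq_iff, intro allI)
  fix a c
  have "(M ** adj M) $ a $ c = (\<Sum>b\<in>UNIV. M $ a $ b * det (vec_lambda ((($) M)(c := axis b 1))))"
    by (simp add: matrix_matrix_mult_def adj_def)
  also have "\<dots> = det (vec_lambda ((($) M)(c := \<Sum>b\<in>UNIV. M $ a $ b *s axis b 1)))"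
    by (rule det_upd_sum[symmetric]) simp
  also have "\<dots> = det (vec_lambda ((($) M)(c := M $ a)))"
    by (simp only: vec_sum_axis[symmetric])
  also have "\<dots> = mat (det M) $ a $ c"
  proof (cases "a = c")
    case True
    then have "vec_lambda ((($) M)(c := M $ a)) = M" by (simp add: vec_eq_iff)
    then show ?thesis using True by (simp add: mat_def)
  next
    case False
    then have "det (vec_lambda ((($) M)(c := M $ a))) = 0"
      by (intro det_identical_rows[of a c]) (auto simp: row_def)
    then show ?thesis using False by (simp add: mat_def)
  qed
  finally show "(M ** adj M) $ a $ c = mat (det M) $ a $ c" .
qed

text \<open>Replacing row \<open>b\<close> by the unit vector \<open>a\<close> restricts the Leibniz
  sum to permutations with \<open>p b = a\<close>; inverting the permutations exchanges the roles of
  \<open>a\<close> and \<open>b\<close>. This yields the inverse formula on the other side.\<close>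

lemma adj_transpose: "adj (transpose M) = transpose (adj (M :: 'a::comm_ring_1^'n::finite^'n))"
proof (simp only: vec_eq_iff, intro allI)
  fix b a
  have 0: "adj M $ a $ b = (\<Sum>p | p permutes UNIV. if p b = a then of_int (sign p) * (\<Prod>t\<in>UNIV - {b}. M $ t $ p t) else 0)" for M :: "'a^'n^'n" and a b
  proof -
    have "(\<Prod>t\<in>UNIV. vec_lambda ((($) M)(b := axis a 1)) $ t $ p t) = (if p b = a then (\<Prod>t\<in>UNIV - {b}. M $ t $ p t) else 0)" for p
      by (subst prod.remove[of _ b]) (auto simp: axis_def intro!: prod.cong)
    then show ?thesis by (simp add: adj_def det_def if_distrib[of "(*) _"] cong: if_cong)
  qed
  have "transpose (adj M) $ b $ a = adj M $ a $ b" by (simp add: transpose_def)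
  also have "\<dots> = (\<Sum>p | p permutes UNIV. if p b = a then of_int (sign p) * (\<Prod>t\<in>UNIV - {b}. M $ t $ p t) else 0)"
    by (rule 0)
  also have "\<dots> = (\<Sum>p | p permutes UNIV. if inv p b = a then of_int (sign (inv p)) * (\<Prod>t\<in>UNIV - {b}. M $ t $ inv p t) else 0)"
    by (rule sum_permutations_inverse)
  also have "\<dots> = (\<Sum>p | p permutes UNIV. if p a = b then of_int (sign p) * (\<Prod>t\<in>UNIV - {a}. transpose M $ t $ p t) else 0)"
  proof (intro sum.cong refl)
    fix p assume "p \<in> {p. p permutes (UNIV :: 'n set)}"
    then have p: "p permutes UNIV" by simp
    have e: "inv p b = a \<longleftrightarrow> p a = b" using p by (metis permutes_inv_eq)
    have s: "sign (inv p) = sign p" using p by (simp add: sign_inverse permutes_imp_permutation)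
    have "(\<Prod>t\<in>UNIV - {b}. M $ t $ inv p t) = (\<Prod>t\<in>UNIV - {a}. transpose M $ t $ p t)" if "p a = b"
    proof (rule prod.reindex_bij_witness[of _ p "inv p"])
    qed (use p that in \<open>auto simp: permutes_inverses transpose_def permutes_inv_eq dest: injD[OF permutes_inj[OF p]]\<close>)
    then show "(if inv p b = a then of_int (sign (inv p)) * (\<Prod>t\<in>UNIV - {b}. M $ t $ inv p t) else 0)
       = (if p a = b then of_int (sign p) * (\<Prod>t\<in>UNIV - {a}. transpose M $ t $ p t) else 0)"
      by (simp add: e s)
  qed
  also have "\<dots> = adj (transpose M) $ b $ a" by (rule 0[symmetric])
  finally show "adj (transpose M) $ b $ a = transpose (adj M) $ b $ a" ..
qed

lemma adj_mult: "adj M ** M = mat (det (M :: 'a::comm_ring_1^'n::finite^'n))"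
proof -
  have "transpose (adj M ** M) = transpose (mat (det M))"
    using mult_adj[of "transpose M"] by (simp add: matrix_transpose_mul adj_transpose transpose_mat)
  then show ?thesis by (metis transpose_transpose)
qed

text \<open>The sign is opposite to that in \<open>R_N\<close>, which makes the polynomial monic in
  \<open>t\<close>; the signs cancel between the two families of determinants.\<close>

definition chi :: "complex \<Rightarrow> complex^'n^'n \<Rightarrow> complex" where
  "chi t G = det (mat t - G)"

definition adjc :: "complex \<Rightarrow> complex^'n^'n \<Rightarrow> complex^'n^'n" where
  "adjc t G = adj (mat t - G)"

lemma chi_mat_poly: "chi t \<in> mat_poly"
  unfolding chi_def by (intro mat_poly_det) (simp, intro mat_poly_intros)

lemma adjc_mat_poly: "(\<lambda>G. adjc t G $ p $ q) \<in> mat_poly"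
proof -
  have "(\<lambda>G :: complex^'a^'a. det (vec_lambda ((($) (mat t - G))(q := axis p 1)))) \<in> mat_poly"
  proof (rule mat_poly_det)
    fix i j
    show "(\<lambda>G :: complex^'a^'a. vec_lambda ((($) (mat t - G))(q := axis p 1)) $ i $ j) \<in> mat_poly"
      by (cases "i = q") (simp_all add: mat_poly_intros)
  qed
  then show ?thesis by (simp add: adjc_def adj_def)
qed

lemma pd_chi: "pd a b (chi t) G = - adjc t G $ b $ a"
proof (rule pdI)
  have "chi t (shift s (unit_mat a b) G) = chi t G + s * - adjc t G $ b $ a" for s
  proof -
    have "mat t - shift s (unit_mat a b) G = vec_lambda ((($) (mat t - G))(a := (mat t - G) $ a + (- s) *s axis b 1))"
      by (auto simp: vec_eq_iff shift_def unit_mat_def axis_def)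
    then have "chi t (shift s (unit_mat a b) G) = det (vec_lambda ((($) (mat t - G))(a := (mat t - G) $ a)))
       + det (vec_lambda ((($) (mat t - G))(a := (- s) *s axis b 1)))"
      unfolding chi_def by (simp only: det_upd_add)
    also have "vec_lambda ((($) (mat t - G))(a := (mat t - G) $ a)) = mat t - G" by (simp add: vec_eq_iff)
    also have "det (vec_lambda ((($) (mat t - G))(a := (- s) *s axis b 1))) = (- s) * adjc t G $ b $ a"
      using det_upd_sum[of "{()}" "($) (mat t - G)" a "\<lambda>_. - s" "\<lambda>_. axis b 1"] by (simp add: adjc_def adj_def)
    finally show ?thesis by (simp add: chi_def)
  qed
  then show "((\<lambda>s. chi t (shift s (unit_mat a b) G)) has_field_derivative - adjc t G $ b $ a) (at 0)"
    by (auto intro!: derivative_eq_intros)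
qed

section \<open>Resolvent identities without denominators\<close>

lemma matrix_sub_ldistrib: "A ** (B - C) = A ** B - A ** C" for A :: "'a::ring_1^'n::finite^'m"
  by (simp add: vec_eq_iff matrix_matrix_mult_def right_diff_distrib sum_subtractf)

lemma matrix_sub_rdistrib: "(A - B) ** C = A ** C - B ** C" for A :: "'a::ring_1^'n::finite^'m"
  by (simp add: vec_eq_iff matrix_matrix_mult_def left_diff_distrib sum_subtractf)

lemma mult_adjc: "G ** adjc t G = mat t ** adjc t G - mat (chi t G)"
  using mult_adj[of "mat t - G"] unfolding adjc_def[symmetric] chi_def[symmetric]
  by (simp add: matrix_sub_rdistrib algebra_simps)

lemma adjc_mult: "adjc t G ** G = adjc t G ** mat t - mat (chi t G)"
  using adj_mult[of "mat t - G"] unfolding adjc_def[symmetric] chi_def[symmetric]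
  by (simp add: matrix_sub_ldistrib algebra_simps)

lemma mat_mult_nth: "(mat t ** A) $ i $ j = t * A $ i $ j" for A :: "'a::comm_ring_1^'m^'n::finite"
  by (simp add: matrix_matrix_mult_def mat_def if_distrib[of "\<lambda>x. x * _"] cong: if_cong)

lemma mult_mat_nth: "(A ** mat t) $ i $ j = A $ i $ j * t" for A :: "'a::comm_ring_1^'n::finite^'m"
  by (simp add: matrix_matrix_mult_def mat_def if_distrib[of "(*) _"] cong: if_cong)

lemma mat_commute: "A ** mat t = mat t ** A" for A :: "'a::comm_ring_1^'n::finite^'n"
  by (simp add: vec_eq_iff mat_mult_nth mult_mat_nth mult.commute)

lemma trace_mat_mult: "trace (mat t ** A) = t * trace A" for A :: "'a::comm_ring_1^'n::finite^'n"
  by (simp add: trace_def mat_mult_nth sum_distrib_left)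

lemma trace_mat: "trace (mat t :: 'a::comm_ring_1^'n::finite^'n) = of_nat CARD('n) * t"
  by (simp add: trace_def mat_def)

lemma trace_mult_adjc: "trace (G ** adjc t G) = t * trace (adjc t G) - of_nat CARD('n) * chi t (G :: complex^'n^'n)"
  by (simp add: mult_adjc trace_sub trace_mat_mult trace_mat)

text \<open>The resolvent identity multiplied by \<open>chi x G * chi y G\<close>, hence valid at
  eigenvalues too. It follows by computing \<open>adjc x G ** G ** adjc y G\<close> in two
  ways.\<close>

lemma adjc_mult_adjc:
  "mat (x - y) ** (adjc x G ** adjc y G) = mat (chi x G) ** adjc y G - mat (chi y G) ** adjc x G"
proof -
  have "adjc x G ** (G ** adjc y G) = adjc x G ** G ** adjc y G" by (simp add: matrix_mul_assoc)
  then have 1: "mat y ** (adjc x G ** adjc y G) - mat (chi y G) ** adjc x G = mat x ** (adjc x G ** adjc y G) - mat (chi x G) ** adjc y G"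
    unfolding mult_adjc adjc_mult by (simp add: matrix_sub_ldistrib matrix_sub_rdistrib matrix_mul_assoc mat_commute)
  have "mat (x - y) ** A = mat x ** A - mat y ** A" for A :: "complex^'a^'a"
    by (simp add: vec_eq_iff mat_mult_nth left_diff_distrib)
  then have "mat (x - y) ** (adjc x G ** adjc y G) = mat x ** (adjc x G ** adjc y G) - mat y ** (adjc x G ** adjc y G)" .
  also have "\<dots> = mat (chi x G) ** adjc y G - mat (chi y G) ** adjc x G"
    using 1 by (simp add: algebra_simps)
  finally show ?thesis .
qed

text \<open>The relation \<open>adjc t G ** (mat t - G) = mat (chi t G)\<close> is differentiated
  entrywise and multiplied on the right by the adjugate; \<open>(mat t - G) ** adjc t G\<close>
  produces the factor \<open>chi t G\<close> on the left.\<close>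

lemma pd_adjc: "chi t G * pd i j (\<lambda>G. adjc t G $ p $ s) G = adjc t G $ p $ i * adjc t G $ j $ s - adjc t G $ j $ i * adjc t G $ p $ s"
proof -
  let ?B = "adjc t G"
  define D where "D q = pd i j (\<lambda>G. adjc t G $ p $ q) G" for q
  have "D r * t - (\<Sum>q\<in>UNIV. D q * G $ q $ r + ?B $ p $ q * (if i = q \<and> j = r then 1 else 0)) = (if p = r then - ?B $ j $ i else 0)" for r
  proof -
    have "(\<lambda>G. adjc t G $ p $ r * t - (\<Sum>q\<in>UNIV. adjc t G $ p $ q * G $ q $ r)) = (\<lambda>G. (if p = r then 1 else 0) * chi t G)"
    proof
      fix G :: "complex^'a^'a"
      have "(\<Sum>q\<in>UNIV. adjc t G $ p $ q * G $ q $ r) = (adjc t G ** G) $ p $ r" by (simp add: matrix_matrix_mult_def)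
      then show "adjc t G $ p $ r * t - (\<Sum>q\<in>UNIV. adjc t G $ p $ q * G $ q $ r) = (if p = r then 1 else 0) * chi t G"
        unfolding adjc_mult by (simp add: mult_mat_nth) (simp add: mat_def)
    qed
    from arg_cong[OF this, of "\<lambda>f. pd i j f G"]
    have 1: "pd i j (\<lambda>G. t * adjc t G $ p $ r + (\<Sum>q\<in>UNIV. (-1) * (adjc t G $ p $ q * G $ q $ r))) G = pd i j (\<lambda>G. (if p = r then 1 else 0) * chi t G) G"
      by (simp add: mult.commute sum_negf)
    have 2: "pd i j (\<lambda>G. (if p = r then 1 else 0) * chi t G) G = (if p = r then - ?B $ j $ i else 0)"
      by (subst pd_cmult) (auto simp: chi_mat_poly pd_chi)
    have 3: "pd i j (\<lambda>G. t * adjc t G $ p $ r + (\<Sum>q\<in>UNIV. (-1) * (adjc t G $ p $ q * G $ q $ r))) G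
      = t * D r + (\<Sum>q\<in>UNIV. (-1) * (D q * G $ q $ r + ?B $ p $ q * (if i = q \<and> j = r then 1 else 0)))"
      unfolding D_def
      by (subst pd_add pd_sum pd_cmult pd_mult pd_entry; (intro mat_poly_intros adjc_mat_poly)?)+ (rule refl)
    have "t * D r + (\<Sum>q\<in>UNIV. (-1) * (D q * G $ q $ r + ?B $ p $ q * (if i = q \<and> j = r then 1 else 0)))
      = (if p = r then - ?B $ j $ i else 0)"
      using trans[OF sym[OF 3] trans[OF 1 2]] .
    then show ?thesis by (simp only: sum_distrib_left[symmetric]) (simp add: mult.commute)
  qed
  moreover have "(\<Sum>q\<in>UNIV. D q * G $ q $ r + ?B $ p $ q * (if i = q \<and> j = r then 1 else 0))
    = (\<Sum>q\<in>UNIV. D q * G $ q $ r) + (if j = r then ?B $ p $ i else 0)" for r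
    by (simp add: sum.distrib if_distrib[of "(*) _"] cong: if_cong)
  ultimately have 1: "D r * t - (\<Sum>q\<in>UNIV. D q * G $ q $ r) = (if j = r then ?B $ p $ i else 0) - (if p = r then ?B $ j $ i else 0)" for r
    by (simp add: algebra_simps)
  have "(\<Sum>r\<in>UNIV. (D r * t - (\<Sum>q\<in>UNIV. D q * G $ q $ r)) * ?B $ r $ s) = ?B $ p $ i * ?B $ j $ s - ?B $ j $ i * ?B $ p $ s"
    unfolding 1 by (simp add: left_diff_distrib sum_subtractf if_distrib[of "\<lambda>x. x * _"] cong: if_cong)
  moreover have "(\<Sum>r\<in>UNIV. (D r * t - (\<Sum>q\<in>UNIV. D q * G $ q $ r)) * ?B $ r $ s) = chi t G * D s"
  proof -
    have "(\<Sum>r\<in>UNIV. (\<Sum>q\<in>UNIV. D q * G $ q $ r) * ?B $ r $ s) = (\<Sum>q\<in>UNIV. D q * (G ** ?B) $ q $ s)"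
      by (simp add: matrix_matrix_mult_def sum_distrib_left sum_distrib_right mult.assoc) (rule sum.swap)
    also have "\<dots> = (\<Sum>q\<in>UNIV. D q * (t * ?B $ q $ s)) - chi t G * D s"
      unfolding mult_adjc by (simp add: mat_mult_nth) (simp add: mat_def right_diff_distrib sum_subtractf if_distrib[of "(*) _"] cong: if_cong)
    finally show ?thesis unfolding left_diff_distrib sum_subtractf by (simp add: mult_ac)
  qed
  ultimately show ?thesis by (simp add: D_def)
qed

text \<open>Increasing \<open>t\<close> by \<open>s\<close> amounts to subtracting \<open>s\<close>
  times the identity from \<open>G\<close>, so \<open>d/dt\<close> is minus the sum of the diagonal
  partial derivatives.\<close>

lemma has_field_derivative_char:
  assumes "\<And>t s G. f (t + s) G = f t (shift s (- mat 1) G)" "f t \<in> mat_poly"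
  shows "((\<lambda>t. f t G) has_field_derivative - (\<Sum>i\<in>UNIV. pd i i (f t) G)) (at t)"
proof -
  have "(\<Sum>i\<in>UNIV. \<Sum>j\<in>UNIV. (- mat 1 :: complex^'a^'a) $ i $ j * pd i j (f t) G) = - (\<Sum>i\<in>UNIV. pd i i (f t) G)"
    by (simp add: mat_def sum_negf if_distrib[of "\<lambda>x. x * _"] cong: if_cong)
  then have "((\<lambda>s. f (t + s) G) has_field_derivative - (\<Sum>i\<in>UNIV. pd i i (f t) G)) (at 0)"
    using has_field_derivative_shift[OF assms(2), of "- mat 1" G] by (simp add: assms(1))
  then show ?thesis using DERIV_shift[of "\<lambda>t. f t G" _ 0 t] by (simp add: add.commute)
qed

lemma shift_mat: "mat (t + s) - G = mat t - shift s (- mat 1) G"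
  by (auto simp: vec_eq_iff shift_def mat_def)

lemma chi_deriv: "((\<lambda>t. chi t G) has_field_derivative trace (adjc t G)) (at t)"
proof -
  have "((\<lambda>t. chi t G) has_field_derivative - (\<Sum>i\<in>UNIV. pd i i (chi t) G)) (at t)"
    by (rule has_field_derivative_char[OF _ chi_mat_poly]) (simp add: chi_def shift_mat)
  then show ?thesis by (simp add: pd_chi sum_negf trace_def)
qed

lemma trace_adjc_deriv: "((\<lambda>t. trace (adjc t G)) has_field_derivative - (\<Sum>i\<in>UNIV. \<Sum>p\<in>UNIV. pd i i (\<lambda>G. adjc t G $ p $ p) G)) (at t)"
proof -
  have "((\<lambda>t. trace (adjc t G)) has_field_derivative - (\<Sum>i\<in>UNIV. pd i i (\<lambda>G. trace (adjc t G)) G)) (at t)"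
    unfolding trace_def
    by (rule has_field_derivative_char[of "\<lambda>t G. \<Sum>i\<in>UNIV. adjc t G $ i $ i"])
      (simp only: adjc_def shift_mat, intro mat_poly_sum adjc_mat_poly)
  then show ?thesis by (simp add: trace_def pd_sum adjc_mat_poly)
qed

text \<open>A formal polynomial is needed to speak of coefficients as functions of \<open>G\<close>
  and to cancel it in the integral domain of polynomials.\<close>

definition cpoly :: "complex^'n^'n \<Rightarrow> complex poly" where
  "cpoly G = det (\<chi> i j. if i = j then [:- G $ i $ j, 1:] else [:- G $ i $ j:])"

lemma poly_cpoly: "poly (cpoly G) t = chi t G"
  unfolding cpoly_def chi_def det_def
  by (auto simp: poly_sum poly_prod mat_def intro!: sum.cong prod.cong)

lemma coeff_prod_mat_poly:
  assumes "\<And>i p. i \<in> I \<Longrightarrow> (\<lambda>G. coeff (f i G) p) \<in> mat_poly"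
  shows "(\<lambda>G. coeff (\<Prod>i\<in>I. f i G) p) \<in> mat_poly"
  using assms
proof (induction I arbitrary: p rule: infinite_finite_induct)
  case (insert i I)
  then show ?case by (simp add: coeff_mult) (intro mat_poly_sum mat_poly.mult, auto)
qed (simp_all add: mat_poly.const)

lemma coeff_cpoly_mat_poly: "(\<lambda>G. coeff (cpoly G) p) \<in> mat_poly"
proof -
  have 1: "of_int k * q = smult (of_int k) q" for k and q :: "complex poly"
    by (simp add: of_int_poly)
  have "(\<lambda>G :: complex^'a^'a. coeff (if i = j then [:- G $ i $ j, 1:] else [:- G $ i $ j:]) p) \<in> mat_poly" for i j p
    by (cases "i = j"; cases p) (simp_all add: coeff_pCons mat_poly_intros split: nat.splits)
  then show ?thesis
    unfolding cpoly_def det_def coeff_sum 1 coeff_smult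
    by (intro mat_poly_sum mat_poly.mult mat_poly.const coeff_prod_mat_poly) simp
qed

lemma coeff_prod_degree_le_1:
  fixes q :: "'i \<Rightarrow> 'a::comm_ring_1 poly"
  assumes "\<And>i. i \<in> I \<Longrightarrow> degree (q i) \<le> 1" "finite I"
  shows "degree (\<Prod>i\<in>I. q i) \<le> card I \<and> coeff (\<Prod>i\<in>I. q i) (card I) = (\<Prod>i\<in>I. coeff (q i) 1)"
  using assms(2,1)
proof induction
  case (insert i I)
  then have IH: "degree (\<Prod>i\<in>I. q i) \<le> card I" "coeff (\<Prod>i\<in>I. q i) (card I) = (\<Prod>i\<in>I. coeff (q i) 1)" by auto
  have "degree (\<Prod>i\<in>insert i I. q i) \<le> Suc (card I)"
    using insert.hyps insert.prems[of i] IH(1) degree_mult_le[of "q i" "\<Prod>i\<in>I. q i"] by simp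
  moreover have "coeff (q i * (\<Prod>i\<in>I. q i)) (1 + card I) = coeff (q i) 1 * coeff (\<Prod>i\<in>I. q i) (card I)"
  proof -
    have "coeff (q i * (\<Prod>i\<in>I. q i)) (1 + card I) = (\<Sum>k\<le>1 + card I. if k = 1 then coeff (q i) 1 * coeff (\<Prod>i\<in>I. q i) (card I) else 0)"
      unfolding coeff_mult
    proof (intro sum.cong refl)
      fix k assume "k \<in> {..1 + card I}"
      consider "k = 0" | "k = 1" | "k > 1" by linarith
      then show "coeff (q i) k * coeff (\<Prod>i\<in>I. q i) (1 + card I - k) = (if k = 1 then coeff (q i) 1 * coeff (\<Prod>i\<in>I. q i) (card I) else 0)"
        using IH(1) insert.prems[of i] by cases (auto simp: coeff_eq_0)
    qed
    then show ?thesis by simp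
  qed
  ultimately show ?case using insert.hyps IH(2) by simp
qed simp

lemma
  fixes G :: "complex^'n::finite^'n"
  shows degree_cpoly: "degree (cpoly G) \<le> CARD('n)" and coeff_cpoly_top: "coeff (cpoly G) CARD('n) = 1"
proof -
  let ?q = "\<lambda>i j. if i = j then [:- G $ i $ j, 1:] else [:- G $ i $ j:]"
  have q: "degree (\<Prod>i\<in>UNIV. ?q i (p i)) \<le> CARD('n) \<and> coeff (\<Prod>i\<in>UNIV. ?q i (p i)) CARD('n) = (\<Prod>i\<in>UNIV. coeff (?q i (p i)) 1)" for p
    by (rule coeff_prod_degree_le_1) auto
  have 1: "of_int k * q = smult (of_int k) q" for k and q :: "complex poly"
    by (simp add: of_int_poly)
  show "degree (cpoly G) \<le> CARD('n)"
    unfolding cpoly_def det_def vec_lambda_beta 1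
    by (intro degree_sum_le) (auto intro: order_trans[OF degree_smult_le] q[THEN conjunct1])
  have "coeff (cpoly G) CARD('n) = (\<Sum>p | p permutes (UNIV :: 'n set). of_int (sign p) * (\<Prod>i\<in>UNIV. coeff (?q i (p i)) 1))"
    unfolding cpoly_def det_def vec_lambda_beta 1 coeff_sum coeff_smult by (simp only: q[THEN conjunct2])
  also have "\<dots> = det (mat 1 :: complex^'n^'n)"
    unfolding det_def by (intro sum.cong refl arg_cong2[where f="(*)"] prod.cong) (auto simp: mat_def)
  finally show "coeff (cpoly G) CARD('n) = 1" by simp
qed

lemma chi_conv_coeffs: "chi t (G :: complex^'n::finite^'n) = (\<Sum>p\<le>CARD('n). coeff (cpoly G) p * t ^ p)"
proof -
  have "chi t G = (\<Sum>p\<le>degree (cpoly G). coeff (cpoly G) p * t ^ p)"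
    by (simp add: poly_altdef flip: poly_cpoly)
  also have "\<dots> = (\<Sum>p\<le>CARD('n). coeff (cpoly G) p * t ^ p)"
    by (rule sum.mono_neutral_left) (use degree_cpoly[of G] in \<open>auto simp: coeff_eq_0\<close>)
  finally show ?thesis .
qed

lemma trace_adjc: "trace (adjc t G) = poly (pderiv (cpoly G)) t"
proof (rule DERIV_unique[OF chi_deriv])
  show "((\<lambda>t. chi t G) has_field_derivative poly (pderiv (cpoly G)) t) (at t)"
    using poly_DERIV[of "cpoly G" t] by (simp add: poly_cpoly)
qed

text \<open>In eigenvalues this is the derivative of \<open>\<chi>' / \<chi>\<close>; contracting
  \<open>pd_adjc\<close> with \<open>i = j\<close> and \<open>p = s\<close> proves it without
  diagonalising \<open>G\<close>.\<close>

lemma chi_times_pderiv2: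
  "chi t G * poly (pderiv (pderiv (cpoly G))) t = (trace (adjc t G))\<^sup>2 - trace (adjc t G ** adjc t G)"
proof -
  have "poly (pderiv (pderiv (cpoly G))) t = - (\<Sum>i\<in>UNIV. \<Sum>p\<in>UNIV. pd i i (\<lambda>G. adjc t G $ p $ p) G)"
    using poly_DERIV[of "pderiv (cpoly G)" t] by (intro DERIV_unique[OF _ trace_adjc_deriv]) (simp add: trace_adjc)
  then have "chi t G * poly (pderiv (pderiv (cpoly G))) t = - (\<Sum>i\<in>UNIV. \<Sum>p\<in>UNIV. chi t G * pd i i (\<lambda>G. adjc t G $ p $ p) G)"
    by (simp add: sum_distrib_left)
  also have "\<dots> = (\<Sum>i\<in>UNIV. \<Sum>p\<in>UNIV. adjc t G $ i $ i * adjc t G $ p $ p) - (\<Sum>i\<in>UNIV. \<Sum>p\<in>UNIV. adjc t G $ p $ i * adjc t G $ i $ p)"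
    unfolding pd_adjc sum_subtractf by simp
  also have "(\<Sum>i\<in>UNIV. \<Sum>p\<in>UNIV. adjc t G $ i $ i * adjc t G $ p $ p) = (trace (adjc t G))\<^sup>2"
    by (simp add: trace_def power2_eq_square sum_product)
  also have "(\<Sum>i\<in>UNIV. \<Sum>p\<in>UNIV. adjc t G $ p $ i * adjc t G $ i $ p) = trace (adjc t G ** adjc t G)"
    by (simp add: trace_def matrix_matrix_mult_def mult.commute)
  finally show ?thesis .
qed

text \<open>The adjoint, for the Gaussian pairing, of the derivation \<open>tr (B\<^sup>2 \<partial>)\<close>.\<close>
definition capB :: "(complex^'n^'n \<Rightarrow> complex) \<Rightarrow> complex^'n^'n \<Rightarrow> complex" where
  "capB f G = (\<Sum>a\<in>UNIV. \<Sum>b\<in>UNIV. \<Sum>c\<in>UNIV. G $ c $ a * pd c b (pd b a f) G)"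

lemma trace_mult3: "trace (A ** (B ** C)) = (\<Sum>a\<in>UNIV. \<Sum>b\<in>UNIV. \<Sum>c\<in>UNIV. A $ c $ a * (B $ a $ b * C $ b $ c))"
  for A B C :: "complex^'n::finite^'n"
proof -
  have "trace (A ** (B ** C)) = (\<Sum>c\<in>UNIV. \<Sum>a\<in>UNIV. \<Sum>b\<in>UNIV. A $ c $ a * (B $ a $ b * C $ b $ c))"
    by (simp add: trace_def matrix_matrix_mult_def sum_distrib_left)
  also have "\<dots> = (\<Sum>a\<in>UNIV. \<Sum>c\<in>UNIV. \<Sum>b\<in>UNIV. A $ c $ a * (B $ a $ b * C $ b $ c))"
    by (rule sum.swap)
  also have "\<dots> = (\<Sum>a\<in>UNIV. \<Sum>b\<in>UNIV. \<Sum>c\<in>UNIV. A $ c $ a * (B $ a $ b * C $ b $ c))"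
    by (intro sum.cong refl sum.swap)
  finally show ?thesis .
qed

lemma pd_pd_chi: "pd c b (pd b a (chi t)) G = - pd c b (\<lambda>G. adjc t G $ a $ b) G"
proof -
  have "pd b a (chi t) = (\<lambda>G. - adjc t G $ a $ b)" by (simp add: fun_eq_iff pd_chi)
  then show ?thesis by (simp add: pd_minus adjc_mat_poly)
qed

text \<open>By \<open>pd_adjc\<close> the second derivatives become products of two adjugates.
  Multiplication by \<open>G\<close> is reduced by \<open>mult_adjc\<close>, and
  \<open>chi_times_pderiv2\<close> evaluates the trace of the squared adjugate.\<close>

lemma chi_times_capB_chi:
  fixes G :: "complex^'n::finite^'n"
  shows "chi t G * capB (chi t) G =
    chi t G * ((of_nat CARD('n) - 1) * poly (pderiv (cpoly G)) t - t * poly (pderiv (pderiv (cpoly G))) t)"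
proof -
  let ?B = "adjc t G" and ?c = "chi t G" and ?N = "of_nat CARD('n) :: complex"
  have "?c * capB (chi t) G = - (\<Sum>a\<in>UNIV. \<Sum>b\<in>UNIV. \<Sum>c\<in>UNIV. G $ c $ a * (?c * pd c b (\<lambda>G. adjc t G $ a $ b) G))"
    by (simp add: capB_def pd_pd_chi sum_distrib_left sum_negf mult_ac)
  also have "\<dots> = trace (G ** (?B ** ?B)) - (\<Sum>a\<in>UNIV. \<Sum>b\<in>UNIV. \<Sum>c\<in>UNIV. G $ c $ a * (?B $ a $ c * ?B $ b $ b))"
    unfolding pd_adjc trace_mult3 right_diff_distrib sum_subtractf by (simp add: mult_ac)
  also have "(\<Sum>a\<in>UNIV. \<Sum>b\<in>UNIV. \<Sum>c\<in>UNIV. G $ c $ a * (?B $ a $ c * ?B $ b $ b)) = trace (G ** ?B) * trace ?B"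
  proof -
    have "trace (G ** ?B) * trace ?B = (\<Sum>c\<in>UNIV. \<Sum>a\<in>UNIV. G $ c $ a * ?B $ a $ c) * (\<Sum>b\<in>UNIV. ?B $ b $ b)"
      by (simp add: trace_def matrix_matrix_mult_def)
    also have "(\<Sum>c\<in>UNIV. \<Sum>a\<in>UNIV. G $ c $ a * ?B $ a $ c) = (\<Sum>a\<in>UNIV. \<Sum>c\<in>UNIV. G $ c $ a * ?B $ a $ c)"
      by (rule sum.swap)
    also have "\<dots> * (\<Sum>b\<in>UNIV. ?B $ b $ b) = (\<Sum>a\<in>UNIV. \<Sum>b\<in>UNIV. \<Sum>c\<in>UNIV. G $ c $ a * (?B $ a $ c * ?B $ b $ b))"
      unfolding sum_distrib_right
    proof (rule sum.cong[OF refl])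
      fix a
      show "(\<Sum>c\<in>UNIV. G $ c $ a * ?B $ a $ c * (\<Sum>b\<in>UNIV. ?B $ b $ b)) = (\<Sum>b\<in>UNIV. \<Sum>c\<in>UNIV. G $ c $ a * (?B $ a $ c * ?B $ b $ b))"
        unfolding sum_distrib_left by (subst sum.swap) (simp add: mult.assoc)
    qed
    finally show ?thesis by simp
  qed
  also have "trace (G ** (?B ** ?B)) = t * trace (?B ** ?B) - ?c * trace ?B"
  proof -
    have "G ** (?B ** ?B) = mat t ** (?B ** ?B) - mat ?c ** ?B"
      by (simp add: matrix_mul_assoc mult_adjc matrix_sub_rdistrib)
    then show ?thesis by (simp add: trace_sub trace_mat_mult)
  qed
  also have "trace (?B ** ?B) = (trace ?B)\<^sup>2 - ?c * poly (pderiv (pderiv (cpoly G))) t"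
    by (simp add: chi_times_pderiv2)
  finally show ?thesis unfolding trace_mult_adjc trace_adjc
    by (simp add: power2_eq_square algebra_simps)
qed

lemma capB_add: "f \<in> mat_poly \<Longrightarrow> g \<in> mat_poly \<Longrightarrow> capB (\<lambda>A. f A + g A) G = capB f G + capB g G"
proof -
  assume fg: "f \<in> mat_poly" "g \<in> mat_poly"
  then have "pd b a (\<lambda>A. f A + g A) = (\<lambda>A. pd b a f A + pd b a g A)" for a b by (simp add: fun_eq_iff pd_add)
  then show ?thesis using fg by (simp add: capB_def pd_add pd_mat_poly ring_distribs sum.distrib)
qed

lemma capB_cmult: "f \<in> mat_poly \<Longrightarrow> capB (\<lambda>A. c * f A) G = c * capB f G"
proof -
  assume f: "f \<in> mat_poly"
  then have "pd b a (\<lambda>A. c * f A) = (\<lambda>A. c * pd b a f A)" for a b by (simp add: fun_eq_iff pd_cmult)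
  then show ?thesis using f by (simp add: capB_def pd_cmult pd_mat_poly sum_distrib_left mult_ac)
qed

lemma capB_sum: "(\<And>i. i \<in> I \<Longrightarrow> f i \<in> mat_poly) \<Longrightarrow> capB (\<lambda>A. \<Sum>i\<in>I. f i A) G = (\<Sum>i\<in>I. capB (f i) G)"
  using capB_cmult[of "\<lambda>_. 0" 0 G]
  by (induction I rule: infinite_finite_induct) (simp_all add: capB_add mat_poly_sum mat_poly.const)

lemma capB_chi:
  fixes G :: "complex^'n::finite^'n"
  shows "capB (chi t) G = (of_nat CARD('n) - 1) * poly (pderiv (cpoly G)) t - t * poly (pderiv (pderiv (cpoly G))) t"
proof -
  txt \<open>Cancelling \<open>chi t G\<close>, which may vanish, requires a comparison of polynomials in \<open>t\<close>.\<close>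
  define q where "q = (\<Sum>p\<le>CARD('n). monom (capB (\<lambda>G :: complex^'n^'n. coeff (cpoly G) p) G) p)"
  have q: "poly q t = capB (chi t) G" for t
  proof -
    have "chi t = (\<lambda>G :: complex^'n^'n. \<Sum>p\<le>CARD('n). t ^ p * coeff (cpoly G) p)"
      by (simp add: fun_eq_iff chi_conv_coeffs mult.commute)
    then show ?thesis
      by (simp add: q_def poly_sum poly_monom capB_sum capB_cmult coeff_cpoly_mat_poly mat_poly_intros mult.commute)
  qed
  define q' where "q' = smult (of_nat CARD('n) - 1) (pderiv (cpoly G)) - pCons 0 (pderiv (pderiv (cpoly G)))"
  have q': "poly q' t = (of_nat CARD('n) - 1) * poly (pderiv (cpoly G)) t - t * poly (pderiv (pderiv (cpoly G))) t" for t
    by (simp add: q'_def)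
  have "poly (cpoly G * q) t = poly (cpoly G * q') t" for t
    by (simp only: poly_mult poly_cpoly q q' chi_times_capB_chi)
  then have "cpoly G * q = cpoly G * q'" by (metis ext poly_eq_poly_eq_iff)
  moreover have "cpoly G \<noteq> 0" using coeff_cpoly_top[of G] by auto
  ultimately have "q = q'" by simp
  then show ?thesis using q q' by metis
qed

text \<open>By \<open>pd_chi\<close> the triple sum is the trace of
  \<open>G ** adjc x G ** adjc y G\<close>, which the resolvent identity separates for
  \<open>x \<noteq> y\<close>.\<close>

lemma capB_cross:
  fixes G :: "complex^'n::finite^'n"
  assumes "x \<noteq> y"
  shows "(\<Sum>a\<in>UNIV. \<Sum>b\<in>UNIV. \<Sum>c\<in>UNIV. G $ c $ a * (pd b a (chi x) G * pd c b (chi y) G))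
    = (chi x G * (y * poly (pderiv (cpoly G)) y) - chi y G * (x * poly (pderiv (cpoly G)) x)) / (x - y)"
proof -
  have "(x - y) * trace (G ** (adjc x G ** adjc y G)) = trace (G ** (mat (x - y) ** (adjc x G ** adjc y G)))"
    by (metis mat_commute matrix_mul_assoc trace_mat_mult)
  also have "\<dots> = chi x G * trace (G ** adjc y G) - chi y G * trace (G ** adjc x G)"
  proof -
    have "G ** (mat c ** A) = mat c ** (G ** A)" for c and A :: "complex^'n^'n"
      by (metis mat_commute matrix_mul_assoc)
    then show ?thesis unfolding adjc_mult_adjc matrix_sub_ldistrib trace_sub by (simp add: trace_mat_mult)
  qed
  also have "\<dots> = chi x G * (y * poly (pderiv (cpoly G)) y) - chi y G * (x * poly (pderiv (cpoly G)) x)"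
    unfolding trace_mult_adjc trace_adjc by (simp add: algebra_simps)
  finally have "trace (G ** (adjc x G ** adjc y G)) = (chi x G * (y * poly (pderiv (cpoly G)) y) - chi y G * (x * poly (pderiv (cpoly G)) x)) / (x - y)"
    using assms by (simp add: field_simps)
  then show ?thesis by (simp add: pd_chi trace_mult3)
qed

section \<open>Coefficients of products of characteristic polynomials\<close>

text \<open>The rank counted from 0, which turns column indices into the exponents of a Vandermonde
  matrix.\<close>

definition pos :: "'k::{finite,linorder} \<Rightarrow> nat" where
  "pos j = card {l. l < j}"

lemma pos_less_iff [simp]: "pos i < pos j \<longleftrightarrow> i < j"
proof -
  have 1: "pos i < pos j" if "i < j" for i j :: 'a
    unfolding pos_def using that by (intro psubset_card_mono) auto
  then show ?thesis by (metis less_asym linorder_neqE not_less_iff_gr_or_eq)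
qed

lemma inj_pos: "inj pos"
  by (rule injI) (metis linorder_neqE order_less_irrefl pos_less_iff)

lemma pos_less_CARD: "pos (j :: 'k::{finite,linorder}) < CARD('k)"
  unfolding pos_def by (rule psubset_card_mono) auto

lemma range_pos: "range (pos :: 'k::{finite,linorder} \<Rightarrow> nat) = {..<CARD('k)}"
  by (rule card_subset_eq) (auto simp: pos_less_CARD card_image inj_pos)

text \<open>A permutation that never lowers the rank must preserve every rank, since the ranks have
  the same sum before and after; only the identity contributes.\<close>

lemma det_upper_triangular:
  fixes A :: "'a::comm_ring_1^'k::{finite,linorder}^'k::{finite,linorder}"
  assumes "\<And>i j. j < i \<Longrightarrow> A $ i $ j = 0"
  shows "det A = (\<Prod>i\<in>UNIV. A $ i $ i)"
proof -
  have "det A = (\<Sum>p\<in>{id}. of_int (sign p) * (\<Prod>i\<in>UNIV. A $ i $ p i))"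
    unfolding det_def
  proof (rule sum.mono_neutral_right)
    show "\<forall>p\<in>{p. p permutes UNIV} - {id}. of_int (sign p) * (\<Prod>i\<in>UNIV. A $ i $ p i) = 0"
    proof
      fix p assume p: "p \<in> {p. p permutes (UNIV :: 'k set)} - {id}"
      have "\<exists>i. p i < i"
      proof (rule ccontr)
        assume "\<nexists>i. p i < i"
        then have le: "pos i \<le> pos (p i)" for i using pos_less_iff[of "p i" i] by (auto simp: not_less[symmetric] simp del: pos_less_iff)
        have "(\<Sum>i\<in>(UNIV :: 'k set). pos i) = (\<Sum>i\<in>UNIV. pos (p i))"
          using sum.permute[of p UNIV pos] p by (simp add: o_def)
        then have "pos i = pos (p i)" for i
          by (rule sum_mono_inv) (auto simp: le)
        then have "p i = i" for i using injD[OF inj_pos] by metis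
        then have "p = id" by (simp add: fun_eq_iff)
        then show False using p by simp
      qed
      then obtain i where "A $ i $ p i = 0" using assms by blast
      then have "(\<Prod>i\<in>UNIV. A $ i $ p i) = 0" by (intro prod_zero) auto
      then show "of_int (sign p) * (\<Prod>i\<in>UNIV. A $ i $ p i) = 0" by simp
    qed
  qed (auto simp: permutes_id)
  then show ?thesis by simp
qed

lemma det_lower_triangular:
  fixes A :: "'a::comm_ring_1^'k::{finite,linorder}^'k::{finite,linorder}"
  assumes "\<And>i j. i < j \<Longrightarrow> A $ i $ j = 0"
  shows "det A = (\<Prod>i\<in>UNIV. A $ i $ i)"
  using det_upper_triangular[of "transpose A"] assms by (simp add: transpose_def[of A] flip: det_transpose[of A])

lemma prod_pairs_less:
  "(\<Prod>(i, j) \<in> {(i, j). i < j}. f i j) = (\<Prod>j\<in>UNIV. \<Prod>i\<in>{i. i < j}. f i (j :: 'k::{finite,linorder}))"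
proof -
  have "(\<Prod>j\<in>UNIV. \<Prod>i\<in>{i. i < j}. f i j) = (\<Prod>(j, i)\<in>(SIGMA j:UNIV. {i. i < j}). f i j)"
    by (rule prod.Sigma) auto
  also have "\<dots> = (\<Prod>(i, j) \<in> {(i, j). i < j}. f i j)"
    by (rule prod.reindex_bij_witness[of _ "\<lambda>(i, j). (j, i)" "\<lambda>(i, j). (j, i)"]) auto
  finally show ?thesis ..
qed

text \<open>The columns \<open>z^pos j\<close> are replaced by the monic polynomials with roots \<open>z_l\<close>, \<open>l < j\<close>;
  the change of columns is unitriangular and the new matrix is lower triangular.\<close>
lemma det_vandermonde:
  fixes z :: "complex^'k::{finite,linorder}"
  shows "det (\<chi> i j. (z $ i) ^ pos j) = vandermonde z"
proof -
  define q where "q j = (\<Prod>l\<in>{l. l < j}. [:- z $ l, 1:])" for j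
  have q: "degree (q j) \<le> pos j" "coeff (q j) (pos j) = 1" for j
    using coeff_prod_degree_le_1[of "{l. l < j}" "\<lambda>l. [:- z $ l, 1:]"] by (auto simp: q_def pos_def)
  define U where "U = (\<chi> (i :: 'k) j. coeff (q j) (pos i))"
  have "det U = (\<Prod>i\<in>UNIV. U $ i $ i)"
    by (rule det_upper_triangular) (auto simp: U_def intro!: coeff_eq_0 le_less_trans[OF q(1)])
  then have U: "det U = 1" by (simp add: U_def q)
  have "(\<chi> i j. (z $ i) ^ pos j) ** U = (\<chi> i j. poly (q j) (z $ i))"
  proof (simp only: vec_eq_iff, intro allI)
    fix i j
    have "poly (q j) (z $ i) = (\<Sum>p\<le>degree (q j). coeff (q j) p * (z $ i) ^ p)" by (rule poly_altdef)
    also have "\<dots> = (\<Sum>p\<in>range (pos :: 'k \<Rightarrow> nat). coeff (q j) p * (z $ i) ^ p)"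
      by (rule sum.mono_neutral_left) (auto simp: range_pos coeff_eq_0 intro: le_less_trans[OF order_trans[OF _ q(1)] pos_less_CARD])
    also have "\<dots> = (\<Sum>a\<in>UNIV. coeff (q j) (pos a) * (z $ i) ^ pos (a :: 'k))"
      by (rule sum.reindex[OF inj_pos, unfolded o_def])
    finally show "((\<chi> i j. (z $ i) ^ pos j) ** U) $ i $ j = (\<chi> i j. poly (q j) (z $ i)) $ i $ j"
      by (simp add: matrix_matrix_mult_def U_def mult.commute)
  qed
  then have "det (\<chi> i j. (z $ i) ^ pos j) = det (\<chi> i j. poly (q j) (z $ i))"
    using U by (metis det_mul mult.right_neutral)
  also have "\<dots> = (\<Prod>i\<in>UNIV. (\<chi> i j. poly (q j) (z $ i)) $ i $ i)"
    by (rule det_lower_triangular) (auto simp: q_def poly_prod intro!: prod_zero)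
  also have "\<dots> = vandermonde z"
    by (simp add: vandermonde_def prod_pairs_less q_def poly_prod)
  finally show ?thesis .
qed

text \<open>The coefficient of \<open>\<Prod>i. z_i^\<alpha>_i\<close> in \<open>\<Delta>(z) \<Prod>i. det (z_i - G)\<close>.\<close>
definition coefS :: "('k::{finite,linorder} \<Rightarrow> nat) \<Rightarrow> complex^'n^'n \<Rightarrow> complex" where
  "coefS \<alpha> G = det (\<chi> i j :: 'k. if pos j \<le> \<alpha> i then coeff (cpoly G) (\<alpha> i - pos j) else 0)"

definition mpow :: "complex^'k::finite \<Rightarrow> ('k \<Rightarrow> nat) \<Rightarrow> complex" where
  "mpow z \<alpha> = (\<Prod>i\<in>UNIV. (z $ i) ^ \<alpha> i)"

definition charprod :: "complex^'k::finite \<Rightarrow> complex^'n^'n \<Rightarrow> complex" where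
  "charprod z G = (\<Prod>i\<in>UNIV. chi (z $ i) G)"

lemma finite_box [simp]: "finite (box m :: ('k::finite \<Rightarrow> nat) set)"
  by (rule finite_PiE) auto

lemma coefS_mat_poly:
  fixes \<alpha> :: "'k::{finite,linorder} \<Rightarrow> nat"
  shows "coefS \<alpha> \<in> (mat_poly :: (complex^'n::finite^'n \<Rightarrow> complex) set)"
  unfolding coefS_def
proof (rule mat_poly_det)
  fix i j :: 'k
  show "(\<lambda>G :: complex^'n^'n. (\<chi> i j. if pos j \<le> \<alpha> i then coeff (cpoly G) (\<alpha> i - pos j) else 0) $ i $ j) \<in> mat_poly"
    by (cases "pos j \<le> \<alpha> i") (simp_all add: coeff_cpoly_mat_poly mat_poly.const)
qed

lemma coefS_antisym:
  assumes "\<sigma> permutes UNIV"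
  shows "coefS (\<alpha> \<circ> \<sigma>) G = of_int (sign \<sigma>) * coefS \<alpha> G"
  unfolding coefS_def by (subst det_permute_rows[OF assms, symmetric]) (simp add: o_def cong: if_cong)

text \<open>Multiplying row \<open>i\<close> of the Vandermonde matrix by
  \<open>chi (z $ i) G\<close> gives the entries \<open>(z $ i) ^ pos j * chi (z $ i) G\<close>, of
  degree at most \<open>CARD('n) + CARD('k) - 1\<close>; \<open>det_sum_rows\<close> extracts their
  monomials.\<close>

lemma sum_coefS:
  fixes z :: "complex^'k::{finite,linorder}" and G :: "complex^'n::finite^'n"
  assumes m: "m = CARD('n) + CARD('k) - 1"
  shows "(\<Sum>\<alpha>\<in>box m. coefS \<alpha> G * mpow z \<alpha>) = vandermonde z * charprod z G"
proof -
  have "(\<Sum>\<alpha>\<in>box m. coefS \<alpha> G * mpow z \<alpha>)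
    = det (\<chi> i j :: 'k. \<Sum>l\<le>m. (z $ i) ^ l * (if pos j \<le> l then coeff (cpoly G) (l - pos j) else 0))"
    by (simp add: det_sum_rows coefS_def mpow_def mult.commute)
  also have "(\<lambda>i j :: 'k. \<Sum>l\<le>m. (z $ i) ^ l * (if pos j \<le> l then coeff (cpoly G) (l - pos j) else 0))
    = (\<lambda>i j. chi (z $ i) G * (z $ i) ^ pos j)"
  proof (intro ext)
    fix i j :: 'k
    have pm: "pos j + CARD('n) \<le> m" using pos_less_CARD[of j] m by linarith
    have "(\<Sum>l\<le>m. (z $ i) ^ l * (if pos j \<le> l then coeff (cpoly G) (l - pos j) else 0))
      = (\<Sum>l\<in>{pos j..pos j + CARD('n)}. (z $ i) ^ l * coeff (cpoly G) (l - pos j))"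
      by (rule sum.mono_neutral_cong_right) (use pm degree_cpoly[of G] in \<open>auto intro!: coeff_eq_0\<close>)
    also have "\<dots> = (\<Sum>p\<le>CARD('n). (z $ i) ^ (p + pos j) * coeff (cpoly G) p)"
      by (rule sum.reindex_bij_witness[of _ "\<lambda>p. p + pos j" "\<lambda>l. l - pos j"]) auto
    also have "\<dots> = chi (z $ i) G * (z $ i) ^ pos j"
      by (simp add: chi_conv_coeffs sum_distrib_left power_add mult_ac)
    finally show "(\<Sum>l\<le>m. (z $ i) ^ l * (if pos j \<le> l then coeff (cpoly G) (l - pos j) else 0)) = chi (z $ i) G * (z $ i) ^ pos j" .
  qed
  also have "det (\<chi> i j. chi (z $ i) G * (z $ i) ^ pos j) = det (\<chi> i. chi (z $ i) G *s (\<chi> j. (z $ i) ^ pos j))"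
    by (intro arg_cong[where f=det]) (simp add: vec_eq_iff)
  also have "\<dots> = charprod z G * vandermonde z"
    by (simp add: det_rows_mul charprod_def det_vandermonde)
  finally show ?thesis by simp
qed

text \<open>After a row permutation the exponents are \<open>CARD('n) + pos i\<close>. Below the
  diagonal the coefficient index then exceeds the degree, and on it stand leading coefficients 1.
  The sign is left unspecified because the pairing of \<open>coefS \<alpha>\<close> with itself
  squares it.\<close>

lemma coefS_top:
  fixes \<alpha> :: "'k::{finite,linorder} \<Rightarrow> nat" and G :: "complex^'n::finite^'n"
  assumes inj: "inj \<alpha>" and range: "range \<alpha> = {CARD('n)..<CARD('n) + CARD('k)}"
  shows "\<exists>s. s * s = 1 \<and> (\<forall>G :: complex^'n^'n. coefS \<alpha> G = s)"
proof -
  define \<tau> where "\<tau> i = CARD('n) + pos i" for i :: 'k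
  have "range \<tau> = (+) CARD('n) ` range (pos :: 'k \<Rightarrow> nat)" by (auto simp: \<tau>_def)
  also have "\<dots> = {CARD('n)..<CARD('n) + CARD('k)}"
    unfolding range_pos by (auto simp: image_iff Bex_def) (metis add_diff_inverse_nat add_less_cancel_left not_less)
  finally have rt: "range \<tau> = range \<alpha>" using range by simp
  have it: "inj \<tau>" using inj_pos by (auto simp: \<tau>_def inj_def)
  define \<sigma> where "\<sigma> = inv \<tau> \<circ> \<alpha>"
  have as: "\<alpha> = \<tau> \<circ> \<sigma>" using rt by (auto simp: \<sigma>_def fun_eq_iff f_inv_into_f)
  then have "inj \<sigma>" using inj by (metis inj_on_imageI2)
  then have "\<sigma> permutes UNIV" by (intro bij_imp_permutes) (auto simp: bij_betw_def finite_UNIV_inj_surj)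
  then have "coefS \<alpha> G = of_int (sign \<sigma>) * coefS \<tau> G" for G :: "complex^'n^'n"
    unfolding as by (rule coefS_antisym)
  moreover have "coefS \<tau> G = 1" for G :: "complex^'n^'n"
  proof -
    have "coefS \<tau> G = (\<Prod>i\<in>(UNIV :: 'k set). (\<chi> i j. if pos j \<le> \<tau> i then coeff (cpoly G) (\<tau> i - pos j) else 0) $ i $ i)"
      unfolding coefS_def
    proof (rule det_upper_triangular[of "\<chi> i j. if pos j \<le> \<tau> i then coeff (cpoly G) (\<tau> i - pos j) else 0", THEN trans])
      fix i j :: 'k assume ji: "j < i"
      then have "CARD('n) < \<tau> i - pos j" using pos_less_iff[of j i] by (simp add: \<tau>_def del: pos_less_iff)
      then show "(\<chi> i j. if pos j \<le> \<tau> i then coeff (cpoly G) (\<tau> i - pos j) else 0) $ i $ j = 0"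
        by (simp add: coeff_eq_0 le_less_trans[OF degree_cpoly])
    qed auto
    then show ?thesis by (simp add: \<tau>_def coeff_cpoly_top)
  qed
  ultimately show ?thesis by (intro exI[of _ "of_int (sign \<sigma>)"]) (simp flip: of_int_mult add: sign_idempotent)
qed

section \<open>Differential operators on products of characteristic polynomials\<close>

definition charprod_except :: "complex^'k::finite \<Rightarrow> 'k \<Rightarrow> complex^'n^'n \<Rightarrow> complex" where
  "charprod_except z i G = (\<Prod>j\<in>UNIV - {i}. chi (z $ j) G)"

lemma charprod_mat_poly: "charprod z \<in> mat_poly"
  unfolding charprod_def by (intro mat_poly_prod chi_mat_poly)

lemma charprod_except_mat_poly: "charprod_except z i \<in> mat_poly"
  unfolding charprod_except_def by (intro mat_poly_prod chi_mat_poly)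

lemma charprod_split: "charprod z G = chi (z $ i) G * charprod_except z i G"
  unfolding charprod_def charprod_except_def by (simp add: prod.remove[of UNIV i])

lemma pd_charprod: "pd a b (charprod z) G = - (\<Sum>i\<in>UNIV. adjc (z $ i) G $ b $ a * charprod_except z i G)"
  unfolding charprod_def charprod_except_def by (simp add: pd_prod chi_mat_poly pd_chi sum_negf)

lemma triple_sum_swap:
  "(\<Sum>a\<in>A. \<Sum>b\<in>B. \<Sum>c\<in>C. \<Sum>i\<in>I. f i a b c) = (\<Sum>i\<in>I. \<Sum>a\<in>A. \<Sum>b\<in>B. \<Sum>c\<in>C. f i a b c)"
proof -
  have "(\<Sum>a\<in>A. \<Sum>b\<in>B. \<Sum>c\<in>C. \<Sum>i\<in>I. f i a b c) = (\<Sum>a\<in>A. \<Sum>b\<in>B. \<Sum>i\<in>I. \<Sum>c\<in>C. f i a b c)"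
    by (intro sum.cong refl sum.swap)
  also have "\<dots> = (\<Sum>a\<in>A. \<Sum>i\<in>I. \<Sum>b\<in>B. \<Sum>c\<in>C. f i a b c)"
    by (intro sum.cong refl sum.swap)
  also have "\<dots> = (\<Sum>i\<in>I. \<Sum>a\<in>A. \<Sum>b\<in>B. \<Sum>c\<in>C. f i a b c)"
    by (rule sum.swap)
  finally show ?thesis .
qed

text \<open>The derivation along the vector field \<open>G \<mapsto> G ** G\<close>; on eigenvalues
  it acts as the infinitesimal Moebius field
  \<open>\<lambda>^2 \<partial>_\<lambda>\<close>.\<close>

definition sqEuler :: "(complex^'n^'n \<Rightarrow> complex) \<Rightarrow> complex^'n^'n \<Rightarrow> complex" where
  "sqEuler f G = (\<Sum>a\<in>UNIV. \<Sum>b\<in>UNIV. \<Sum>c\<in>UNIV. G $ a $ b * (G $ b $ c * pd a c f G))"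

text \<open>Differentiating the factor \<open>i\<close> gives the trace of
  \<open>adjc (z $ i) G ** (G ** G)\<close>, and reducing by \<open>adjc_mult\<close> leaves a term
  \<open>trace G * charprod z G\<close> each time. Subtracting \<open>CARD('k)\<close> such terms
  leaves only expressions in \<open>z\<close> and the characteristic polynomial.\<close>

lemma sqEuler_charprod:
  fixes z :: "complex^'k::finite" and G :: "complex^'n::finite^'n"
  shows "sqEuler (charprod z) G - of_nat CARD('k) * trace G * charprod z G
    = (\<Sum>i\<in>UNIV. (of_nat CARD('n) * z $ i * chi (z $ i) G - (z $ i)\<^sup>2 * poly (pderiv (cpoly G)) (z $ i)) * charprod_except z i G)"
proof -
  have tr: "trace (adjc t G ** (G ** G)) = t\<^sup>2 * poly (pderiv (cpoly G)) t - of_nat CARD('n) * t * chi t G - chi t G * trace G" for t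
  proof -
    have "adjc t G ** (G ** G) = mat t ** (adjc t G ** G) - mat (chi t G) ** G"
      by (simp add: matrix_mul_assoc) (simp add: adjc_mult mat_commute matrix_sub_rdistrib matrix_sub_ldistrib matrix_mul_assoc)
    then have "trace (adjc t G ** (G ** G)) = t * trace (G ** adjc t G) - chi t G * trace G"
      by (simp only: trace_sub trace_mat_mult trace_mul_sym[of "adjc t G"])
    then show ?thesis by (simp add: trace_mult_adjc trace_adjc power2_eq_square algebra_simps)
  qed
  have "sqEuler (charprod z) G = (\<Sum>a\<in>UNIV. \<Sum>b\<in>UNIV. \<Sum>c\<in>UNIV. \<Sum>i\<in>UNIV. - charprod_except z i G * (adjc (z $ i) G $ c $ a * (G $ a $ b * G $ b $ c)))"
    by (simp add: sqEuler_def pd_charprod sum_distrib_left sum_negf mult_ac)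
  also have "\<dots> = (\<Sum>i\<in>UNIV. - charprod_except z i G * trace (adjc (z $ i) G ** (G ** G)))"
    by (subst triple_sum_swap) (simp add: trace_mult3 sum_distrib_left)
  also have "\<dots> = (\<Sum>i\<in>UNIV. (of_nat CARD('n) * z $ i * chi (z $ i) G - (z $ i)\<^sup>2 * poly (pderiv (cpoly G)) (z $ i)) * charprod_except z i G + trace G * charprod z G)"
  proof (rule sum.cong[OF refl])
    fix i
    show "- charprod_except z i G * trace (adjc (z $ i) G ** (G ** G)) = (of_nat CARD('n) * z $ i * chi (z $ i) G - (z $ i)\<^sup>2 * poly (pderiv (cpoly G)) (z $ i)) * charprod_except z i G + trace G * charprod z G"
      unfolding tr charprod_split[of z G i] by (simp add: algebra_simps)
  qed
  finally show ?thesis by (simp add: sum.distrib)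
qed

lemma pd_trace_charprod:
  "(\<Sum>a\<in>UNIV. pd a a (charprod z) G) = - (\<Sum>i\<in>UNIV. poly (pderiv (cpoly G)) (z $ i) * charprod_except z i G)"
  unfolding pd_charprod trace_adjc[symmetric] trace_def sum_distrib_right sum_negf by (subst sum.swap) simp

lemma inverse_diff_antisym: "1 / (x - y :: 'a::field) = - (1 / (y - x))"
  by (metis minus_diff_eq minus_divide_right)

text \<open>Both derivatives fall on one factor, giving \<open>capB_chi\<close>, or on two, giving
  \<open>capB_cross\<close>. In the double sum over pairs, exchanging the indices in one half
  identifies it with the other, whence the factor 2. In the inner sums the term \<open>j = i\<close>
  is \<open>1 / 0 = 0\<close>.\<close>

lemma capB_charprod:
  fixes z :: "complex^'k::finite" and G :: "complex^'n::finite^'n"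
  assumes inj: "inj (($) z)"
  shows "capB (charprod z) G = (\<Sum>i\<in>UNIV. ((of_nat CARD('n) - 1) * poly (pderiv (cpoly G)) (z $ i)
      - z $ i * poly (pderiv (pderiv (cpoly G))) (z $ i)
      - 2 * z $ i * poly (pderiv (cpoly G)) (z $ i) * (\<Sum>j\<in>UNIV. 1 / (z $ i - z $ j))) * charprod_except z i G)"
proof -
  let ?c = "\<lambda>i. chi (z $ i)" and ?d = "\<lambda>i. poly (pderiv (cpoly G)) (z $ i)"
  define u where "u i = z $ i * ?d i * charprod_except z i G" for i
  define cr where "cr i j = (\<Sum>a\<in>UNIV. \<Sum>b\<in>UNIV. \<Sum>c\<in>UNIV. G $ c $ a * (pd b a (?c i) G * pd c b (?c j) G))" for i j
  define R where "R i j = (\<Prod>l\<in>UNIV - {i} - {j}. ?c l G)" for i j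
  have pp: "pd c b (pd b a (charprod z)) G = (\<Sum>i\<in>UNIV. pd c b (pd b a (?c i)) G * charprod_except z i G
      + (\<Sum>j\<in>UNIV - {i}. pd b a (?c i) G * pd c b (?c j) G * R i j))" for a b c
  proof -
    have "pd b a (charprod z) = (\<lambda>G. \<Sum>i\<in>UNIV. pd b a (?c i) G * charprod_except z i G)"
      unfolding charprod_def[abs_def] charprod_except_def by (simp add: fun_eq_iff pd_prod chi_mat_poly)
    moreover have "pd c b (charprod_except z i) G = (\<Sum>j\<in>UNIV - {i}. pd c b (?c j) G * R i j)" for i
      unfolding charprod_except_def R_def by (simp add: pd_prod chi_mat_poly)
    ultimately show ?thesis
      by (simp add: pd_sum pd_mult mat_poly.mult pd_mat_poly chi_mat_poly charprod_except_mat_poly sum_distrib_left mult.assoc)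
  qed
  have "capB (charprod z) G = (\<Sum>a\<in>UNIV. \<Sum>b\<in>UNIV. \<Sum>c\<in>UNIV. \<Sum>i\<in>UNIV. G $ c $ a * pd c b (pd b a (?c i)) G * charprod_except z i G)
     + (\<Sum>a\<in>UNIV. \<Sum>b\<in>UNIV. \<Sum>c\<in>UNIV. \<Sum>i\<in>UNIV. \<Sum>j\<in>UNIV - {i}. G $ c $ a * (pd b a (?c i) G * pd c b (?c j) G) * R i j)"
    unfolding capB_def pp by (simp add: sum.distrib sum_distrib_left ring_distribs mult.assoc)
  also have "(\<Sum>a\<in>UNIV. \<Sum>b\<in>UNIV. \<Sum>c\<in>UNIV. \<Sum>i\<in>UNIV. G $ c $ a * pd c b (pd b a (?c i)) G * charprod_except z i G)
    = (\<Sum>i\<in>UNIV. capB (?c i) G * charprod_except z i G)"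
    by (subst triple_sum_swap) (simp add: capB_def sum_distrib_right)
  also have "(\<Sum>a\<in>UNIV. \<Sum>b\<in>UNIV. \<Sum>c\<in>UNIV. \<Sum>i\<in>UNIV. \<Sum>j\<in>UNIV - {i}. G $ c $ a * (pd b a (?c i) G * pd c b (?c j) G) * R i j)
    = (\<Sum>i\<in>UNIV. \<Sum>j\<in>UNIV - {i}. cr i j * R i j)"
    by (subst triple_sum_swap, rule sum.cong[OF refl], subst triple_sum_swap) (simp add: cr_def sum_distrib_right)
  also have "\<dots> = (\<Sum>i\<in>UNIV. \<Sum>j\<in>UNIV. u j * (1 / (z $ i - z $ j)) - u i * (1 / (z $ i - z $ j)))"
  proof (rule sum.cong[OF refl])
    fix i
    have "(\<Sum>j\<in>UNIV - {i}. cr i j * R i j) = (\<Sum>j\<in>UNIV - {i}. u j * (1 / (z $ i - z $ j)) - u i * (1 / (z $ i - z $ j)))"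
    proof (rule sum.cong[OF refl])
      fix j assume j: "j \<in> UNIV - {i}"
      then have ne: "z $ i \<noteq> z $ j" using inj by (auto simp: inj_def)
      have "UNIV - {j} - {i} = UNIV - {i} - {j}" by auto
      then have r: "charprod_except z i G = ?c j G * R i j" "charprod_except z j G = ?c i G * R i j"
        unfolding charprod_except_def R_def using j prod.remove[of "UNIV - {i}" j "\<lambda>l. ?c l G"] prod.remove[of "UNIV - {j}" i "\<lambda>l. ?c l G"]
        by auto
      have "cr i j * R i j = (?c i G * (z $ j * ?d j) - ?c j G * (z $ i * ?d i)) * (1 / (z $ i - z $ j)) * R i j"
        unfolding cr_def capB_cross[OF ne] by simp
      also have "\<dots> = u j * (1 / (z $ i - z $ j)) - u i * (1 / (z $ i - z $ j))"
        unfolding u_def r by (simp add: algebra_simps)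
      finally show "cr i j * R i j = u j * (1 / (z $ i - z $ j)) - u i * (1 / (z $ i - z $ j))" .
    qed
    also have "\<dots> = (\<Sum>j\<in>UNIV. u j * (1 / (z $ i - z $ j)) - u i * (1 / (z $ i - z $ j)))"
      by (rule sum.mono_neutral_left) auto
    finally show "(\<Sum>j\<in>UNIV - {i}. cr i j * R i j) = (\<Sum>j\<in>UNIV. u j * (1 / (z $ i - z $ j)) - u i * (1 / (z $ i - z $ j)))" .
  qed
  also have "\<dots> = (\<Sum>i\<in>UNIV. \<Sum>j\<in>UNIV. u j * (1 / (z $ i - z $ j))) - (\<Sum>i\<in>UNIV. \<Sum>j\<in>UNIV. u i * (1 / (z $ i - z $ j)))"
    by (simp add: sum_subtractf)
  also have "(\<Sum>i\<in>UNIV. \<Sum>j\<in>UNIV. u j * (1 / (z $ i - z $ j))) = (\<Sum>j\<in>UNIV. \<Sum>i\<in>UNIV. u j * (1 / (z $ i - z $ j)))"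
    by (rule sum.swap)
  also have "\<dots> = - (\<Sum>i\<in>UNIV. \<Sum>j\<in>UNIV. u i * (1 / (z $ i - z $ j)))"
    unfolding sum_negf[symmetric]
    by (intro sum.cong refl, subst inverse_diff_antisym) simp
  finally have fin: "capB (charprod z) G = (\<Sum>i\<in>UNIV. capB (?c i) G * charprod_except z i G)
    + (- (\<Sum>i\<in>UNIV. \<Sum>j\<in>UNIV. u i * (1 / (z $ i - z $ j))) - (\<Sum>i\<in>UNIV. \<Sum>j\<in>UNIV. u i * (1 / (z $ i - z $ j))))" .
  define v where "v i = u i * (\<Sum>j\<in>UNIV. 1 / (z $ i - z $ j))" for i
  have "capB (charprod z) G = (\<Sum>i\<in>UNIV. capB (?c i) G * charprod_except z i G - (v i + v i))"
    unfolding fin sum_subtractf sum.distrib by (simp only: v_def sum_distrib_left) simp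
  also have "\<dots> = (\<Sum>i\<in>UNIV. ((of_nat CARD('n) - 1) * ?d i - z $ i * poly (pderiv (pderiv (cpoly G))) (z $ i)
      - 2 * z $ i * ?d i * (\<Sum>j\<in>UNIV. 1 / (z $ i - z $ j))) * charprod_except z i G)"
    unfolding capB_chi v_def u_def by (intro sum.cong refl) (simp only: algebra_simps mult_2)
  finally show ?thesis .
qed

text \<open>Each sum is symmetrised: the first is antisymmetric, the second uses
  \<open>(z_i^2 - z_j^2) / (z_i - z_j) = z_i + z_j\<close>, and the third vanishes in the cyclic sum
  over triples. These are the total contributions of derivatives of \<open>\<Delta>\<close>, with
  diagonal terms equal to \<open>1 / 0 = 0\<close>.\<close>

lemma partial_fraction_sums:
  fixes z :: "complex^'k::finite"
  assumes inj: "inj (($) z)"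
  shows "(\<Sum>i\<in>UNIV. \<Sum>j\<in>UNIV. 1 / (z $ i - z $ j)) = 0"
    and "(\<Sum>i\<in>UNIV. (z $ i)\<^sup>2 * (\<Sum>j\<in>UNIV. 1 / (z $ i - z $ j))) = (of_nat CARD('k) - 1) * (\<Sum>i\<in>UNIV. z $ i)"
    and "(\<Sum>i\<in>UNIV. z $ i * (\<Sum>j\<in>UNIV - {i}. \<Sum>l\<in>UNIV - {i} - {j}. 1 / ((z $ i - z $ j) * (z $ i - z $ l)))) = 0"
proof -
  have half: "x = (x + y) / 2" if "x = y" for x y :: complex using that by simp
  have "(\<Sum>i\<in>UNIV. \<Sum>j\<in>UNIV. 1 / (z $ i - z $ j)) = (\<Sum>i\<in>UNIV. \<Sum>j\<in>UNIV. 1 / (z $ j - z $ i))"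
    by (rule sum.swap)
  also have "\<dots> = - (\<Sum>i\<in>UNIV. \<Sum>j\<in>UNIV. 1 / (z $ i - z $ j))"
    unfolding sum_negf[symmetric] by (intro sum.cong refl inverse_diff_antisym)
  finally show "(\<Sum>i\<in>UNIV. \<Sum>j\<in>UNIV. 1 / (z $ i - z $ j)) = 0" by simp
  define s where "s i j = (z $ i)\<^sup>2 * (1 / (z $ i - z $ j))" for i j
  have "(\<Sum>i\<in>UNIV. \<Sum>j\<in>UNIV. s i j) = ((\<Sum>i\<in>UNIV. \<Sum>j\<in>UNIV. s i j) + (\<Sum>i\<in>UNIV. \<Sum>j\<in>UNIV. s j i)) / 2"
    by (rule half, rule sum.swap)
  \<comment> \<open>The correction removes the diagonal, where \<open>s i i = 0\<close> whereas
    \<open>z $ i + z $ i\<close> need not vanish; it turns \<open>CARD('k)\<close> into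
    \<open>CARD('k) - 1\<close>.\<close>
  also have "(\<Sum>i\<in>UNIV. \<Sum>j\<in>UNIV. s i j) + (\<Sum>i\<in>UNIV. \<Sum>j\<in>UNIV. s j i) = (\<Sum>i\<in>UNIV. \<Sum>j\<in>UNIV. z $ i + z $ j - (if j = i then 2 * z $ i else 0))"
    unfolding sum.distrib[symmetric]
  proof (intro sum.cong refl)
    fix i j
    show "s i j + s j i = z $ i + z $ j - (if j = i then 2 * z $ i else 0)"
    proof (cases "j = i")
      case False
      then have ne: "z $ i - z $ j \<noteq> 0" using inj by (auto simp: inj_def)
      have "s i j + s j i = ((z $ i)\<^sup>2 - (z $ j)\<^sup>2) / (z $ i - z $ j)"
        unfolding s_def by (subst (2) inverse_diff_antisym) (simp add: diff_divide_distrib)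
      also have "\<dots> = z $ i + z $ j" using ne by (simp add: power2_eq_square square_diff_square_factored)
      finally show ?thesis using False by simp
    qed (simp add: s_def)
  qed
  also have "\<dots> / 2 = (of_nat CARD('k) - 1) * (\<Sum>i\<in>UNIV. z $ i)"
    by (simp add: sum_subtractf sum.distrib sum_distrib_left[symmetric]) (simp add: field_simps)
  finally show "(\<Sum>i\<in>UNIV. (z $ i)\<^sup>2 * (\<Sum>j\<in>UNIV. 1 / (z $ i - z $ j))) = (of_nat CARD('k) - 1) * (\<Sum>i\<in>UNIV. z $ i)"
    by (simp add: s_def sum_distrib_left)
  define T where "T i j l = (if i \<noteq> j \<and> j \<noteq> l \<and> i \<noteq> l then z $ i / ((z $ i - z $ j) * (z $ i - z $ l)) else 0)" for i j l
  have "(\<Sum>i\<in>UNIV. z $ i * (\<Sum>j\<in>UNIV - {i}. \<Sum>l\<in>UNIV - {i} - {j}. 1 / ((z $ i - z $ j) * (z $ i - z $ l)))) = (\<Sum>i\<in>UNIV. \<Sum>j\<in>UNIV. \<Sum>l\<in>UNIV. T i j l)"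
    unfolding sum_distrib_left
    by (intro sum.cong refl sum.mono_neutral_cong_left) (auto simp: T_def intro!: sum.mono_neutral_cong_left sum.neutral)
  also have "\<dots> = 0"
  proof -
    have c1: "(\<Sum>i\<in>UNIV. \<Sum>j\<in>UNIV. \<Sum>l\<in>UNIV. T i j l) = (\<Sum>i\<in>UNIV. \<Sum>j\<in>UNIV. \<Sum>l\<in>UNIV. T j l i)" for T :: "'k \<Rightarrow> 'k \<Rightarrow> 'k \<Rightarrow> complex"
    proof -
      have "(\<Sum>j\<in>UNIV. \<Sum>l\<in>UNIV. \<Sum>i\<in>UNIV. T j l i) = (\<Sum>j\<in>UNIV. \<Sum>i\<in>UNIV. \<Sum>l\<in>UNIV. T j l i)"
        by (intro sum.cong refl sum.swap)
      also have "\<dots> = (\<Sum>i\<in>UNIV. \<Sum>j\<in>UNIV. \<Sum>l\<in>UNIV. T j l i)" by (rule sum.swap)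
      finally show ?thesis .
    qed
    have zero: "T i j l + T j l i + T l i j = 0" for i j l
    proof (cases "i \<noteq> j \<and> j \<noteq> l \<and> i \<noteq> l")
      case True
      then have "z $ i - z $ j \<noteq> 0" "z $ i - z $ l \<noteq> 0" "z $ j - z $ l \<noteq> 0" using inj by (auto simp: inj_def)
      then have "z $ i / ((z $ i - z $ j) * (z $ i - z $ l)) + z $ j / ((z $ j - z $ l) * (- (z $ i - z $ j))) + z $ l / ((- (z $ i - z $ l)) * (- (z $ j - z $ l))) = 0"
        by (simp add: divide_simps) (simp add: algebra_simps)
      then show ?thesis using True by (auto simp: T_def)
    qed (auto simp: T_def)
    have "(\<Sum>i\<in>UNIV. \<Sum>j\<in>UNIV. \<Sum>l\<in>UNIV. T i j l) + (\<Sum>i\<in>UNIV. \<Sum>j\<in>UNIV. \<Sum>l\<in>UNIV. T j l i) + (\<Sum>i\<in>UNIV. \<Sum>j\<in>UNIV. \<Sum>l\<in>UNIV. T l i j) = 0"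
      unfolding sum.distrib[symmetric] zero by simp
    then have "3 * (\<Sum>i\<in>UNIV. \<Sum>j\<in>UNIV. \<Sum>l\<in>UNIV. T i j l) = 0"
      using c1[of T] c1[of "\<lambda>i j l. T j l i"] by simp
    then show ?thesis by simp
  qed
  finally show "(\<Sum>i\<in>UNIV. z $ i * (\<Sum>j\<in>UNIV - {i}. \<Sum>l\<in>UNIV - {i} - {j}. 1 / ((z $ i - z $ j) * (z $ i - z $ l)))) = 0" .
qed

section \<open>One-variable restrictions and derivatives of the Vandermonde product\<close>

definition upd :: "complex^'k \<Rightarrow> 'k \<Rightarrow> complex \<Rightarrow> complex^'k" where
  "upd z i t = (\<chi> j. if j = i then t else z $ j)"

text \<open>The pairs that avoid \<open>i\<close> and the sign
  \<open>(- 1) ^ card {b. i < b}\<close> do not depend on the entry at \<open>i\<close>, so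
  comparing a general value with \<open>z $ i\<close> leaves the products over
  \<open>j \<noteq> i\<close>.\<close>

lemma vandermonde_upd:
  fixes z :: "complex^'k::{finite,linorder}"
  shows "vandermonde (upd z i t) * (\<Prod>j\<in>UNIV - {i}. z $ i - z $ j) = vandermonde z * (\<Prod>j\<in>UNIV - {i}. t - z $ j)"
proof -
  let ?S = "{(a, b). a < b \<and> a \<noteq> i \<and> b \<noteq> i}"
  define C where "C = (\<Prod>(a, b)\<in>?S. z $ b - z $ a)"
  have ps: "{(a, b). a < b} = ?S \<union> ((\<lambda>b. (i, b)) ` {b. i < b} \<union> (\<lambda>a. (a, i)) ` {a. a < i})" by auto
  have v: "vandermonde y = (\<Prod>(a, b)\<in>?S. y $ b - y $ a) * ((\<Prod>b\<in>{b. i < b}. y $ b - y $ i) * (\<Prod>a\<in>{a. a < i}. y $ i - y $ a))" for y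
    unfolding vandermonde_def ps
    by (subst prod.union_disjoint; (subst prod.union_disjoint)?; auto simp: prod.reindex inj_on_def)
  have c: "(\<Prod>(a, b)\<in>?S. upd z i t $ b - upd z i t $ a) = C" for t
    unfolding C_def by (intro prod.cong) (auto simp: upd_def)
  have p1: "(\<Prod>b\<in>{b. i < b}. upd z i t $ b - upd z i t $ i) = (\<Prod>b\<in>{b. i < b}. (- 1) * (t - z $ b))" for t
    by (intro prod.cong) (auto simp: upd_def)
  have p2: "(\<Prod>a\<in>{a. a < i}. upd z i t $ i - upd z i t $ a) = (\<Prod>a\<in>{a. a < i}. t - z $ a)" for t
    by (intro prod.cong) (auto simp: upd_def)
  have q: "(\<Prod>j\<in>UNIV - {i}. t - z $ j) = (\<Prod>b\<in>{b. i < b}. t - z $ b) * (\<Prod>a\<in>{a. a < i}. t - z $ a)" for t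
  proof -
    have *: "UNIV - {i} = {b. i < b} \<union> {a. a < i}" by auto
    show ?thesis unfolding * by (subst prod.union_disjoint) auto
  qed
  have V: "vandermonde (upd z i t) = C * (- 1) ^ card {b. i < b} * (\<Prod>j\<in>UNIV - {i}. t - z $ j)" for t
    unfolding v[of "upd z i t"] c p1 p2 q prod.distrib prod_constant by (simp add: mult_ac)
  have e: "upd z i (z $ i) = z" by (simp add: upd_def vec_eq_iff)
  show ?thesis using V[of "z $ i"] unfolding e V[of t] by (simp add: mult_ac)
qed

lemma pderiv_sum: "pderiv (\<Sum>i\<in>I. f i) = (\<Sum>i\<in>I. pderiv (f i))"
  by (induction I rule: infinite_finite_induct) (simp_all add: pderiv_add)

definition rootpoly :: "complex^'k::finite \<Rightarrow> 'k \<Rightarrow> complex poly" where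
  "rootpoly z i = (\<Prod>j\<in>UNIV - {i}. [:- z $ j, 1:])"

lemma poly_rootpoly: "poly (rootpoly z i) t = (\<Prod>j\<in>UNIV - {i}. t - z $ j)"
  by (simp add: rootpoly_def poly_prod)

lemma
  fixes z :: "complex^'k::finite"
  assumes inj: "inj (($) z)"
  shows rootpoly_nonzero: "poly (rootpoly z i) (z $ i) \<noteq> 0"
    and pderiv_rootpoly: "poly (pderiv (rootpoly z i)) (z $ i) = poly (rootpoly z i) (z $ i) * (\<Sum>j\<in>UNIV. 1 / (z $ i - z $ j))"
    and pderiv2_rootpoly: "poly (pderiv (pderiv (rootpoly z i))) (z $ i) = poly (rootpoly z i) (z $ i) *
      (\<Sum>j\<in>UNIV - {i}. \<Sum>l\<in>UNIV - {i} - {j}. 1 / ((z $ i - z $ j) * (z $ i - z $ l)))"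
proof -
  have ne: "z $ i - z $ j \<noteq> 0" if "j \<noteq> i" for j using inj that by (auto simp: inj_def)
  show "poly (rootpoly z i) (z $ i) \<noteq> 0" using ne by (auto simp: poly_rootpoly)
  have pd: "pderiv (\<Prod>j\<in>J. [:- z $ j, 1:]) = (\<Sum>j\<in>J. \<Prod>l\<in>J - {j}. [:- z $ l, 1:])" for J
    by (simp add: pderiv_prod pderiv_pCons)
  have rem: "(\<Prod>l\<in>J - {j}. z $ i - z $ l) = (\<Prod>l\<in>J. z $ i - z $ l) * (1 / (z $ i - z $ j))" if "j \<in> J" "j \<noteq> i" for J j
    using prod.remove[of J j "\<lambda>l. z $ i - z $ l"] that ne[OF that(2)] by simp
  have "poly (pderiv (rootpoly z i)) (z $ i) = (\<Sum>j\<in>UNIV - {i}. \<Prod>l\<in>UNIV - {i} - {j}. z $ i - z $ l)"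
    unfolding rootpoly_def pd by (simp add: poly_sum poly_prod)
  also have "\<dots> = (\<Sum>j\<in>UNIV - {i}. poly (rootpoly z i) (z $ i) * (1 / (z $ i - z $ j)))"
    unfolding poly_rootpoly by (intro sum.cong refl rem) auto
  also have "\<dots> = (\<Sum>j\<in>UNIV. poly (rootpoly z i) (z $ i) * (1 / (z $ i - z $ j)))"
    by (rule sum.mono_neutral_left) auto
  finally show "poly (pderiv (rootpoly z i)) (z $ i) = poly (rootpoly z i) (z $ i) * (\<Sum>j\<in>UNIV. 1 / (z $ i - z $ j))"
    by (simp only: sum_distrib_left)
  have "poly (pderiv (pderiv (rootpoly z i))) (z $ i) = (\<Sum>j\<in>UNIV - {i}. \<Sum>l\<in>UNIV - {i} - {j}. \<Prod>p\<in>UNIV - {i} - {j} - {l}. z $ i - z $ p)"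
    unfolding rootpoly_def pd pderiv_sum by (simp add: poly_sum poly_prod)
  also have "\<dots> = (\<Sum>j\<in>UNIV - {i}. \<Sum>l\<in>UNIV - {i} - {j}. poly (rootpoly z i) (z $ i) * (1 / ((z $ i - z $ j) * (z $ i - z $ l))))"
    unfolding poly_rootpoly
  proof (intro sum.cong refl)
    fix j l assume jl: "j \<in> UNIV - {i}" "l \<in> UNIV - {i} - {j}"
    show "(\<Prod>p\<in>UNIV - {i} - {j} - {l}. z $ i - z $ p) = (\<Prod>j\<in>UNIV - {i}. z $ i - z $ j) * (1 / ((z $ i - z $ j) * (z $ i - z $ l)))"
      using jl by (subst rem, simp, simp, subst rem) auto
  qed
  finally show "poly (pderiv (pderiv (rootpoly z i))) (z $ i) = poly (rootpoly z i) (z $ i) *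
      (\<Sum>j\<in>UNIV - {i}. \<Sum>l\<in>UNIV - {i} - {j}. 1 / ((z $ i - z $ j) * (z $ i - z $ l)))"
    by (simp only: sum_distrib_left)
qed

context
  fixes z :: "complex^'k::{finite,linorder}" and G :: "complex^'n::finite^'n" and m :: nat
  assumes inj: "inj (($) z)" and m: "m = CARD('n) + CARD('k) - 1"
begin

text \<open>The sum in \<open>sum_coefS\<close> as a formal polynomial in the variable
  \<open>z $ i\<close> alone. Its derivatives weight the coefficients by powers of
  \<open>\<alpha> i\<close>, while \<open>slice_eq\<close> gives the same derivatives in closed
  form.\<close>

definition slice :: "'k \<Rightarrow> complex poly" where
  "slice i = (\<Sum>\<alpha>\<in>box m. monom (coefS \<alpha> G * (\<Prod>j\<in>UNIV - {i}. (z $ j) ^ \<alpha> j)) (\<alpha> i))"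

lemma slice_eq:
  "slice i = smult (vandermonde z * charprod_except z i G / poly (rootpoly z i) (z $ i)) (rootpoly z i * cpoly G)"
    (is "_ = ?r")
proof -
  have "poly (slice i) t = poly ?r t" for t
  proof -
    have "mpow (upd z i t) \<alpha> = (\<Prod>j\<in>UNIV - {i}. (z $ j) ^ \<alpha> j) * t ^ \<alpha> i" for \<alpha>
      unfolding mpow_def by (subst prod.remove[of _ i]) (auto simp: upd_def intro!: prod.cong)
    then have "poly (slice i) t = (\<Sum>\<alpha>\<in>box m. coefS \<alpha> G * mpow (upd z i t) \<alpha>)"
      by (simp add: slice_def poly_sum poly_monom mult.assoc)
    also have "\<dots> = vandermonde (upd z i t) * charprod (upd z i t) G" by (rule sum_coefS[OF m])
    also have "charprod (upd z i t) G = chi t G * charprod_except z i G"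
      unfolding charprod_split[of _ G i] charprod_except_def by (auto simp: upd_def intro!: prod.cong)
    also have "vandermonde (upd z i t) = vandermonde z * poly (rootpoly z i) t / poly (rootpoly z i) (z $ i)"
      using vandermonde_upd[of z i t] rootpoly_nonzero[OF inj, of i] unfolding poly_rootpoly[symmetric] by (simp add: field_simps)
    finally show ?thesis by (simp add: poly_cpoly mult_ac)
  qed
  then show ?thesis by (metis ext poly_eq_poly_eq_iff)
qed

abbreviation "ch i \<equiv> chi (z $ i) G"
abbreviation "ch1 i \<equiv> poly (pderiv (cpoly G)) (z $ i)"
abbreviation "ch2 i \<equiv> poly (pderiv (pderiv (cpoly G))) (z $ i)"
abbreviation "S1 i \<equiv> (\<Sum>j\<in>UNIV. 1 / (z $ i - z $ j))"
abbreviation "S2 i \<equiv> (\<Sum>j\<in>UNIV - {i}. \<Sum>l\<in>UNIV - {i} - {j}. 1 / ((z $ i - z $ j) * (z $ i - z $ l)))"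
abbreviation "W i \<equiv> vandermonde z * charprod_except z i G"

lemma slice_values:
  "poly (slice i) (z $ i) = W i * ch i"
  "poly (pderiv (slice i)) (z $ i) = W i * (S1 i * ch i + ch1 i)"
  "poly (pderiv (pderiv (slice i))) (z $ i) = W i * (S2 i * ch i + 2 * S1 i * ch1 i + ch2 i)"
  using rootpoly_nonzero[OF inj, of i]
  by (simp_all add: slice_eq pderiv_smult pderiv_mult pderiv_add pderiv_rootpoly[OF inj] pderiv2_rootpoly[OF inj] poly_cpoly)
    (simp_all add: field_simps)

lemma mpow_split: "mpow z \<alpha> = (z $ i) ^ \<alpha> i * (\<Prod>j\<in>UNIV - {i}. (z $ j) ^ \<alpha> j)"
  unfolding mpow_def by (simp add: prod.remove[of UNIV i])

lemma mpow_upd: "mpow z (\<alpha>(i := l)) = (z $ i) ^ l * (\<Prod>j\<in>UNIV - {i}. (z $ j) ^ \<alpha> j)"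
  unfolding mpow_split[of _ i] by (auto intro!: prod.cong)

text \<open>The left side is \<open>\<Sum>i. m z_i - z_i^2 \<partial>_i\<close> applied to
  \<open>\<Delta>(z) \<Prod>i. det (z_i - G)\<close>. The derivative of \<open>\<Delta>\<close>
  contributes \<open>CARD('k) - 1\<close> times the sum of the \<open>z_i\<close>, which lowers
  \<open>m\<close> to \<open>CARD('n)\<close>, the constant in
  \<open>sqEuler_charprod\<close>.\<close>

lemma sum_coefS_raise:
  "(\<Sum>\<alpha>\<in>box m. coefS \<alpha> G * (\<Sum>i\<in>UNIV. of_nat (m - \<alpha> i) * mpow z (\<alpha>(i := Suc (\<alpha> i)))))
    = vandermonde z * (sqEuler (charprod z) G - of_nat CARD('k) * trace G * charprod z G)"
proof -
  have "(\<Sum>\<alpha>\<in>box m. coefS \<alpha> G * (of_nat (m - \<alpha> i) * mpow z (\<alpha>(i := Suc (\<alpha> i)))))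
      = of_nat m * z $ i * poly (slice i) (z $ i) - (z $ i)\<^sup>2 * poly (pderiv (slice i)) (z $ i)" for i
    unfolding slice_def pderiv_sum pderiv_monom poly_sum poly_monom sum_distrib_left sum_subtractf[symmetric]
  proof (rule sum.cong[OF refl])
    fix \<alpha> :: "'k \<Rightarrow> nat" assume "\<alpha> \<in> box m"
    then have "\<alpha> i \<le> m" by auto
    then show "coefS \<alpha> G * (of_nat (m - \<alpha> i) * mpow z (\<alpha>(i := Suc (\<alpha> i))))
      = of_nat m * z $ i * (coefS \<alpha> G * (\<Prod>j\<in>UNIV - {i}. z $ j ^ \<alpha> j) * (z $ i) ^ \<alpha> i)
        - (z $ i)\<^sup>2 * (of_nat (\<alpha> i) * (coefS \<alpha> G * (\<Prod>j\<in>UNIV - {i}. z $ j ^ \<alpha> j)) * (z $ i) ^ (\<alpha> i - 1))"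
      unfolding mpow_upd by (cases "\<alpha> i") (simp_all add: of_nat_diff algebra_simps power2_eq_square)
  qed
  then have "(\<Sum>\<alpha>\<in>box m. coefS \<alpha> G * (\<Sum>i\<in>UNIV. of_nat (m - \<alpha> i) * mpow z (\<alpha>(i := Suc (\<alpha> i)))))
     = (\<Sum>i\<in>UNIV. of_nat m * z $ i * poly (slice i) (z $ i) - (z $ i)\<^sup>2 * poly (pderiv (slice i)) (z $ i))"
    unfolding sum_distrib_left by (subst sum.swap) simp
  also have "\<dots> = (\<Sum>i\<in>UNIV. vandermonde z * (charprod z G * (of_nat m * z $ i) - charprod z G * ((z $ i)\<^sup>2 * S1 i) - (z $ i)\<^sup>2 * ch1 i * charprod_except z i G))"
  proof (rule sum.cong[OF refl])
    fix i
    show "of_nat m * z $ i * poly (slice i) (z $ i) - (z $ i)\<^sup>2 * poly (pderiv (slice i)) (z $ i)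
      = vandermonde z * (charprod z G * (of_nat m * z $ i) - charprod z G * ((z $ i)\<^sup>2 * S1 i) - (z $ i)\<^sup>2 * ch1 i * charprod_except z i G)"
      unfolding slice_values charprod_split[of z G i] by (simp add: algebra_simps del: sum_divide_distrib)
  qed
  also have "\<dots> = vandermonde z * (charprod z G * (of_nat m * (\<Sum>i\<in>UNIV. z $ i)) - charprod z G * (\<Sum>i\<in>UNIV. (z $ i)\<^sup>2 * S1 i) - (\<Sum>i\<in>UNIV. (z $ i)\<^sup>2 * ch1 i * charprod_except z i G))"
    by (simp only: sum_distrib_left[symmetric] sum_subtractf)
  also have "(\<Sum>i\<in>UNIV. (z $ i)\<^sup>2 * S1 i) = (of_nat CARD('k) - 1) * (\<Sum>i\<in>UNIV. z $ i)"
    by (rule partial_fraction_sums(2)[OF inj])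
  also have "charprod z G * (of_nat m * (\<Sum>i\<in>UNIV. z $ i)) - charprod z G * ((of_nat CARD('k) - 1) * (\<Sum>i\<in>UNIV. z $ i)) - (\<Sum>i\<in>UNIV. (z $ i)\<^sup>2 * ch1 i * charprod_except z i G)
     = (\<Sum>i\<in>UNIV. (of_nat CARD('n) * z $ i) * charprod z G) - (\<Sum>i\<in>UNIV. (z $ i)\<^sup>2 * ch1 i * charprod_except z i G)"
  proof -
    have mm: "of_nat m = (of_nat CARD('n) + of_nat CARD('k) - 1 :: complex)"
      using zero_less_card_finite[where 'a='k] by (simp add: m of_nat_diff Suc_le_eq)
    show ?thesis unfolding mm by (simp add: sum_distrib_right[symmetric] sum_distrib_left[symmetric] algebra_simps)
  qed
  also have "\<dots> = (\<Sum>i\<in>UNIV. (of_nat CARD('n) * z $ i * ch i - (z $ i)\<^sup>2 * ch1 i) * charprod_except z i G)"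
    unfolding sum_subtractf[symmetric]
  proof (rule sum.cong[OF refl])
    fix i
    show "of_nat CARD('n) * z $ i * charprod z G - (z $ i)\<^sup>2 * ch1 i * charprod_except z i G
      = (of_nat CARD('n) * z $ i * ch i - (z $ i)\<^sup>2 * ch1 i) * charprod_except z i G"
      unfolding charprod_split[of z G i] by (simp add: algebra_simps)
  qed
  finally show ?thesis by (simp only: sqEuler_charprod)
qed

text \<open>The left side is \<open>\<Sum>i. m \<partial>_i - z_i \<partial>_i^2\<close> applied to
  the same product. Terms with derivatives on \<open>\<Delta>\<close> alone cancel in total by
  \<open>partial_fraction_sums\<close>; splitting \<open>m = (CARD('n) - 1) + CARD('k)\<close>
  separates the \<open>capB\<close> part from the trace part.\<close>

lemma sum_coefS_lower:
  "(\<Sum>\<alpha>\<in>box m. coefS \<alpha> G * (\<Sum>i\<in>UNIV. of_nat (\<alpha> i * (Suc m - \<alpha> i)) * mpow z (\<alpha>(i := \<alpha> i - 1))))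
    = vandermonde z * (capB (charprod z) G - of_nat CARD('k) * (\<Sum>a\<in>UNIV. pd a a (charprod z) G))"
proof -
  have "(\<Sum>\<alpha>\<in>box m. coefS \<alpha> G * (of_nat (\<alpha> i * (Suc m - \<alpha> i)) * mpow z (\<alpha>(i := \<alpha> i - 1))))
      = of_nat m * poly (pderiv (slice i)) (z $ i) - z $ i * poly (pderiv (pderiv (slice i))) (z $ i)" for i
    unfolding slice_def pderiv_sum pderiv_monom poly_sum poly_monom sum_distrib_left sum_subtractf[symmetric]
  proof (rule sum.cong[OF refl])
    fix \<alpha> :: "'k \<Rightarrow> nat" assume "\<alpha> \<in> box m"
    then have a: "\<alpha> i \<le> m" by auto
    define R where "R = (\<Prod>j\<in>UNIV - {i}. z $ j ^ \<alpha> j)"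
    show "coefS \<alpha> G * (of_nat (\<alpha> i * (Suc m - \<alpha> i)) * mpow z (\<alpha>(i := \<alpha> i - 1)))
      = of_nat m * (of_nat (\<alpha> i) * (coefS \<alpha> G * (\<Prod>j\<in>UNIV - {i}. z $ j ^ \<alpha> j)) * (z $ i) ^ (\<alpha> i - 1))
        - z $ i * (of_nat (\<alpha> i - 1) * (of_nat (\<alpha> i) * (coefS \<alpha> G * (\<Prod>j\<in>UNIV - {i}. z $ j ^ \<alpha> j))) * (z $ i) ^ (\<alpha> i - 1 - 1))"
    proof (cases "\<alpha> i")
      case (Suc c)
      then obtain d where d: "m = Suc c + d" using a le_Suc_ex by metis
      show ?thesis unfolding mpow_upd R_def[symmetric] Suc d by (cases c) (simp_all add: algebra_simps)
    qed simp
  qed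
  then have "(\<Sum>\<alpha>\<in>box m. coefS \<alpha> G * (\<Sum>i\<in>UNIV. of_nat (\<alpha> i * (Suc m - \<alpha> i)) * mpow z (\<alpha>(i := \<alpha> i - 1))))
     = (\<Sum>i\<in>UNIV. of_nat m * poly (pderiv (slice i)) (z $ i) - z $ i * poly (pderiv (pderiv (slice i))) (z $ i))"
    unfolding sum_distrib_left by (subst sum.swap) simp
  also have "\<dots> = (\<Sum>i\<in>UNIV. vandermonde z * (charprod z G * (of_nat m * S1 i) - charprod z G * (z $ i * S2 i)
      + (of_nat m * ch1 i - z $ i * ch2 i - 2 * z $ i * ch1 i * S1 i) * charprod_except z i G))"
  proof (rule sum.cong[OF refl])
    fix i
    define s1 s2 where "s1 = S1 i" and "s2 = S2 i"
    show "of_nat m * poly (pderiv (slice i)) (z $ i) - z $ i * poly (pderiv (pderiv (slice i))) (z $ i)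
      = vandermonde z * (charprod z G * (of_nat m * S1 i) - charprod z G * (z $ i * S2 i)
      + (of_nat m * ch1 i - z $ i * ch2 i - 2 * z $ i * ch1 i * S1 i) * charprod_except z i G)"
      unfolding slice_values charprod_split[of z G i] s1_def[symmetric] s2_def[symmetric] by (simp add: algebra_simps)
  qed
  also have "\<dots> = vandermonde z * (charprod z G * (of_nat m * (\<Sum>i\<in>UNIV. S1 i)) - charprod z G * (\<Sum>i\<in>UNIV. z $ i * S2 i)
      + (\<Sum>i\<in>UNIV. (of_nat m * ch1 i - z $ i * ch2 i - 2 * z $ i * ch1 i * S1 i) * charprod_except z i G))"
    by (simp only: sum_distrib_left[symmetric] sum_subtractf sum.distrib)
  also have "\<dots> = vandermonde z * (\<Sum>i\<in>UNIV. (of_nat m * ch1 i - z $ i * ch2 i - 2 * z $ i * ch1 i * S1 i) * charprod_except z i G)"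
    unfolding partial_fraction_sums(1,3)[OF inj] by simp
  also have "(\<Sum>i\<in>UNIV. (of_nat m * ch1 i - z $ i * ch2 i - 2 * z $ i * ch1 i * S1 i) * charprod_except z i G)
    = (\<Sum>i\<in>UNIV. ((of_nat CARD('n) - 1) * ch1 i - z $ i * ch2 i - 2 * z $ i * ch1 i * S1 i) * charprod_except z i G
       + of_nat CARD('k) * (ch1 i * charprod_except z i G))"
  proof (rule sum.cong[OF refl])
    fix i
    define s1 where "s1 = S1 i"
    have mm: "of_nat m = (of_nat CARD('n) + of_nat CARD('k) - 1 :: complex)"
      using zero_less_card_finite[where 'a='k] by (simp add: m of_nat_diff Suc_le_eq)
    show "(of_nat m * ch1 i - z $ i * ch2 i - 2 * z $ i * ch1 i * S1 i) * charprod_except z i G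
      = ((of_nat CARD('n) - 1) * ch1 i - z $ i * ch2 i - 2 * z $ i * ch1 i * S1 i) * charprod_except z i G
       + of_nat CARD('k) * (ch1 i * charprod_except z i G)"
      unfolding s1_def[symmetric] mm by (simp add: algebra_simps)
  qed
  also have "\<dots> = capB (charprod z) G - of_nat CARD('k) * (\<Sum>a\<in>UNIV. pd a a (charprod z) G)"
    unfolding capB_charprod[OF inj] pd_trace_charprod sum.distrib sum_distrib_left[symmetric] by simp
  finally show ?thesis .
qed

end

section \<open>Comparison of coefficients\<close>

lemma poly_zero_if_cofinitely_zero:
  fixes c :: "nat \<Rightarrow> complex"
  assumes "finite Z" "\<And>t. t \<notin> Z \<Longrightarrow> (\<Sum>l\<le>m. c l * t ^ l) = 0" "l \<le> m"
  shows "c l = 0"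
proof -
  define p where "p = (\<Sum>l\<le>m. monom (c l) l)"
  have p: "poly p t = (\<Sum>l\<le>m. c l * t ^ l)" for t by (simp add: p_def poly_sum poly_monom)
  have "- Z \<subseteq> {t. poly p t = 0}" using assms(2) by (auto simp: p)
  moreover have "infinite (- Z)" using assms(1) infinite_UNIV_char_0 by (metis Diff_infinite_finite Compl_eq_Diff_UNIV)
  ultimately have "p = 0" using poly_roots_finite finite_subset by blast
  moreover have "coeff p l = c l" using assms(3) by (simp add: p_def coeff_sum)
  ultimately show ?thesis by simp
qed

text \<open>Induction on the variables: when one is added, its value has to avoid the finitely many
  old ones, and a polynomial in one variable that vanishes outside a finite set is zero.\<close>

lemma multivariate_coeffs_zero:
  fixes c :: "('k \<Rightarrow> nat) \<Rightarrow> complex"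
  assumes "finite I" "\<And>z. inj_on z I \<Longrightarrow> (\<Sum>\<alpha>\<in>PiE I (\<lambda>_. {..m}). c \<alpha> * (\<Prod>i\<in>I. z i ^ \<alpha> i)) = 0"
    and "\<alpha> \<in> PiE I (\<lambda>_. {..m})"
  shows "c \<alpha> = 0"
  using assms
proof (induction I arbitrary: c \<alpha> rule: finite_induct)
  case empty
  then show ?case using empty.prems(1)[of "\<lambda>_. 0"] by simp
next
  case (insert x I)
  let ?B = "PiE I (\<lambda>_. {..m})"
  have zero: "(\<Sum>\<alpha>\<in>?B. c (\<alpha>(x := l)) * (\<Prod>i\<in>I. z i ^ \<alpha> i)) = 0" if z: "inj_on z I" and l: "l \<le> m" for z l
  proof (rule poly_zero_if_cofinitely_zero[where Z="z ` I" and m=m and c="\<lambda>l. \<Sum>\<alpha>\<in>?B. c (\<alpha>(x := l)) * (\<Prod>i\<in>I. z i ^ \<alpha> i)"])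
    fix t assume t: "t \<notin> z ` I"
    define y where "y = z(x := t)"
    have "inj_on y (insert x I)" using z t insert.hyps by (auto simp: y_def inj_on_def)
    then have "0 = (\<Sum>\<alpha>\<in>PiE (insert x I) (\<lambda>_. {..m}). c \<alpha> * (\<Prod>i\<in>insert x I. y i ^ \<alpha> i))"
      by (rule insert.prems(1)[symmetric])
    also have "\<dots> = (\<Sum>(l, \<alpha>)\<in>{..m} \<times> ?B. c (\<alpha>(x := l)) * (\<Prod>i\<in>insert x I. y i ^ (\<alpha>(x := l)) i))"
      unfolding PiE_insert_eq
      by (subst sum.reindex[OF inj_combinator[OF insert.hyps(2)]]) (simp add: case_prod_beta')
    also have "\<dots> = (\<Sum>l\<le>m. \<Sum>\<alpha>\<in>?B. c (\<alpha>(x := l)) * (\<Prod>i\<in>insert x I. y i ^ (\<alpha>(x := l)) i))"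
      by (simp add: sum.cartesian_product)
    also have "\<dots> = (\<Sum>l\<le>m. (\<Sum>\<alpha>\<in>?B. c (\<alpha>(x := l)) * (\<Prod>i\<in>I. z i ^ \<alpha> i)) * t ^ l)"
      unfolding sum_distrib_right
    proof (intro sum.cong refl)
      fix l \<alpha>
      have "(\<Prod>i\<in>insert x I. y i ^ (\<alpha>(x := l)) i) = t ^ l * (\<Prod>i\<in>I. z i ^ \<alpha> i)"
      proof -
        have "(\<Prod>i\<in>I. y i ^ (\<alpha>(x := l)) i) = (\<Prod>i\<in>I. z i ^ \<alpha> i)"
          using insert.hyps by (intro prod.cong) (auto simp: y_def)
        then show ?thesis using insert.hyps by (simp add: y_def)
      qed
      then show "c (\<alpha>(x := l)) * (\<Prod>i\<in>insert x I. y i ^ (\<alpha>(x := l)) i) = c (\<alpha>(x := l)) * (\<Prod>i\<in>I. z i ^ \<alpha> i) * t ^ l"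
        by simp
    qed
    finally show "(\<Sum>l\<le>m. (\<Sum>\<alpha>\<in>?B. c (\<alpha>(x := l)) * (\<Prod>i\<in>I. z i ^ \<alpha> i)) * t ^ l) = 0" ..
  qed (use insert.hyps l in auto)
  obtain l \<beta> where ab: "\<alpha> = \<beta>(x := l)" "\<beta> \<in> ?B" "l \<le> m"
    using insert.prems(2) unfolding PiE_insert_eq by auto
  show ?case unfolding ab(1) by (rule insert.IH[of "\<lambda>\<beta>. c (\<beta>(x := l))" \<beta>]) (use zero ab in auto)
qed

lemma mpow_coeffs_zero:
  fixes c :: "('k::finite \<Rightarrow> nat) \<Rightarrow> complex"
  assumes "\<And>z :: complex^'k. inj (($) z) \<Longrightarrow> (\<Sum>\<alpha>\<in>box m. c \<alpha> * mpow z \<alpha>) = 0" "\<alpha> \<in> box m"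
  shows "c \<alpha> = 0"
proof (rule multivariate_coeffs_zero[OF finite _ assms(2)])
  fix z :: "'k \<Rightarrow> complex" assume "inj z"
  then show "(\<Sum>\<alpha>\<in>box m. c \<alpha> * (\<Prod>i\<in>UNIV. z i ^ \<alpha> i)) = 0"
    using assms(1)[of "vec_lambda z"] by (simp add: mpow_def inj_def)
qed

text \<open>Summation by parts in the exponent \<open>j\<close>. The weight vanishes at
  \<open>\<beta> j = m\<close>, so the shifted index stays in the box; in the lowering counterpart
  the weight vanishes at exponent 0.\<close>

lemma sum_box_raise:
  fixes c :: "('k::finite \<Rightarrow> nat) \<Rightarrow> complex"
  shows "(\<Sum>\<beta>\<in>box m. c \<beta> * (of_nat (m - \<beta> j) * f (\<beta>(j := Suc (\<beta> j)))))
    = (\<Sum>\<beta>\<in>box m. (if 0 < \<beta> j then of_nat (Suc m - \<beta> j) * c (\<beta>(j := \<beta> j - 1)) else 0) * f \<beta>)"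
proof -
  have "(\<Sum>\<beta>\<in>box m. c \<beta> * (of_nat (m - \<beta> j) * f (\<beta>(j := Suc (\<beta> j)))))
    = (\<Sum>\<beta>\<in>{\<beta> \<in> box m. \<beta> j < m}. c \<beta> * (of_nat (m - \<beta> j) * f (\<beta>(j := Suc (\<beta> j)))))"
    by (rule sum.mono_neutral_right) auto
  also have "\<dots> = (\<Sum>\<beta>\<in>{\<beta> \<in> box m. 0 < \<beta> j}. of_nat (Suc m - \<beta> j) * c (\<beta>(j := \<beta> j - 1)) * f \<beta>)"
    by (rule sum.reindex_bij_witness[of _ "\<lambda>\<beta>. \<beta>(j := \<beta> j - 1)" "\<lambda>\<beta>. \<beta>(j := Suc (\<beta> j))"])
      (auto simp: PiE_iff intro: order_trans[OF diff_le_self] dest: spec[of _ j])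
  also have "\<dots> = (\<Sum>\<beta>\<in>box m. (if 0 < \<beta> j then of_nat (Suc m - \<beta> j) * c (\<beta>(j := \<beta> j - 1)) else 0) * f \<beta>)"
    by (rule sum.mono_neutral_cong_left) auto
  finally show ?thesis .
qed

lemma sum_box_lower:
  fixes c :: "('k::finite \<Rightarrow> nat) \<Rightarrow> complex"
  shows "(\<Sum>\<alpha>\<in>box m. c \<alpha> * (of_nat (\<alpha> i * (Suc m - \<alpha> i)) * f (\<alpha>(i := \<alpha> i - 1))))
    = (\<Sum>\<alpha>\<in>box m. (if \<alpha> i < m then of_nat (Suc (\<alpha> i) * (m - \<alpha> i)) * c (\<alpha>(i := Suc (\<alpha> i))) else 0) * f \<alpha>)"
proof -
  have "(\<Sum>\<alpha>\<in>box m. c \<alpha> * (of_nat (\<alpha> i * (Suc m - \<alpha> i)) * f (\<alpha>(i := \<alpha> i - 1))))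
    = (\<Sum>\<alpha>\<in>{\<alpha> \<in> box m. 0 < \<alpha> i}. c \<alpha> * (of_nat (\<alpha> i * (Suc m - \<alpha> i)) * f (\<alpha>(i := \<alpha> i - 1))))"
    by (rule sum.mono_neutral_right) auto
  also have "\<dots> = (\<Sum>\<alpha>\<in>{\<alpha> \<in> box m. \<alpha> i < m}. of_nat (Suc (\<alpha> i) * (m - \<alpha> i)) * c (\<alpha>(i := Suc (\<alpha> i))) * f \<alpha>)"
    by (rule sum.reindex_bij_witness[of _ "\<lambda>\<beta>. \<beta>(i := Suc (\<beta> i))" "\<lambda>\<beta>. \<beta>(i := \<beta> i - 1)"])
      (auto simp: PiE_iff intro: order_trans[OF diff_le_self] less_le_trans[OF diff_less])
  also have "\<dots> = (\<Sum>\<alpha>\<in>box m. (if \<alpha> i < m then of_nat (Suc (\<alpha> i) * (m - \<alpha> i)) * c (\<alpha>(i := Suc (\<alpha> i))) else 0) * f \<alpha>)"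
    by (rule sum.mono_neutral_cong_left) auto
  finally show ?thesis .
qed

text \<open>The two matrix factors move across as derivatives and the one derivative as a factor,
  which turns a first-order operator with quadratic coefficients into a second-order one with linear
  coefficients.\<close>

lemma (in Stein_pairing) sqEuler_adjoint:
  assumes f: "f \<in> mat_poly" and g: "g \<in> mat_poly"
  shows "P f (sqEuler g) = P (capB f) g"
proof -
  note mp = mat_poly_sum mat_poly.mult mat_poly.entry pd_mat_poly f g
  have "P f (sqEuler g) = (\<Sum>a\<in>UNIV. \<Sum>b\<in>UNIV. \<Sum>c\<in>UNIV. P f (\<lambda>B. B $ a $ b * (B $ b $ c * pd a c g B)))"
    unfolding sqEuler_def[abs_def] by (simp add: sum_right mp)
  also have "\<dots> = (\<Sum>a\<in>UNIV. \<Sum>b\<in>UNIV. \<Sum>c\<in>UNIV. P (\<lambda>G. G $ c $ a * pd c b (pd b a f) G) g)"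
    by (simp add: pd_left[symmetric] pd_right mp)
  also have "\<dots> = P (capB f) g"
    unfolding capB_def[abs_def] by (simp add: sum_left mp)
  finally show ?thesis .
qed

lemma (in Stein_pairing) trace_adjoint:
  assumes f: "f \<in> mat_poly" and g: "g \<in> mat_poly"
  shows "P f (\<lambda>B. trace B * g B) = P (\<lambda>G. \<Sum>a\<in>UNIV. pd a a f G) g"
  unfolding trace_def sum_distrib_right
  by (simp add: sum_left sum_right pd_left[symmetric] mat_poly.mult mat_poly.entry pd_mat_poly f g)

lemma capB_mat_poly: "f \<in> mat_poly \<Longrightarrow> capB f \<in> mat_poly"
  unfolding capB_def[abs_def] by (intro mat_poly_sum mat_poly.mult mat_poly.entry pd_mat_poly)

lemma sqEuler_mat_poly: "f \<in> mat_poly \<Longrightarrow> sqEuler f \<in> mat_poly"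
  unfolding sqEuler_def[abs_def] by (intro mat_poly_sum mat_poly.mult mat_poly.entry pd_mat_poly)

text \<open>The raising operator acts on the second argument of the pairing of the two products with
  Vandermonde factors; its adjoint acts on the first as the lowering operator. Expanding in
  monomials of \<open>z\<close> and \<open>w\<close> gives the relation between the numbers
  \<open>r \<alpha> \<beta>\<close>.\<close>

lemma Stein_pairing_coefS_recursion:
  fixes P :: "(complex^'n::finite^'n \<Rightarrow> complex) \<Rightarrow> (complex^'n^'n \<Rightarrow> complex) \<Rightarrow> complex"
    and \<alpha> \<beta> :: "'k::{finite,linorder} \<Rightarrow> nat"
  assumes P: "Stein_pairing P" and m: "m = CARD('n) + CARD('k) - 1" and ab: "\<alpha> \<in> box m" "\<beta> \<in> box m"
  defines "r \<equiv> \<lambda>\<alpha> \<beta> :: 'k \<Rightarrow> nat. P (coefS \<alpha>) (coefS \<beta>)"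
  shows "(\<Sum>j\<in>UNIV. if 0 < \<beta> j then of_nat (Suc m - \<beta> j) * r \<alpha> (\<beta>(j := \<beta> j - 1)) else 0)
    = (\<Sum>i\<in>UNIV. if \<alpha> i < m then of_nat (Suc (\<alpha> i) * (m - \<alpha> i)) * r (\<alpha>(i := Suc (\<alpha> i))) \<beta> else 0)"
proof -
  interpret Stein_pairing P by fact
  define D where "D \<alpha> \<beta> = (\<Sum>j\<in>UNIV. if 0 < \<beta> j then of_nat (Suc m - \<beta> j) * r \<alpha> (\<beta>(j := \<beta> j - 1)) else 0)
    - (\<Sum>i\<in>UNIV. if \<alpha> i < m then of_nat (Suc (\<alpha> i) * (m - \<alpha> i)) * r (\<alpha>(i := Suc (\<alpha> i))) \<beta> else 0)" for \<alpha> \<beta>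
  let ?k = "of_nat CARD('k) :: complex"
  have zero: "(\<Sum>\<alpha>\<in>box m. (\<Sum>\<beta>\<in>box m. D \<alpha> \<beta> * mpow w \<beta>) * mpow z \<alpha>) = 0"
    if z: "inj (($) z)" and w: "inj (($) w)" for z w
  proof -
    let ?Fz = "charprod z :: complex^'n^'n \<Rightarrow> complex" and ?Fw = "charprod w :: complex^'n^'n \<Rightarrow> complex"
    define A where "A \<beta> = (\<Sum>j\<in>UNIV. of_nat (m - \<beta> j) * mpow w (\<beta>(j := Suc (\<beta> j))))" for \<beta>
    define B where "B \<alpha> = (\<Sum>i\<in>UNIV. of_nat (\<alpha> i * (Suc m - \<alpha> i)) * mpow z (\<alpha>(i := \<alpha> i - 1)))" for \<alpha>
    have bil: "P (\<lambda>G. \<Sum>\<alpha>\<in>box m. c \<alpha> * coefS \<alpha> G) (\<lambda>G. \<Sum>\<beta>\<in>box m. d \<beta> * coefS \<beta> G) = (\<Sum>\<alpha>\<in>box m. \<Sum>\<beta>\<in>box m. c \<alpha> * d \<beta> * r \<alpha> \<beta>)"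
      for c d :: "('k \<Rightarrow> nat) \<Rightarrow> complex"
      by (simp add: sum_left sum_right cmult_left cmult_right mat_poly_sum mat_poly.mult mat_poly.const coefS_mat_poly
        r_def sum_distrib_left mult.assoc)
    have Fz: "(\<lambda>G. vandermonde z * ?Fz G) = (\<lambda>G. \<Sum>\<alpha>\<in>box m. mpow z \<alpha> * coefS \<alpha> G)"
      using sum_coefS[OF m, of _ z] by (simp add: fun_eq_iff mult.commute)
    have Fw: "(\<lambda>G. vandermonde w * ?Fw G) = (\<lambda>G. \<Sum>\<alpha>\<in>box m. mpow w \<alpha> * coefS \<alpha> G)"
      using sum_coefS[OF m, of _ w] by (simp add: fun_eq_iff mult.commute)
    have Aw: "(\<lambda>G :: complex^'n^'n. vandermonde w * (sqEuler ?Fw G - ?k * trace G * ?Fw G)) = (\<lambda>G. \<Sum>\<beta>\<in>box m. A \<beta> * coefS \<beta> G)"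
      using sum_coefS_raise[OF w m] by (simp add: fun_eq_iff A_def mult.commute)
    have Bz: "(\<lambda>G :: complex^'n^'n. vandermonde z * (capB ?Fz G - ?k * (\<Sum>a\<in>UNIV. pd a a ?Fz G))) = (\<lambda>G. \<Sum>\<alpha>\<in>box m. B \<alpha> * coefS \<alpha> G)"
      using sum_coefS_lower[OF z m] by (simp add: fun_eq_iff B_def mult.commute)
    note mp = charprod_mat_poly sqEuler_mat_poly capB_mat_poly mat_poly.mult mat_poly.const mat_poly_trace mat_poly_sum pd_mat_poly
    have "P ?Fz (\<lambda>G. sqEuler ?Fw G + (- ?k) * (trace G * ?Fw G)) = P ?Fz (sqEuler ?Fw) + P ?Fz (\<lambda>G. (- ?k) * (trace G * ?Fw G))"
      by (rule add_right) (intro mp)+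
    also have "\<dots> = P (capB ?Fz) ?Fw + (- ?k) * P (\<lambda>G. \<Sum>a\<in>UNIV. pd a a ?Fz G) ?Fw"
      by (simp only: cmult_right sqEuler_adjoint[OF charprod_mat_poly charprod_mat_poly] trace_adjoint[OF charprod_mat_poly charprod_mat_poly])
    also have "\<dots> = P (capB ?Fz) ?Fw + P (\<lambda>G. (- ?k) * (\<Sum>a\<in>UNIV. pd a a ?Fz G)) ?Fw"
      by (simp only: cmult_left)
    also have "\<dots> = P (\<lambda>G. capB ?Fz G + (- ?k) * (\<Sum>a\<in>UNIV. pd a a ?Fz G)) ?Fw"
      by (rule add_left[symmetric]) (intro mp)+
    finally have "P ?Fz (\<lambda>G. sqEuler ?Fw G + (- ?k) * (trace G * ?Fw G)) = P (\<lambda>G. capB ?Fz G + (- ?k) * (\<Sum>a\<in>UNIV. pd a a ?Fz G)) ?Fw" .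
    then have "vandermonde z * vandermonde w * P ?Fz (\<lambda>G. sqEuler ?Fw G - ?k * trace G * ?Fw G)
      = vandermonde z * vandermonde w * P (\<lambda>G. capB ?Fz G - ?k * (\<Sum>a\<in>UNIV. pd a a ?Fz G)) ?Fw"
      by (simp add: mult.assoc)
    then have "P (\<lambda>G. vandermonde z * ?Fz G) (\<lambda>G. vandermonde w * (sqEuler ?Fw G - ?k * trace G * ?Fw G))
      = P (\<lambda>G. vandermonde z * (capB ?Fz G - ?k * (\<Sum>a\<in>UNIV. pd a a ?Fz G))) (\<lambda>G. vandermonde w * ?Fw G)"
      unfolding cmult_left cmult_right by (simp only: mult_ac)
    then have e: "(\<Sum>\<alpha>\<in>box m. \<Sum>\<beta>\<in>box m. mpow z \<alpha> * A \<beta> * r \<alpha> \<beta>) = (\<Sum>\<alpha>\<in>box m. \<Sum>\<beta>\<in>box m. B \<alpha> * mpow w \<beta> * r \<alpha> \<beta>)"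
      unfolding Fz Fw Aw Bz bil .
    have a: "(\<Sum>\<beta>\<in>box m. r \<alpha> \<beta> * A \<beta>) = (\<Sum>\<beta>\<in>box m. (\<Sum>j\<in>UNIV. if 0 < \<beta> j then of_nat (Suc m - \<beta> j) * r \<alpha> (\<beta>(j := \<beta> j - 1)) else 0) * mpow w \<beta>)" for \<alpha>
      unfolding A_def sum_distrib_left sum_distrib_right
      by (subst (1 2) sum.swap) (simp only: sum_box_raise)
    have b: "(\<Sum>\<alpha>\<in>box m. r \<alpha> \<beta> * B \<alpha>) = (\<Sum>\<alpha>\<in>box m. (\<Sum>i\<in>UNIV. if \<alpha> i < m then of_nat (Suc (\<alpha> i) * (m - \<alpha> i)) * r (\<alpha>(i := Suc (\<alpha> i))) \<beta> else 0) * mpow z \<alpha>)" for \<beta>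
      unfolding B_def sum_distrib_left sum_distrib_right
      by (subst (1 2) sum.swap) (simp only: sum_box_lower[of "\<lambda>\<alpha>. r \<alpha> \<beta>"])
    have "(\<Sum>\<alpha>\<in>box m. (\<Sum>\<beta>\<in>box m. D \<alpha> \<beta> * mpow w \<beta>) * mpow z \<alpha>)
      = (\<Sum>\<alpha>\<in>box m. mpow z \<alpha> * (\<Sum>\<beta>\<in>box m. (\<Sum>j\<in>UNIV. if 0 < \<beta> j then of_nat (Suc m - \<beta> j) * r \<alpha> (\<beta>(j := \<beta> j - 1)) else 0) * mpow w \<beta>))
      - (\<Sum>\<beta>\<in>box m. mpow w \<beta> * (\<Sum>\<alpha>\<in>box m. (\<Sum>i\<in>UNIV. if \<alpha> i < m then of_nat (Suc (\<alpha> i) * (m - \<alpha> i)) * r (\<alpha>(i := Suc (\<alpha> i))) \<beta> else 0) * mpow z \<alpha>))"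
    proof -
      have sw: "(\<Sum>\<beta>\<in>box m. mpow w \<beta> * (\<Sum>\<alpha>\<in>box m. X \<alpha> \<beta> * mpow z \<alpha>)) = (\<Sum>\<alpha>\<in>box m. (\<Sum>\<beta>\<in>box m. X \<alpha> \<beta> * mpow w \<beta>) * mpow z \<alpha>)" for X
        unfolding sum_distrib_left sum_distrib_right by (subst sum.swap) (simp add: mult_ac)
      have df: "(\<Sum>\<alpha>\<in>box m. (\<Sum>\<beta>\<in>box m. (X \<alpha> \<beta> - Y \<alpha> \<beta>) * mpow w \<beta>) * mpow z \<alpha>)
        = (\<Sum>\<alpha>\<in>box m. mpow z \<alpha> * (\<Sum>\<beta>\<in>box m. X \<alpha> \<beta> * mpow w \<beta>)) - (\<Sum>\<alpha>\<in>box m. (\<Sum>\<beta>\<in>box m. Y \<alpha> \<beta> * mpow w \<beta>) * mpow z \<alpha>)" for X Y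
        unfolding left_diff_distrib sum_subtractf by (simp only: mult.commute[of "mpow z _"])
      show ?thesis unfolding sw D_def by (rule df)
    qed
    also have "\<dots> = (\<Sum>\<alpha>\<in>box m. mpow z \<alpha> * (\<Sum>\<beta>\<in>box m. r \<alpha> \<beta> * A \<beta>)) - (\<Sum>\<beta>\<in>box m. mpow w \<beta> * (\<Sum>\<alpha>\<in>box m. r \<alpha> \<beta> * B \<alpha>))"
      by (simp only: a b)
    also have "\<dots> = (\<Sum>\<alpha>\<in>box m. \<Sum>\<beta>\<in>box m. mpow z \<alpha> * A \<beta> * r \<alpha> \<beta>) - (\<Sum>\<alpha>\<in>box m. \<Sum>\<beta>\<in>box m. B \<alpha> * mpow w \<beta> * r \<alpha> \<beta>)"
      unfolding sum_distrib_left by (subst (3) sum.swap) (simp add: mult_ac)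
    also have "\<dots> = 0" using e by simp
    finally show ?thesis .
  qed
  \<comment> \<open>Coefficients are compared first in \<open>z\<close> for fixed \<open>w\<close>,
    then in \<open>w\<close>.\<close>
  have "(\<Sum>\<beta>\<in>box m. D \<alpha> \<beta> * mpow w \<beta>) = 0" if "inj (($) w)" for w
    by (rule mpow_coeffs_zero[where c="\<lambda>\<alpha>. \<Sum>\<beta>\<in>box m. D \<alpha> \<beta> * mpow w \<beta>", OF zero[OF _ that] ab(1)])
  then have "D \<alpha> \<beta> = 0"
    by (rule mpow_coeffs_zero[where c="D \<alpha>", OF _ ab(2)])
  then show ?thesis by (simp add: D_def)
qed

lemma R_N_identity_eq_pairing:
  fixes z w :: "complex^'k::finite"
  shows "R_N z w (mat 1 :: complex^'n::finite^'n) (mat 1) = pairing (charprod z :: complex^'n^'n \<Rightarrow> complex) (charprod w)"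
proof -
  have neg: "det (- A) = (-1) ^ CARD('n) * det A" for A :: "complex^'n^'n"
    unfolding det_def by (simp add: prod_uminus sum_distrib_left mult_ac)
  have "det (G - mat a) * det (H - mat b) = chi a G * chi b H" for G H :: "complex^'n^'n" and a b
    using neg[of "mat a - G"] neg[of "mat b - H"] by (simp add: chi_def mult_ac flip: power_add mult.assoc)
  then show ?thesis
    by (simp add: R_N_def ginibre_eq_gauss pairing_def charprod_def prod.distrib)
qed

text \<open>With the Vandermonde factors multiplied out, the identity holds without distinctness and
  is a comparison of expansions in monomials.\<close>

theorem R_N_identity_eq_det:
  fixes z w :: "complex^'k::{finite,linorder}"
  shows "vandermonde z * vandermonde w * R_N z w (mat 1 :: complex^'n::finite^'n) (mat 1)
    = (\<Prod>j=1..CARD('k). fact (CARD('n) + j - 1)) *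
      det (\<chi> i j. \<Sum>l=0..CARD('n) + CARD('k) - 1. (z $ i * w $ j) ^ l / fact l)"
proof -
  define m where "m = CARD('n) + CARD('k) - 1"
  define P where "P = (pairing :: (complex^'n^'n \<Rightarrow> complex) \<Rightarrow> (complex^'n^'n \<Rightarrow> complex) \<Rightarrow> complex)"
  interpret Stein_pairing P unfolding P_def by (rule Stein_pairing_pairing)
  define r where "r \<alpha> \<beta> = P (coefS \<alpha>) (coefS \<beta>)" for \<alpha> \<beta> :: "'k \<Rightarrow> nat"
  define F where "F \<alpha> = (\<Prod>i\<in>UNIV. fact (\<alpha> i) :: complex)" for \<alpha> :: "'k \<Rightarrow> nat"
  \<comment> \<open>In the recursion raising \<open>\<alpha> i\<close> carries an extra factor
    \<open>Suc (\<alpha> i)\<close>, which is exactly the change of \<open>F\<close>. Weighting the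
    left index absorbs it and leaves the same matrix on both sides.\<close>
  define rh where "rh \<alpha> \<beta> = r \<alpha> \<beta> * F \<alpha>" for \<alpha> \<beta>
  define \<rho> where "\<rho> = (\<Prod>j=1..CARD('k). fact (CARD('n) + j - 1) :: complex)"
  have F_nz: "F \<alpha> \<noteq> 0" for \<alpha> by (simp add: F_def)
  have F_Suc: "F (\<alpha>(i := Suc (\<alpha> i))) = of_nat (Suc (\<alpha> i)) * F \<alpha>" for \<alpha> i
  proof -
    have "F (\<alpha>(i := Suc (\<alpha> i))) = fact (Suc (\<alpha> i)) * (\<Prod>j\<in>UNIV - {i}. fact (\<alpha> j))"
      unfolding F_def by (subst prod.remove[of _ i]) (auto intro!: prod.cong)
    also have "F \<alpha> = fact (\<alpha> i) * (\<Prod>j\<in>UNIV - {i}. fact (\<alpha> j))"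
      unfolding F_def by (subst prod.remove[of _ i]) auto
    ultimately show ?thesis by (simp add: mult.assoc)
  qed
  have F_pred: "of_nat (\<alpha> i) * F (\<alpha>(i := \<alpha> i - 1)) = F \<alpha>" if "0 < \<alpha> i" for \<alpha> i
    using F_Suc[of "\<alpha>(i := \<alpha> i - 1)" i] that by (simp add: fun_upd_idem)
  have box: "\<alpha> \<in> box m" if "\<forall>i. \<alpha> i \<le> m" for \<alpha> :: "'k \<Rightarrow> nat" using that by auto
  have up: "intertwines m rh (raising m)"
    unfolding intertwines_def
  proof (intro allI impI)
    fix \<alpha> \<beta> :: "'k \<Rightarrow> nat" assume ab: "\<forall>i. \<alpha> i \<le> m" "\<forall>i. \<beta> i \<le> m"
    have "left_act m (raising m) rh \<alpha> \<beta>
      = F \<alpha> * (\<Sum>i\<in>UNIV. if \<alpha> i < m then of_nat (Suc (\<alpha> i) * (m - \<alpha> i)) * r (\<alpha>(i := Suc (\<alpha> i))) \<beta> else 0)"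
      unfolding act_raise(1) sum_distrib_left by (intro sum.cong refl) (simp add: rh_def F_Suc del: of_nat_Suc mult_Suc)
    also have "\<dots> = F \<alpha> * (\<Sum>j\<in>UNIV. if 0 < \<beta> j then of_nat (Suc m - \<beta> j) * r \<alpha> (\<beta>(j := \<beta> j - 1)) else 0)"
      using Stein_pairing_coefS_recursion[OF Stein_pairing_axioms m_def box[OF ab(1)] box[OF ab(2)]]
      by (simp only: r_def)
    also have "\<dots> = right_act m (raising m) rh \<alpha> \<beta>"
      unfolding act_raise(2)[OF ab(2)] sum_distrib_left
      by (intro sum.cong refl) (auto simp: rh_def mult_ac Suc_diff_le intro!: arg_cong[where f="\<lambda>x. _ * (_ * of_nat x)"])
    finally show "left_act m (raising m) rh \<alpha> \<beta>
      = right_act m (raising m) rh \<alpha> \<beta>" .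
  qed
  have down: "intertwines m rh (lowering m)"
    unfolding intertwines_def
  proof (intro allI impI)
    fix \<alpha> \<beta> :: "'k \<Rightarrow> nat" assume ab: "\<forall>i. \<alpha> i \<le> m" "\<forall>i. \<beta> i \<le> m"
    have "left_act m (lowering m) rh \<alpha> \<beta>
      = F \<alpha> * (\<Sum>i\<in>UNIV. if 0 < \<alpha> i then of_nat (Suc m - \<alpha> i) * r (\<alpha>(i := \<alpha> i - 1)) \<beta> else 0)"
      unfolding act_lower(2)[OF ab(1)] sum_distrib_left
    proof (rule sum.cong[OF refl])
      fix i
      show "(if 0 < \<alpha> i then of_nat (Suc (\<alpha> i - 1) * (m - (\<alpha> i - 1))) * rh (\<alpha>(i := \<alpha> i - 1)) \<beta> else 0)
        = F \<alpha> * (if 0 < \<alpha> i then of_nat (Suc m - \<alpha> i) * r (\<alpha>(i := \<alpha> i - 1)) \<beta> else 0)"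
      proof (cases "0 < \<alpha> i")
        case True
        then have e: "Suc (\<alpha> i - 1) = \<alpha> i" "m - (\<alpha> i - 1) = Suc m - \<alpha> i" by auto
        have Fa: "F \<alpha> = of_nat (\<alpha> i) * F (\<alpha>(i := \<alpha> i - 1))" using F_pred[of \<alpha> i] True by simp
        show ?thesis unfolding e rh_def Fa using True by simp
      qed simp
    qed
    also have "\<dots> = F \<alpha> * (\<Sum>j\<in>UNIV. if \<beta> j < m then of_nat (Suc (\<beta> j) * (m - \<beta> j)) * r \<alpha> (\<beta>(j := Suc (\<beta> j))) else 0)"
      \<comment> \<open>The recursion for the swapped form lowers the left index and raises the
        right one.\<close>
      using Stein_pairing_coefS_recursion[OF swapped m_def box[OF ab(2)] box[OF ab(1)]]
      by (simp only: r_def)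
    also have "\<dots> = right_act m (lowering m) rh \<alpha> \<beta>"
      unfolding act_lower(1) sum_distrib_left by (intro sum.cong refl) (simp add: rh_def mult_ac del: of_nat_Suc mult_Suc)
    finally show "left_act m (lowering m) rh \<alpha> \<beta>
      = right_act m (lowering m) rh \<alpha> \<beta>" .
  qed
  have left: "rh (\<alpha> \<circ> \<sigma>) \<beta> = of_int (sign \<sigma>) * rh \<alpha> \<beta>" if "\<sigma> permutes UNIV" for \<alpha> \<beta> \<sigma>
  proof -
    have "F (\<alpha> \<circ> \<sigma>) = F \<alpha>"
      unfolding F_def using prod.permute[OF that, of "\<lambda>i. fact (\<alpha> i) :: complex"] by (simp add: o_def)
    moreover have "coefS (\<alpha> \<circ> \<sigma>) = (\<lambda>G :: complex^'n^'n. of_int (sign \<sigma>) * coefS \<alpha> G)"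
      by (simp add: fun_eq_iff coefS_antisym[OF that])
    ultimately show ?thesis by (simp add: rh_def r_def cmult_left)
  qed
  have right: "rh \<alpha> (\<beta> \<circ> \<sigma>) = of_int (sign \<sigma>) * rh \<alpha> \<beta>" if "\<sigma> permutes UNIV" for \<alpha> \<beta> \<sigma>
  proof -
    have "coefS (\<beta> \<circ> \<sigma>) = (\<lambda>G :: complex^'n^'n. of_int (sign \<sigma>) * coefS \<beta> G)"
      by (simp add: fun_eq_iff coefS_antisym[OF that])
    then show ?thesis by (simp add: rh_def r_def cmult_right)
  qed
  have top: "rh \<alpha> \<alpha> = \<rho>" if inj: "inj \<alpha>" and range: "range \<alpha> = {Suc m - CARD('k)..m}" for \<alpha>
  proof -
    have mk: "Suc m = CARD('n) + CARD('k)"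
      using zero_less_card_finite[where 'a='k] by (simp add: m_def)
    then have e: "{Suc m - CARD('k)..m} = {CARD('n)..<CARD('n) + CARD('k)}"
      unfolding atLeastLessThanSuc_atLeastAtMost[symmetric] by simp
    obtain s where s: "s * s = 1" "\<And>G :: complex^'n^'n. coefS \<alpha> G = s"
      using coefS_top[OF inj, where 'n='n] range e by auto
    interpret prob_space "gauss :: (complex^'n^'n) measure" by (rule prob_space_gauss)
    have "r \<alpha> \<alpha> = 1" unfolding r_def P_def pairing_def s(2) using s(1) prob_space by simp
    \<comment> \<open>The top exponents are
      \<open>CARD('n), \<dots>, CARD('n) + CARD('k) - 1\<close>, so their factorials are the
      prefactor of the formula.\<close>
    moreover have "F \<alpha> = \<rho>"
    proof -
      have "F \<alpha> = (\<Prod>l\<in>range \<alpha>. fact l)" unfolding F_def by (simp add: prod.reindex[OF inj])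
      also have "\<dots> = \<rho>"
        unfolding range e \<rho>_def
        by (rule prod.reindex_bij_witness[of _ "\<lambda>j. CARD('n) + j - 1" "\<lambda>l. Suc l - CARD('n)"]) auto
      finally show ?thesis .
    qed
    ultimately show ?thesis by (simp add: rh_def)
  qed
  have rows: "(\<Sum>\<beta>\<in>box m. rh \<alpha> \<beta> * (\<Prod>j\<in>UNIV. (w $ j) ^ \<beta> j)) = \<rho> * det (\<chi> i j. (w $ j) ^ \<alpha> i)" if "\<alpha> \<in> box m" for \<alpha>
    by (rule row_sum_eq_det[OF up down left right top]) (use that in auto)
  have VF: "(\<lambda>G :: complex^'n^'n. vandermonde v * charprod v G) = (\<lambda>G. \<Sum>\<alpha>\<in>box m. mpow v \<alpha> * coefS \<alpha> G)" for v :: "complex^'k::{finite,linorder}"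
    using sum_coefS[OF m_def, of _ v] by (simp add: fun_eq_iff mult.commute)
  have "vandermonde z * vandermonde w * R_N z w (mat 1 :: complex^'n^'n) (mat 1)
    = P (\<lambda>G. vandermonde z * charprod z G) (\<lambda>G. vandermonde w * charprod w G)"
    by (simp add: cmult_left cmult_right R_N_identity_eq_pairing P_def[symmetric])
  also have "\<dots> = (\<Sum>\<alpha>\<in>box m. \<Sum>\<beta>\<in>box m. mpow z \<alpha> * (mpow w \<beta> * r \<alpha> \<beta>))"
    unfolding VF by (simp add: sum_left sum_right cmult_left cmult_right mat_poly_sum mat_poly.mult mat_poly.const coefS_mat_poly
        r_def sum_distrib_left)
  \<comment> \<open>Undoing the weight \<open>F\<close> is what puts \<open>1 / fact l\<close> into
    the truncated exponential series.\<close>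
  also have "\<dots> = (\<Sum>\<alpha>\<in>box m. mpow z \<alpha> / F \<alpha> * (\<Sum>\<beta>\<in>box m. rh \<alpha> \<beta> * (\<Prod>j\<in>UNIV. (w $ j) ^ \<beta> j)))"
    unfolding sum_distrib_left using F_nz by (intro sum.cong refl) (simp add: rh_def mpow_def[of w])
  also have "\<dots> = \<rho> * (\<Sum>\<alpha>\<in>box m. (\<Prod>i\<in>UNIV. (z $ i) ^ \<alpha> i / fact (\<alpha> i)) * det (\<chi> i j. (w $ j) ^ \<alpha> i))"
    unfolding sum_distrib_left[where r=\<rho>] by (intro sum.cong refl) (simp only: rows, simp add: mpow_def F_def prod_dividef)
  also have "\<dots> = \<rho> * det (\<chi> i j. \<Sum>l\<le>m. (z $ i) ^ l / fact l * (w $ j) ^ l)"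
    by (simp only: det_sum_rows)
  also have "(\<lambda>i j. \<Sum>l\<le>m. (z $ i) ^ l / fact l * (w $ j) ^ l) = (\<lambda>i j. \<Sum>l=0..CARD('n) + CARD('k) - 1. (z $ i * w $ j) ^ l / fact l)"
    unfolding m_def atLeast0AtMost by (simp add: power_mult_distrib)
  finally show ?thesis unfolding \<rho>_def .
qed

lemma vandermonde_nonzero:
  fixes z :: "complex^'k::{finite,linorder}"
  assumes "inj (($) z)"
  shows "vandermonde z \<noteq> 0"
  using assms unfolding vandermonde_def by (auto simp: inj_def dest: less_imp_neq)

theorem theorem1p1:
  fixes z w :: "complex^'k::{finite,linorder}"
    and \<Omega> \<Sigma> :: "complex^'n^'n"
  shows "((\<forall>j. z $ j \<noteq> 0 \<and> w $ j \<noteq> 0) \<longrightarrow>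
            R_N z w \<Omega> \<Sigma> =
              det (diag_mat z ** diag_mat w) ^ CARD('n) *
              (LINT X|ginibre. det (mat 1 +
                 kronecker (\<Omega> ** \<Sigma>)
                   (matrix_inv (diag_mat z) ** X ** matrix_inv (diag_mat w) ** conj_transpose X))))
       \<and> R_N z w (mat 1 :: complex^'n^'n) (mat 1) =
           1 / of_real pi ^ (CARD('k)\<^sup>2) *
           (LINT X|lborel. exp (- trace (X ** conj_transpose X)) *
              det (block_mat (diag_mat z) X (- conj_transpose X) (diag_mat w)) ^ CARD('n))
       \<and> (inj (($) z) \<and> inj (($) w) \<longrightarrow>
            1 / of_real pi ^ (CARD('k)\<^sup>2) *
            (LINT X|lborel. exp (- trace (X ** conj_transpose X)) *
               det (block_mat (diag_mat z) X (- conj_transpose X) (diag_mat w)) ^ CARD('n)) =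
            (\<Prod>j=1..CARD('k). fact (CARD('n) + j - 1)) *
            (det (\<chi> i j. \<Sum>l=0..CARD('n) + CARD('k) - 1. (z $ i * w $ j) ^ l / fact l) /
             (vandermonde z * vandermonde w)))"
proof (intro conjI impI)
  show "R_N z w \<Omega> \<Sigma> = det (diag_mat z ** diag_mat w) ^ CARD('n) *
      (LINT X|ginibre. det (mat 1 + kronecker (\<Omega> ** \<Sigma>)
        (matrix_inv (diag_mat z) ** X ** matrix_inv (diag_mat w) ** conj_transpose X)))"
    if "\<forall>j. z $ j \<noteq> 0 \<and> w $ j \<noteq> 0"
    using that by (intro R_N_dual_nonzero) auto
  show dual: "R_N z w (mat 1 :: complex^'n^'n) (mat 1) = 1 / of_real pi ^ (CARD('k)\<^sup>2) *
      (LINT X|lborel. exp (- trace (X ** conj_transpose X)) *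
        det (block_mat (diag_mat z) X (- conj_transpose X) (diag_mat w)) ^ CARD('n))"
    by (rule R_N_dual_identity)
  assume "inj (($) z) \<and> inj (($) w)"
  then have "vandermonde z \<noteq> 0" "vandermonde w \<noteq> 0" by (auto dest: vandermonde_nonzero)
  then show "1 / of_real pi ^ (CARD('k)\<^sup>2) * (LINT X|lborel. exp (- trace (X ** conj_transpose X)) *
        det (block_mat (diag_mat z) X (- conj_transpose X) (diag_mat w)) ^ CARD('n)) =
      (\<Prod>j=1..CARD('k). fact (CARD('n) + j - 1)) *
      (det (\<chi> i j. \<Sum>l=0..CARD('n) + CARD('k) - 1. (z $ i * w $ j) ^ l / fact l) / (vandermonde z * vandermonde w))"
    unfolding dual[symmetric] using R_N_identity_eq_det[of z w, where 'n='n] by (simp add: field_simps)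
qed

end
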